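(* Let $G=(V,E)$ be a (finite or infinite) graph without isolated edge, and let $L=\{L_v:v\in V\}\cup\{L_e:e\in E\}$ be a set of lists of positive integers such that $|L_v|=1$ for every vertex $v$ and $|L_e|\geq 5$ for every edge $e$. Then there exists an $L$-weighting of $G$.
   Context: Graphs are simple and may be infinite; an isolated edge is a connected component isomorphic to $K_2$. Each list is a finite subset of $\{1,\dots,k\}$ for some natural number $k$. A weighting of $G$ from $L$ is a function $\omega\colon V\cup E\to\mathbb{Z}_{>0}$ with $\omega(v)\in L_v$ for all $v\in V$ and $\omega(e)\in L_e$ for all $e\in E$. The weighted degree of a vertex $v$ is $s_\omega(v)=\sum_{w\in N(v)}\omega(vw)+\omega(v)$; if $v$ has infinite degree $\kappa$ this sum is the cardinal $\kappa$ (equal to the degree of $v$). An $L$-weighting of $G$ is a weighting $\omega$ from $L$ such that for every edge $uv$ of $G$, either $s_\omega(u)\neq s_\omega(v)$, or $u$ and $v$ have the same infinite degree. *)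

theory Defs
  imports Main
begin

definition simple_graph :: "'a set \<Rightarrow> ('a \<Rightarrow> 'a \<Rightarrow> bool) \<Rightarrow> bool" where
  "simple_graph V adj \<longleftrightarrow>
     (\<forall>u v. adj u v \<longrightarrow> u \<in> V \<and> v \<in> V) \<and>
     (\<forall>u v. adj u v \<longrightarrow> adj v u) \<and>
     (\<forall>u. \<not> adj u u)"

definition edges :: "('a \<Rightarrow> 'a \<Rightarrow> bool) \<Rightarrow> 'a set set" where
  "edges adj = {{u, v} | u v. adj u v}"

definition nbhd :: "('a \<Rightarrow> 'a \<Rightarrow> bool) \<Rightarrow> 'a \<Rightarrow> 'a set" where
  "nbhd adj v = {w. adj v w}"

definition no_isolated_edge :: "('a \<Rightarrow> 'a \<Rightarrow> bool) \<Rightarrow> bool" where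
  "no_isolated_edge adj \<longleftrightarrow>
     \<not> (\<exists>u v. adj u v \<and> nbhd adj u = {v} \<and> nbhd adj v = {u})"

definition is_list :: "nat set \<Rightarrow> bool" where
  "is_list S \<longleftrightarrow> finite S \<and> 0 \<notin> S"

text \<open>Weighted degree of a vertex of finite degree (natural number);
for vertices of infinite degree the weighted degree is the cardinal |N(v)|.\<close>
definition wsum :: "('a \<Rightarrow> 'a \<Rightarrow> bool) \<Rightarrow> ('a \<Rightarrow> nat) \<Rightarrow> ('a set \<Rightarrow> nat) \<Rightarrow> 'a \<Rightarrow> nat" where
  "wsum adj wv we v = (\<Sum>w\<in>nbhd adj v. we {v, w}) + wv v"

text \<open>Equality of weighted degrees, viewed as cardinals: finite ones are compared as
naturals, infinite ones as cardinals (the degree), and a finite one never equals an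
infinite one.\<close>
definition wdeg_eq :: "('a \<Rightarrow> 'a \<Rightarrow> bool) \<Rightarrow> ('a \<Rightarrow> nat) \<Rightarrow> ('a set \<Rightarrow> nat) \<Rightarrow> 'a \<Rightarrow> 'a \<Rightarrow> bool" where
  "wdeg_eq adj wv we u v \<longleftrightarrow>
     (if finite (nbhd adj u) \<and> finite (nbhd adj v) then wsum adj wv we u = wsum adj wv we v
      else if infinite (nbhd adj u) \<and> infinite (nbhd adj v)
      then (card_of (nbhd adj u), card_of (nbhd adj v)) \<in> ordIso
      else False)"

definition same_infinite_degree :: "('a \<Rightarrow> 'a \<Rightarrow> bool) \<Rightarrow> 'a \<Rightarrow> 'a \<Rightarrow> bool" where
  "same_infinite_degree adj u v \<longleftrightarrow>
     infinite (nbhd adj u) \<and> infinite (nbhd adj v) \<and>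
     (card_of (nbhd adj u), card_of (nbhd adj v)) \<in> ordIso"

definition weighting_from ::
  "'a set \<Rightarrow> ('a \<Rightarrow> 'a \<Rightarrow> bool) \<Rightarrow> ('a \<Rightarrow> nat set) \<Rightarrow> ('a set \<Rightarrow> nat set)
   \<Rightarrow> ('a \<Rightarrow> nat) \<Rightarrow> ('a set \<Rightarrow> nat) \<Rightarrow> bool" where
  "weighting_from V adj Lv Le wv we \<longleftrightarrow>
     (\<forall>v\<in>V. wv v \<in> Lv v) \<and> (\<forall>e\<in>edges adj. we e \<in> Le e)"

definition L_weighting ::
  "'a set \<Rightarrow> ('a \<Rightarrow> 'a \<Rightarrow> bool) \<Rightarrow> ('a \<Rightarrow> nat set) \<Rightarrow> ('a set \<Rightarrow> nat set)
   \<Rightarrow> ('a \<Rightarrow> nat) \<Rightarrow> ('a set \<Rightarrow> nat) \<Rightarrow> bool" where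
  "L_weighting V adj Lv Le wv we \<longleftrightarrow>
     weighting_from V adj Lv Le wv we \<and>
     (\<forall>u v. adj u v \<longrightarrow> \<not> wdeg_eq adj wv we u v \<or> same_infinite_degree adj u v)"

end

theory Submission imports Defs "HOL-Analysis.Analysis" begin

text \<open>
For a finite graph, a choice of edge weights \<open>x\<close> is proper when no factor of
\<open>\<Prod>\<^bsub>uv\<^esub> (s(u) - s(v))\<close> vanishes. By the combinatorial Nullstellensatz it is enough to find a
top-degree monomial with all exponents at most 4 and nonzero coefficient; up to factorials
that coefficient is a permanent whose rows are the edges and whose columns are the edges
of the monomial with multiplicity. Permanents are linear in each column, so the columns
may be replaced by linear combinations of edges (forms) as long as every edge occurs in
at most four of them.

Such forms are built by induction on the number of edges. A set \<open>J\<close> of labels, obtained from a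
maximum independent set, is chosen so that after deleting the edges at \<open>J\<close> only isolated
edges and a smaller graph without isolated edges remain. Restricted to the edges at \<open>J\<close> the
permanent is a coefficient of a product of linear forms in variables \<open>y\<^sub>w\<close>, \<open>w \<in> J\<close>. Nearly all forms
are \<open>y\<^sub>a \<plusminus> y\<^sub>b\<close>, each used twice, and
\<open>(y\<^sub>a + \<sigma> y\<^sub>b)\<^sup>2 / (y\<^sub>a y\<^sub>b) = \<sigma> \<bar>y\<^sub>a + \<sigma> y\<^sub>b\<bar>\<^sup>2\<close> on the unit circle; averaging over roots of unity
shows that the coefficient does not vanish.

Infinite graphs follow from the finite case by Tychonoff's theorem, since only edges between
vertices of finite degree impose a condition.
\<close>

section \<open>Permanents and the Nullstellensatz\<close>

text \<open>Four uses per edge are the whole budget, and squaring a form charges its edges twice. An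
  edge therefore fits into at most two squared forms: once as an arm that carries a label to an
  outside vertex, and once as a member of a set \<open>D\<close>, a join modulo 2 that links the
  vertices left with an odd number of labels. Edges inside \<open>J\<close> and edges that become
  isolated need further columns, each costing one more use; \<open>heavy\<close>, \<open>F0\<close>,
  \<open>Ex\<close> and \<open>free\<close> keep these extra uses off edges whose budget is already
  spent. Parity is the second obstacle. A join exists only for an even vertex set, so an odd set
  forces one unsquared form. Either a dummy token restores parity, or every label has a token of its
  own; then there are no triangles, and the use reserved for them pays for the single form. The
  independent set is maximal first in size and then in degree sum: size makes two private neighbours
  of a label adjacent, which produces the triangles, and the degree sum excludes a component with
  only one label.\<close>

text \<open>Expansion of a permanent along its rows \<open>ss\<close>; it is the permanent only if \<open>\<Phi>\<close>, the set of
columns, has exactly \<open>length ss\<close> elements.\<close>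

primrec perl :: "('r \<Rightarrow> 's \<Rightarrow> real) \<Rightarrow> 's list \<Rightarrow> 'r set \<Rightarrow> real" where
  "perl B [] \<Phi> = 1"
| "perl B (s # ss) \<Phi> = (\<Sum>r\<in>\<Phi>. B r s * perl B ss (\<Phi> - {r}))"

lemma perl_cong:
  assumes "\<And>r s. r \<in> \<Phi> \<Longrightarrow> s \<in> set ss \<Longrightarrow> B r s = B' r s"
  shows "perl B ss \<Phi> = perl B' ss \<Phi>"
  using assms
proof (induction ss arbitrary: \<Phi>)
  case (Cons s ss)
  have "perl B ss (\<Phi> - {r}) = perl B' ss (\<Phi> - {r})" for r
    by (rule Cons.IH) (use Cons.prems in auto)
  then show ?case using Cons.prems by (auto intro!: sum.cong)
qed simp

lemma perl_reindex:
  assumes "inj_on g \<Phi>"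
  shows "perl B ss (g ` \<Phi>) = perl (\<lambda>r. B (g r)) ss \<Phi>"
  using assms
proof (induction ss arbitrary: \<Phi>)
  case (Cons s ss)
  have "perl B ss (g ` \<Phi> - {g r}) = perl (\<lambda>r. B (g r)) ss (\<Phi> - {r})" if "r \<in> \<Phi>" for r
  proof -
    have "g ` \<Phi> - {g r} = g ` (\<Phi> - {r})"
      using Cons.prems that by (auto simp: inj_on_def)
    then show ?thesis
      using Cons.IH[of "\<Phi> - {r}"] Cons.prems by (simp add: inj_on_diff)
  qed
  then show ?case using Cons.prems by (simp add: sum.reindex)
qed simp

lemma perl_map: "perl B (map g ss) \<Phi> = perl (\<lambda>r s. B r (g s)) ss \<Phi>"
  by (induction ss arbitrary: \<Phi>) auto

text \<open>The rows \<open>ss2\<close> cannot use a column of \<open>\<Phi>1\<close>, and there are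
  exactly as many of them as columns in \<open>\<Phi>2\<close>; so they exhaust
  \<open>\<Phi>2\<close> and leave \<open>\<Phi>1\<close> to \<open>ss1\<close>.\<close>

lemma perl_append_block:
  assumes "finite \<Phi>1" "finite \<Phi>2" "\<Phi>1 \<inter> \<Phi>2 = {}" "card \<Phi>2 = length ss2"
    and "\<And>r s. r \<in> \<Phi>1 \<Longrightarrow> s \<in> set ss2 \<Longrightarrow> B r s = 0"
  shows "perl B (ss2 @ ss1) (\<Phi>1 \<union> \<Phi>2) = perl B ss2 \<Phi>2 * perl B ss1 \<Phi>1"
  using assms
proof (induction ss2 arbitrary: \<Phi>2)
  case (Cons s ss2)
  have "perl B ((s # ss2) @ ss1) (\<Phi>1 \<union> \<Phi>2)
      = (\<Sum>r\<in>\<Phi>1. B r s * perl B (ss2 @ ss1) (\<Phi>1 \<union> \<Phi>2 - {r}))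
      + (\<Sum>r\<in>\<Phi>2. B r s * perl B (ss2 @ ss1) (\<Phi>1 \<union> \<Phi>2 - {r}))"
    using Cons.prems by (simp add: sum.union_disjoint)
  also have "(\<Sum>r\<in>\<Phi>1. B r s * perl B (ss2 @ ss1) (\<Phi>1 \<union> \<Phi>2 - {r})) = 0"
    using Cons.prems by simp
  also have "(\<Sum>r\<in>\<Phi>2. B r s * perl B (ss2 @ ss1) (\<Phi>1 \<union> \<Phi>2 - {r}))
      = (\<Sum>r\<in>\<Phi>2. B r s * (perl B ss2 (\<Phi>2 - {r}) * perl B ss1 \<Phi>1))"
  proof (rule sum.cong[OF refl])
    fix r assume r: "r \<in> \<Phi>2"
    have "\<Phi>1 \<union> \<Phi>2 - {r} = \<Phi>1 \<union> (\<Phi>2 - {r})" using r Cons.prems(3) by auto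
    moreover have "perl B (ss2 @ ss1) (\<Phi>1 \<union> (\<Phi>2 - {r})) = perl B ss2 (\<Phi>2 - {r}) * perl B ss1 \<Phi>1"
      by (rule Cons.IH) (use Cons.prems r in auto)
    ultimately show "B r s * perl B (ss2 @ ss1) (\<Phi>1 \<union> \<Phi>2 - {r})
        = B r s * (perl B ss2 (\<Phi>2 - {r}) * perl B ss1 \<Phi>1)" by simp
  qed
  finally show ?case by (simp add: sum_distrib_right mult.assoc)
qed simp

lemma perl_row_linear:
  assumes "\<And>r. r \<in> \<Phi> \<Longrightarrow> B r s = \<alpha> * B r s1 + \<beta> * B r s2"
  shows "perl B (xs @ s # ys) \<Phi> = \<alpha> * perl B (xs @ s1 # ys) \<Phi> + \<beta> * perl B (xs @ s2 # ys) \<Phi>"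
  using assms
proof (induction xs arbitrary: \<Phi>)
  case Nil
  then show ?case by (simp add: sum_distrib_left algebra_simps flip: sum.distrib)
next
  case (Cons x xs)
  have "perl B (xs @ s # ys) (\<Phi> - {r})
     = \<alpha> * perl B (xs @ s1 # ys) (\<Phi> - {r}) + \<beta> * perl B (xs @ s2 # ys) (\<Phi> - {r})" for r
    by (rule Cons.IH) (use Cons.prems in auto)
  then show ?case by (simp add: sum_distrib_left algebra_simps flip: sum.distrib)
qed

text \<open>Every term of a genuine permanent contains exactly one entry of the column
  \<open>r0\<close>. The hypothesis on \<open>card \<Phi>\<close> ensures this: with more columns
  than rows, terms that avoid \<open>r0\<close> would break linearity.\<close>

lemma perl_form_linear:
  assumes "finite \<Phi>" "card \<Phi> = length ss" "r0 \<in> \<Phi>"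
    and "\<And>s. s \<in> set ss \<Longrightarrow> B r0 s = (\<Sum>e\<in>E. c e * A e s)"
  shows "perl B ss \<Phi> = (\<Sum>e\<in>E. c e * perl (B(r0 := A e)) ss \<Phi>)"
  using assms
proof (induction ss arbitrary: \<Phi>)
  case (Cons s ss)
  \<comment> \<open>Once the column \<open>r0\<close> is used up, redefining it has no
    effect.\<close>
  have 1: "perl B ss (\<Phi> - {r0}) = perl (B(r0 := A e)) ss (\<Phi> - {r0})" for e
    by (rule perl_cong) auto
  have 2: "perl B ss (\<Phi> - {r}) = (\<Sum>e\<in>E. c e * perl (B(r0 := A e)) ss (\<Phi> - {r}))"
    if "r \<in> \<Phi> - {r0}" for r
    by (rule Cons.IH) (use Cons.prems that in auto)
  have "perl B (s # ss) \<Phi> = B r0 s * perl B ss (\<Phi> - {r0})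
      + (\<Sum>r\<in>\<Phi> - {r0}. B r s * perl B ss (\<Phi> - {r}))"
    using Cons.prems by (simp add: sum.remove[of \<Phi> r0])
  also have "B r0 s * perl B ss (\<Phi> - {r0})
      = (\<Sum>e\<in>E. c e * (A e s * perl (B(r0 := A e)) ss (\<Phi> - {r0})))"
    using Cons.prems(4)[of s] by (simp add: sum_distrib_right mult.assoc flip: 1)
  also have "(\<Sum>r\<in>\<Phi> - {r0}. B r s * perl B ss (\<Phi> - {r}))
      = (\<Sum>r\<in>\<Phi> - {r0}. \<Sum>e\<in>E. c e * (B r s * perl (B(r0 := A e)) ss (\<Phi> - {r})))"
    by (rule sum.cong) (simp_all add: 2 sum_distrib_left mult_ac)
  also have "\<dots> = (\<Sum>e\<in>E. c e * (\<Sum>r\<in>\<Phi> - {r0}. B r s * perl (B(r0 := A e)) ss (\<Phi> - {r})))"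
    by (subst sum.swap) (simp add: sum_distrib_left)
  also have "(\<Sum>e\<in>E. c e * (A e s * perl (B(r0 := A e)) ss (\<Phi> - {r0})))
      + (\<Sum>e\<in>E. c e * (\<Sum>r\<in>\<Phi> - {r0}. B r s * perl (B(r0 := A e)) ss (\<Phi> - {r})))
      = (\<Sum>e\<in>E. c e * perl (B(r0 := A e)) (s # ss) \<Phi>)"
    using Cons.prems by (simp add: sum.remove[of \<Phi> r0] sum.distrib[symmetric] algebra_simps)
  finally show ?case .
qed simp

text \<open>A nonzero permanent of linear combinations has a nonzero term in its multilinear
  expansion, found here column by column. Demanding \<open>a r (\<kappa> r) \<noteq> 0\<close> keeps
  each selected edge in the support of its form, so that bounds on supports become bounds on
  multiplicities.\<close>

lemma perl_choose_forms:
  assumes "finite \<Phi>" "card \<Phi> = length ss"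
    and B: "\<And>r s. r \<in> \<Phi> \<Longrightarrow> s \<in> set ss \<Longrightarrow> B r s = (\<Sum>e\<in>E. a r e * A e s)"
    and "perl B ss \<Phi> \<noteq> 0"
  shows "\<exists>\<kappa>. (\<forall>r\<in>\<Phi>. \<kappa> r \<in> E \<and> a r (\<kappa> r) \<noteq> 0) \<and> perl (\<lambda>r. A (\<kappa> r)) ss \<Phi> \<noteq> 0"
proof -
  have "\<exists>\<kappa>. (\<forall>r\<in>\<Psi>. \<kappa> r \<in> E \<and> a r (\<kappa> r) \<noteq> 0) \<and>
        perl (\<lambda>r. if r \<in> \<Psi> then A (\<kappa> r) else B r) ss \<Phi> \<noteq> 0" if "finite \<Psi>" "\<Psi> \<subseteq> \<Phi>" for \<Psi>
    using that
  proof (induction \<Psi>)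
    case empty
    then show ?case using assms by simp
  next
    case (insert r0 \<Psi>)
    then obtain \<kappa> where \<kappa>: "\<forall>r\<in>\<Psi>. \<kappa> r \<in> E \<and> a r (\<kappa> r) \<noteq> 0"
      "perl (\<lambda>r. if r \<in> \<Psi> then A (\<kappa> r) else B r) ss \<Phi> \<noteq> 0" by auto
    have eq: "perl (\<lambda>r. if r \<in> \<Psi> then A (\<kappa> r) else B r) ss \<Phi>
      = (\<Sum>e\<in>E. a r0 e * perl ((\<lambda>r. if r \<in> \<Psi> then A (\<kappa> r) else B r)(r0 := A e)) ss \<Phi>)"
      by (rule perl_form_linear) (use assms insert in auto)
    from \<kappa>(2)[unfolded eq] obtain e where "e \<in> E"
      "a r0 e * perl ((\<lambda>r. if r \<in> \<Psi> then A (\<kappa> r) else B r)(r0 := A e)) ss \<Phi> \<noteq> 0"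
      by (rule sum.not_neutral_contains_not_neutral)
    then have e: "e \<in> E" "a r0 e \<noteq> 0"
      "perl ((\<lambda>r. if r \<in> \<Psi> then A (\<kappa> r) else B r)(r0 := A e)) ss \<Phi> \<noteq> 0" by auto
    have "(\<lambda>r. if r \<in> \<Psi> then A (\<kappa> r) else B r)(r0 := A e)
        = (\<lambda>r. if r \<in> insert r0 \<Psi> then A ((\<kappa>(r0 := e)) r) else B r)"
      by auto
    then show ?case using \<kappa> e insert.hyps by (intro exI[of _ "\<kappa>(r0 := e)"]) auto
  qed
  from this[of \<Phi>] obtain \<kappa> where \<kappa>: "\<forall>r\<in>\<Phi>. \<kappa> r \<in> E \<and> a r (\<kappa> r) \<noteq> 0"
    "perl (\<lambda>r. if r \<in> \<Phi> then A (\<kappa> r) else B r) ss \<Phi> \<noteq> 0" using assms by auto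
  have "perl (\<lambda>r. if r \<in> \<Phi> then A (\<kappa> r) else B r) ss \<Phi> = perl (\<lambda>r. A (\<kappa> r)) ss \<Phi>"
    by (rule perl_cong) auto
  then show ?thesis using \<kappa> by auto
qed

text \<open>The coefficient of \<open>\<Prod>e\<in>E. x\<^sub>e ^ K e\<close> in \<open>\<Prod>s\<leftarrow>ss. \<Sum>e\<in>E. A e s * x\<^sub>e\<close>.\<close>

primrec mcoef :: "'e set \<Rightarrow> ('e \<Rightarrow> 's \<Rightarrow> real) \<Rightarrow> 's list \<Rightarrow> ('e \<Rightarrow> nat) \<Rightarrow> real" where
  "mcoef E A [] K = 1"
| "mcoef E A (s # ss) K =
     (\<Sum>e\<in>E. if K e > 0 then A e s * mcoef E A ss (K(e := K e - 1)) else 0)"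


text \<open>With \<open>K e\<close> equal columns for each \<open>e\<close>, every way of producing
  the monomial occurs once for each ordering of equal columns, whence the factorials.\<close>

lemma perl_eq_mcoef:
  assumes "finite E" "finite \<Phi>" "card \<Phi> = length ss" "\<kappa> ` \<Phi> \<subseteq> E"
  shows "perl (\<lambda>r. A (\<kappa> r)) ss \<Phi>
    = (\<Prod>e\<in>E. fact (card {r\<in>\<Phi>. \<kappa> r = e})) * mcoef E A ss (\<lambda>e. card {r\<in>\<Phi>. \<kappa> r = e})"
  using assms(2-)
proof (induction ss arbitrary: \<Phi>)
  case (Cons s ss)
  define K where "K = (\<lambda>\<Phi> e. card {r\<in>\<Phi>. \<kappa> r = e})"
  define pf where "pf = (\<lambda>K::_ \<Rightarrow> nat. \<Prod>e\<in>E. fact (K e) :: real)"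
  have KK: "K (\<Phi> - {r}) = (K \<Phi>)(\<kappa> r := K \<Phi> (\<kappa> r) - 1)" and Kpos: "K \<Phi> (\<kappa> r) > 0" if "r \<in> \<Phi>" for r
  proof
    fix e
    show "K (\<Phi> - {r}) e = ((K \<Phi>)(\<kappa> r := K \<Phi> (\<kappa> r) - 1)) e"
    proof (cases "e = \<kappa> r")
      case True
      have "{r'\<in>\<Phi> - {r}. \<kappa> r' = e} = {r'\<in>\<Phi>. \<kappa> r' = e} - {r}" by auto
      then show ?thesis using True that Cons.prems by (simp add: K_def)
    next
      case False
      then have "{r'\<in>\<Phi> - {r}. \<kappa> r' = e} = {r'\<in>\<Phi>. \<kappa> r' = e}" by auto
      then show ?thesis using False by (simp add: K_def)
    qed
  next
    show "K \<Phi> (\<kappa> r) > 0" unfolding K_def using that Cons.prems by (auto simp: card_gt_0_iff)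
  qed
  have pf: "real (K \<Phi> e) * pf ((K \<Phi>)(e := K \<Phi> e - 1)) = pf (K \<Phi>)" if "e \<in> E" "K \<Phi> e > 0" for e
  proof -
    have "pf (K \<Phi>) = fact (K \<Phi> e) * (\<Prod>e\<in>E - {e}. fact (K \<Phi> e))"
      unfolding pf_def using assms that by (simp add: prod.remove)
    moreover have "pf ((K \<Phi>)(e := K \<Phi> e - 1)) = fact (K \<Phi> e - 1) * (\<Prod>e\<in>E - {e}. fact (K \<Phi> e))"
      unfolding pf_def using assms that by (simp add: prod.remove[of E e])
    moreover have "(fact (K \<Phi> e) :: real) = K \<Phi> e * fact (K \<Phi> e - 1)"
      using that by (simp add: fact_reduce)
    ultimately show ?thesis by simp
  qed
  have "perl (\<lambda>r. A (\<kappa> r)) (s # ss) \<Phi>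
     = (\<Sum>r\<in>\<Phi>. A (\<kappa> r) s * (pf (K (\<Phi> - {r})) * mcoef E A ss (K (\<Phi> - {r}))))"
    unfolding perl.simps
  proof (rule sum.cong[OF refl])
    fix r assume "r \<in> \<Phi>"
    then show "A (\<kappa> r) s * perl (\<lambda>r. A (\<kappa> r)) ss (\<Phi> - {r})
       = A (\<kappa> r) s * (pf (K (\<Phi> - {r})) * mcoef E A ss (K (\<Phi> - {r})))"
      using Cons.IH[of "\<Phi> - {r}"] Cons.prems unfolding pf_def K_def by auto
  qed
  also have "\<dots> = (\<Sum>r\<in>\<Phi>. (\<lambda>e. A e s * (pf ((K \<Phi>)(e := K \<Phi> e - 1)) * mcoef E A ss ((K \<Phi>)(e := K \<Phi> e - 1)))) (\<kappa> r))"
    by (rule sum.cong) (simp_all add: KK)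
  \<comment> \<open>Grouping the columns by their edge yields the factor \<open>K \<Phi> e\<close>,
    which \<open>pf\<close> absorbs into the factorial.\<close>
  also have "\<dots> = (\<Sum>e\<in>E. real (K \<Phi> e) * (A e s * (pf ((K \<Phi>)(e := K \<Phi> e - 1)) * mcoef E A ss ((K \<Phi>)(e := K \<Phi> e - 1)))))"
    using Cons.prems assms(1) by (subst sum.group[symmetric, of \<Phi> E \<kappa>]) (auto simp: K_def intro!: sum.cong)
  also have "\<dots> = (\<Sum>e\<in>E. pf (K \<Phi>) * (if K \<Phi> e > 0 then A e s * mcoef E A ss ((K \<Phi>)(e := K \<Phi> e - 1)) else 0))"
    by (rule sum.cong[OF refl]) (auto simp: mult_ac simp flip: pf)
  also have "\<dots> = pf (K \<Phi>) * mcoef E A (s # ss) (K \<Phi>)"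
    by (simp add: sum_distrib_left)
  finally show ?case unfolding pf_def K_def .
qed simp

section \<open>The combinatorial Nullstellensatz by divided differences\<close>

text \<open>These are the weights of the divided difference of order \<open>k\<close> at the points
  of \<open>T\<close>: the functional kills lower powers and reads off the coefficient of
  \<open>t ^ k\<close>. Higher powers are left uncontrolled.\<close>

lemma divided_difference_weights:
  assumes "finite (T::real set)" "card T = Suc k"
  shows "\<exists>l. \<forall>j\<le>k. (\<Sum>t\<in>T. l t * t ^ j) = (if j = k then 1 else 0)"
  using assms
proof (induction k arbitrary: T)
  case 0
  then obtain a where "T = {a}" by (auto simp: card_1_singleton_iff)
  then show ?case by (intro exI[of _ "\<lambda>_. 1"]) auto
next
  case (Suc k)
  then obtain a T' where T: "T = insert a T'" "a \<notin> T'" "card T' = Suc k" "finite T'"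
    by (metis card_Suc_eq finite_insert)
  then obtain l where l: "\<And>j. j \<le> k \<Longrightarrow> (\<Sum>t\<in>T'. l t * t ^ j) = (if j = k then 1 else 0)"
    using Suc.IH by blast
  \<comment> \<open>dividing by \<open>t - a\<close> raises the order of a divided difference by one\<close>
  define m where "m = (\<lambda>t. if t = a then - (\<Sum>t\<in>T'. l t / (t - a)) else l t / (t - a))"
  have m0: "(\<Sum>t\<in>T. m t) = 0"
  proof -
    have "(\<Sum>t\<in>T'. m t) = (\<Sum>t\<in>T'. l t / (t - a))"
      using T by (intro sum.cong) (auto simp: m_def)
    then show ?thesis using T by (simp add: m_def)
  qed
  \<comment> \<open>Write \<open>t = (t - a) + a\<close>; the factor \<open>t - a\<close> cancels
    the division and removes the point \<open>a\<close>.\<close>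
  have mS: "(\<Sum>t\<in>T. m t * t ^ Suc j) = (\<Sum>t\<in>T'. l t * t ^ j) + a * (\<Sum>t\<in>T. m t * t ^ j)" for j
  proof -
    have "(\<Sum>t\<in>T. m t * t ^ Suc j) = (\<Sum>t\<in>T. m t * (t - a) * t ^ j) + a * (\<Sum>t\<in>T. m t * t ^ j)"
      by (simp add: sum_distrib_left algebra_simps flip: sum.distrib)
    also have "(\<Sum>t\<in>T. m t * (t - a) * t ^ j) = (\<Sum>t\<in>T'. m t * (t - a) * t ^ j)"
      using T by simp
    also have "\<dots> = (\<Sum>t\<in>T'. l t * t ^ j)"
      using T by (intro sum.cong) (auto simp: m_def)
    finally show ?thesis .
  qed
  have "(\<Sum>t\<in>T. m t * t ^ j) = (if j = Suc k then 1 else 0)" if "j \<le> Suc k" for j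
    using that
  proof (induction j)
    case 0
    then show ?case using m0 by simp
  next
    case (Suc j)
    then show ?case unfolding mS using l[of j] by simp
  qed
  then show ?case by blast
qed

text \<open>Divided differences in all variables at once extract one coefficient from a polynomial
  of degree at most \<open>\<Sum>e\<in>E. K e\<close>. The factor with exponents \<open>n\<close>
  stores the variables already picked, so that the induction on \<open>ss\<close> can
  proceed.\<close>

lemma grid_moment:
  fixes A :: "'e \<Rightarrow> 's \<Rightarrow> real"
  assumes "finite E" and "\<And>e. e \<in> E \<Longrightarrow> finite (T e)"
    and l: "\<And>e j. e \<in> E \<Longrightarrow> j \<le> K e \<Longrightarrow> (\<Sum>t\<in>T e. l e t * t ^ j) = (if j = K e then 1 else 0)"
    and "(\<Sum>e\<in>E. n e) + length ss \<le> (\<Sum>e\<in>E. K e)"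
  shows "(\<Sum>x\<in>PiE E T. (\<Prod>e\<in>E. l e (x e) * x e ^ n e) * (\<Prod>s\<leftarrow>ss. (\<Sum>e\<in>E. A e s * x e) + c s))
    = (if (\<Sum>e\<in>E. n e) + length ss = (\<Sum>e\<in>E. K e) \<and> (\<forall>e\<in>E. n e \<le> K e)
       then mcoef E A ss (\<lambda>e. K e - n e) else 0)"
  using assms(4)
proof (induction ss arbitrary: n)
  case Nil
  have eq: "(\<Sum>x\<in>PiE E T. (\<Prod>e\<in>E. l e (x e) * x e ^ n e)) = (\<Prod>e\<in>E. \<Sum>t\<in>T e. l e t * t ^ n e)"
    using assms by (simp add: prod_sum_PiE)
  show ?case
  \<comment> \<open>The degree bound leaves two cases: some exponent falls short of \<open>K\<close>
    and its moment vanishes, or all exponents equal those of \<open>K\<close>. An exponent above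
    \<open>K\<close>, whose moment is unknown, cannot occur without a short one.\<close>
  proof (cases "\<exists>e\<in>E. n e < K e")
    case True
    then obtain e where "e \<in> E" "n e < K e" by auto
    then have "(\<Prod>e\<in>E. \<Sum>t\<in>T e. l e t * t ^ n e) = 0"
      using l[of e "n e"] assms(1) by (intro prod_zero) (auto intro!: bexI[of _ e])
    moreover have "\<not> ((\<Sum>e\<in>E. n e) = (\<Sum>e\<in>E. K e) \<and> (\<forall>e\<in>E. n e \<le> K e))"
      using \<open>e \<in> E\<close> \<open>n e < K e\<close> assms(1) sum_strict_mono_ex1[of E n K] by fastforce
    ultimately show ?thesis using eq by simp
  next
    case False
    then have "\<forall>e\<in>E. K e \<le> n e" by force
    with Nil have "(\<Sum>e\<in>E. n e) = (\<Sum>e\<in>E. K e)"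
      by (simp add: antisym sum_mono)
    have "n e = K e" if "e \<in> E" for e
    proof (rule ccontr)
      assume "n e \<noteq> K e"
      with that \<open>\<forall>e\<in>E. K e \<le> n e\<close> have "(\<Sum>e\<in>E. K e) < (\<Sum>e\<in>E. n e)"
        using assms(1) by (intro sum_strict_mono_ex1) (auto intro!: bexI[of _ e])
      with \<open>(\<Sum>e\<in>E. n e) = (\<Sum>e\<in>E. K e)\<close> show False by simp
    qed
    then have "(\<Prod>e\<in>E. \<Sum>t\<in>T e. l e t * t ^ n e) = 1"
      using l by (intro prod.neutral) auto
    then show ?thesis using eq \<open>\<And>e. e \<in> E \<Longrightarrow> n e = K e\<close> by simp
  qed
next
  case (Cons s ss)
  define M where "M = (\<lambda>n. \<Sum>x\<in>PiE E T. (\<Prod>e\<in>E. l e (x e) * x e ^ n e) * (\<Prod>s\<leftarrow>ss. (\<Sum>e\<in>E. A e s * x e) + c s))"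
  have raise: "(\<Prod>e\<in>E. l e (x e) * x e ^ n e) * x e0 = (\<Prod>e\<in>E. l e (x e) * x e ^ (n(e0 := Suc (n e0))) e)"
    if "e0 \<in> E" for e0 and x :: "'e \<Rightarrow> real"
    using that assms(1) by (simp add: prod.remove[of E e0] mult_ac)
  have sumn: "(\<Sum>e\<in>E. (n(e0 := Suc (n e0))) e) = Suc (\<Sum>e\<in>E. n e)" if "e0 \<in> E" for e0
    using that assms(1) by (simp add: sum.remove[of E e0])
  have "(\<Sum>x\<in>PiE E T. (\<Prod>e\<in>E. l e (x e) * x e ^ n e) * (\<Prod>s\<leftarrow>s # ss. (\<Sum>e\<in>E. A e s * x e) + c s))
     = (\<Sum>x\<in>PiE E T. (\<Sum>e0\<in>E. A e0 s * (((\<Prod>e\<in>E. l e (x e) * x e ^ n e) * x e0) * (\<Prod>s\<leftarrow>ss. (\<Sum>e\<in>E. A e s * x e) + c s)))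
        + c s * ((\<Prod>e\<in>E. l e (x e) * x e ^ n e) * (\<Prod>s\<leftarrow>ss. (\<Sum>e\<in>E. A e s * x e) + c s)))"
    by (rule sum.cong[OF refl]) (simp add: sum_distrib_left sum_distrib_right algebra_simps)
  also have "\<dots> = (\<Sum>e0\<in>E. A e0 s * M (n(e0 := Suc (n e0)))) + c s * M n"
    unfolding sum.distrib M_def
    by (subst sum.swap) (simp add: sum_distrib_left raise cong: sum.cong)
  \<comment> \<open>Picking the constant \<open>c s\<close> leaves the degree strictly below the
    bound, where the moment is zero.\<close>
  also have "M n = 0" unfolding M_def using Cons.prems by (subst Cons.IH) auto
  also have "(\<Sum>e0\<in>E. A e0 s * M (n(e0 := Suc (n e0)))) + c s * 0
     = (if (\<Sum>e\<in>E. n e) + length (s # ss) = (\<Sum>e\<in>E. K e) \<and> (\<forall>e\<in>E. n e \<le> K e)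
       then mcoef E A (s # ss) (\<lambda>e. K e - n e) else 0)"
  proof -
    have M: "M (n(e0 := Suc (n e0))) = (if (\<Sum>e\<in>E. n e) + length (s # ss) = (\<Sum>e\<in>E. K e)
         \<and> (\<forall>e\<in>E. n e \<le> K e) \<and> n e0 < K e0 then mcoef E A ss ((\<lambda>e. K e - n e)(e0 := K e0 - n e0 - 1)) else 0)"
      if e0: "e0 \<in> E" for e0
    proof -
      have *: "(\<forall>e\<in>E. (n(e0 := Suc (n e0))) e \<le> K e) \<longleftrightarrow> (\<forall>e\<in>E. n e \<le> K e) \<and> n e0 < K e0"
      proof (intro iffI conjI ballI)
        fix e assume "\<forall>e\<in>E. (n(e0 := Suc (n e0))) e \<le> K e" "e \<in> E"
        then show "n e \<le> K e" by (cases "e = e0") auto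
      next
        assume "\<forall>e\<in>E. (n(e0 := Suc (n e0))) e \<le> K e"
        then show "n e0 < K e0" using e0 by auto
      next
        fix e assume "(\<forall>e\<in>E. n e \<le> K e) \<and> n e0 < K e0" "e \<in> E"
        then show "(n(e0 := Suc (n e0))) e \<le> K e" by (cases "e = e0") auto
      qed
      have K: "(\<lambda>e. K e - (n(e0 := Suc (n e0))) e) = (\<lambda>e. K e - n e)(e0 := K e0 - n e0 - 1)"
        by auto
      have le: "(\<Sum>e\<in>E. (n(e0 := Suc (n e0))) e) + length ss \<le> (\<Sum>e\<in>E. K e)"
        using Cons.prems by (simp only: sumn[OF e0]) simp
      show ?thesis
        unfolding M_def Cons.IH[OF le] * K sumn[OF e0] by simp
    qed
    show ?thesis
    proof (cases "(\<Sum>e\<in>E. n e) + length (s # ss) = (\<Sum>e\<in>E. K e) \<and> (\<forall>e\<in>E. n e \<le> K e)")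
      case True
      then show ?thesis by (auto simp: M intro!: sum.cong)
    next
      case False
      then have 0: "M (n(e0 := Suc (n e0))) = 0" if "e0 \<in> E" for e0
        unfolding M[OF that] by meson
      show ?thesis unfolding if_not_P[OF False] by (simp add: 0)
    qed
  qed
  finally show ?case .
qed

text \<open>If the product vanished on the whole grid, so would its weighted sum over the subgrid
  \<open>T\<close>, but that sum is a nonzero coefficient.\<close>

lemma nonvanishing_on_grid:
  fixes S :: "'e \<Rightarrow> real set"
  assumes "finite E" "finite \<Phi>" "card \<Phi> = length ss" "\<kappa> ` \<Phi> \<subseteq> E"
    and S: "\<And>e. e \<in> E \<Longrightarrow> finite (S e) \<and> card {r\<in>\<Phi>. \<kappa> r = e} < card (S e)"
    and nz: "perl (\<lambda>r. A (\<kappa> r)) ss \<Phi> \<noteq> 0"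
  shows "\<exists>x. (\<forall>e\<in>E. x e \<in> S e) \<and> (\<forall>s\<in>set ss. (\<Sum>e\<in>E. A e s * x e) + c s \<noteq> 0)"
proof -
  define K where "K e = card {r\<in>\<Phi>. \<kappa> r = e}" for e
  have "\<exists>T l. T \<subseteq> S e \<and> finite T \<and> (\<forall>j\<le>K e. (\<Sum>t\<in>T. l t * t ^ j) = (if j = K e then 1 else 0))"
    if e: "e \<in> E" for e
  proof -
    obtain T where T: "T \<subseteq> S e" "card T = Suc (K e)" "finite T"
      using S[OF e] obtain_subset_with_card_n[of "Suc (K e)" "S e"] unfolding K_def by auto
    then show ?thesis using divided_difference_weights[of T "K e"] by blast
  qed
  then obtain T l where T: "\<And>e. e \<in> E \<Longrightarrow> T e \<subseteq> S e \<and> finite (T e)"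
    and l: "\<And>e j. e \<in> E \<Longrightarrow> j \<le> K e \<Longrightarrow> (\<Sum>t\<in>T e. l e t * t ^ j) = (if j = K e then 1 else 0)"
    by metis
  have "(\<Sum>e\<in>E. K e) = card \<Phi>"
    unfolding K_def using sum.group[of \<Phi> E \<kappa> "\<lambda>_. 1::nat"] assms by simp
  moreover have "mcoef E A ss K \<noteq> 0"
    using nz perl_eq_mcoef[OF assms(1-4)] unfolding K_def by auto
  ultimately have "(\<Sum>x\<in>PiE E T. (\<Prod>e\<in>E. l e (x e) * x e ^ 0) * (\<Prod>s\<leftarrow>ss. (\<Sum>e\<in>E. A e s * x e) + c s)) \<noteq> 0"
    using grid_moment[of E T K l "\<lambda>_. 0" ss A c] T l assms by simp
  then obtain x where "x \<in> PiE E T"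
    "(\<Prod>e\<in>E. l e (x e) * x e ^ 0) * (\<Prod>s\<leftarrow>ss. (\<Sum>e\<in>E. A e s * x e) + c s) \<noteq> 0"
    by (rule sum.not_neutral_contains_not_neutral)
  then have x: "x \<in> PiE E T" "(\<Prod>s\<leftarrow>ss. (\<Sum>e\<in>E. A e s * x e) + c s) \<noteq> 0" by auto
  then show ?thesis using T by (intro exI[of _ x]) (auto simp: prod_list_zero_iff PiE_def Pi_def)
qed


section \<open>Differences along edges and the property \<open>good\<close>\<close>

text \<open>An arbitrary orientation of an edge. Reversing it changes only the sign of one row of
  the permanent.\<close>

definition hdv :: "'a set \<Rightarrow> 'a" where "hdv s = (SOME v. v \<in> s)"
definition tlv :: "'a set \<Rightarrow> 'a" where "tlv s = (SOME v. v \<in> s \<and> v \<noteq> hdv s)"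

lemma hdv_tlv:
  assumes "card s = 2"
  shows "hdv s \<noteq> tlv s" "s = {hdv s, tlv s}"
proof -
  obtain u v where uv: "s = {u, v}" "u \<noteq> v" using assms by (auto simp: card_2_iff)
  have h: "hdv s \<in> s" unfolding hdv_def using uv by (intro someI[of "\<lambda>v. v \<in> s" u]) auto
  have "\<exists>v. v \<in> s \<and> v \<noteq> hdv s" using uv by (metis insertCI)
  then have "tlv s \<in> s \<and> tlv s \<noteq> hdv s" unfolding tlv_def by (rule someI_ex)
  then show "hdv s \<noteq> tlv s" by metis
  have "hdv s = u \<and> tlv s = v \<or> hdv s = v \<and> tlv s = u"
    using h \<open>tlv s \<in> s \<and> tlv s \<noteq> hdv s\<close> uv(1) by (metis insertE singletonD)
  then show "s = {hdv s, tlv s}" using uv(1) by (metis insert_commute)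
qed

definition rowdiff :: "'a set \<Rightarrow> ('a \<Rightarrow> real) \<Rightarrow> real" where
  "rowdiff s f = f (hdv s) - f (tlv s)"

definition ind :: "'a set \<Rightarrow> 'a \<Rightarrow> real" where "ind e v = of_bool (v \<in> e)"

lemma rowdiff_sum: "rowdiff s (\<lambda>v. \<Sum>e\<in>E. a e * f e v) = (\<Sum>e\<in>E. a e * rowdiff s (f e))"
  unfolding rowdiff_def by (simp add: sum_subtractf right_diff_distrib)

text \<open>The rows are the differences of vertex sums along the edges, the columns are edges, each
used at most four times.\<close>

definition good :: "'a set set \<Rightarrow> bool" where
  "good E \<longleftrightarrow> (\<exists>(\<kappa> :: nat \<Rightarrow> 'a set) ss. distinct ss \<and> set ss = E \<and> \<kappa> ` {..<length ss} \<subseteq> E \<and>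
     (\<forall>e\<in>E. card {r\<in>{..<length ss}. \<kappa> r = e} \<le> 4) \<and>
     perl (\<lambda>r s. rowdiff s (ind (\<kappa> r))) ss {..<length ss} \<noteq> 0)"

lemma good_empty: "good {}"
  unfolding good_def by (intro exI[of _ "\<lambda>_. {}"] exI[of _ "[]"]) auto

text \<open>Lets forms stand in for edges: some selection of one edge from each form gives a nonzero
  permanent, and an edge is selected at most as often as it lies in a support. The columns may have
  any index type; a bijection renumbers them for \<open>good\<close>.\<close>

lemma goodI:
  fixes \<Phi> :: "'r set" and f :: "'r \<Rightarrow> 'a \<Rightarrow> real"
  assumes "finite \<Phi>" "card \<Phi> = length ss" "distinct ss" "set ss = E"
    and f: "\<And>r. r \<in> \<Phi> \<Longrightarrow> f r = (\<lambda>v. \<Sum>e\<in>E. a r e * ind e v)"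
    and load: "\<And>e. e \<in> E \<Longrightarrow> card {r\<in>\<Phi>. a r e \<noteq> 0} \<le> 4"
    and nz: "perl (\<lambda>r s. rowdiff s (f r)) ss \<Phi> \<noteq> 0"
  shows "good E"
proof -
  have "\<exists>\<kappa>. (\<forall>r\<in>\<Phi>. \<kappa> r \<in> E \<and> a r (\<kappa> r) \<noteq> 0) \<and> perl (\<lambda>r. (\<lambda>e s. rowdiff s (ind e)) (\<kappa> r)) ss \<Phi> \<noteq> 0"
  proof (rule perl_choose_forms[OF assms(1,2) _ nz])
    fix r s assume "r \<in> \<Phi>"
    then show "rowdiff s (f r) = (\<Sum>e\<in>E. a r e * rowdiff s (ind e))"
      by (simp add: f rowdiff_sum)
  qed
  then obtain \<kappa> where \<kappa>: "\<And>r. r \<in> \<Phi> \<Longrightarrow> \<kappa> r \<in> E \<and> a r (\<kappa> r) \<noteq> 0"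
    and nz': "perl (\<lambda>r s. rowdiff s (ind (\<kappa> r))) ss \<Phi> \<noteq> 0" by auto
  obtain g where g: "bij_betw g {..<length ss} \<Phi>"
    using assms(1,2) by (metis bij_betw_from_nat_into_finite ex_bij_betw_nat_finite lessThan_atLeast0)
  have "card {r\<in>{..<length ss}. \<kappa> (g r) = e} \<le> 4" if e: "e \<in> E" for e
  proof -
    have "card {r\<in>{..<length ss}. \<kappa> (g r) = e} = card (g ` {r\<in>{..<length ss}. \<kappa> (g r) = e})"
      using g by (intro card_image[symmetric]) (auto simp: bij_betw_def inj_on_def)
    also have "\<dots> \<le> card {r\<in>\<Phi>. a r e \<noteq> 0}"
      using g \<kappa> assms(1) by (intro card_mono) (auto simp: bij_betw_def)
    finally show ?thesis using load[OF e] by simp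
  qed
  moreover have "perl (\<lambda>r s. rowdiff s (ind (\<kappa> (g r)))) ss {..<length ss} \<noteq> 0"
    using nz' perl_reindex[of g "{..<length ss}" "\<lambda>r s. rowdiff s (ind (\<kappa> r))" ss] g
    by (simp add: bij_betw_def)
  moreover have "(\<lambda>r. \<kappa> (g r)) ` {..<length ss} \<subseteq> E"
    using g \<kappa> by (auto simp: bij_betw_def)
  ultimately show ?thesis unfolding good_def using assms(3,4)
    by (intro exI[of _ "\<lambda>r. \<kappa> (g r)"] exI[of _ ss]) blast
qed

text \<open>The forms of \<open>E1\<close> vanish on the rows of \<open>E2\<close>, so the matrix is
  block triangular, whatever the columns of \<open>E2\<close> do on the rows of \<open>E1\<close>.
  This lets one block be peeled off the graph.\<close>

lemma good_union:
  fixes \<Phi> :: "'r set" and f :: "'r \<Rightarrow> 'a \<Rightarrow> real"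
  assumes "finite \<Phi>" "card \<Phi> = length ss" "distinct ss" "set ss = E1"
    and f: "\<And>r. r \<in> \<Phi> \<Longrightarrow> f r = (\<lambda>v. \<Sum>e\<in>E1. a r e * ind e v)"
    and load: "\<And>e. e \<in> E1 \<Longrightarrow> card {r\<in>\<Phi>. a r e \<noteq> 0} \<le> 4"
    and nz: "perl (\<lambda>r s. rowdiff s (f r)) ss \<Phi> \<noteq> 0"
    and vanish: "\<And>r s. r \<in> \<Phi> \<Longrightarrow> s \<in> E2 \<Longrightarrow> rowdiff s (f r) = 0"
    and "good E2" "E1 \<inter> E2 = {}"
  shows "good (E1 \<union> E2)"
proof -
  obtain \<kappa> :: "nat \<Rightarrow> 'a set" and ss2 where
    2: "distinct ss2" "set ss2 = E2" "\<kappa> ` {..<length ss2} \<subseteq> E2"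
    "\<And>e. e \<in> E2 \<Longrightarrow> card {r\<in>{..<length ss2}. \<kappa> r = e} \<le> 4"
    "perl (\<lambda>r s. rowdiff s (ind (\<kappa> r))) ss2 {..<length ss2} \<noteq> 0"
    using \<open>good E2\<close> unfolding good_def by blast
  define \<Phi>' :: "('r + nat) set" where "\<Phi>' = Inl ` \<Phi> \<union> Inr ` {..<length ss2}"
  define f' where "f' = case_sum f (\<lambda>r. ind (\<kappa> r))"
  define a' :: "'r + nat \<Rightarrow> 'a set \<Rightarrow> real" where
    "a' = case_sum (\<lambda>r e. if e \<in> E1 then a r e else 0) (\<lambda>r e. of_bool (e = \<kappa> r))"
  have fin: "finite E1" "finite E2" using assms 2 by auto
  have kap: "\<kappa> r \<notin> E1" if "r < length ss2" for r
    using that 2(3) \<open>E1 \<inter> E2 = {}\<close> by auto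
  show ?thesis
  proof (rule goodI[where \<Phi> = \<Phi>' and ss = "ss2 @ ss" and f = f' and a = a'])
    show "finite \<Phi>'" unfolding \<Phi>'_def using assms by auto
    show "card \<Phi>' = length (ss2 @ ss)"
      unfolding \<Phi>'_def using assms by (subst card_Un_disjoint) (auto simp: card_image)
    show "distinct (ss2 @ ss)" "set (ss2 @ ss) = E1 \<union> E2" using assms 2 by auto
    show "f' r = (\<lambda>v. \<Sum>e\<in>E1 \<union> E2. a' r e * ind e v)" if "r \<in> \<Phi>'" for r
    proof (cases r)
      case (Inl r0)
      then have "r0 \<in> \<Phi>" using that by (auto simp: \<Phi>'_def)
      then have "f' r = (\<lambda>v. \<Sum>e\<in>E1. a' r e * ind e v)" by (simp add: Inl f'_def f a'_def)
      also have "\<dots> = (\<lambda>v. \<Sum>e\<in>E1 \<union> E2. a' r e * ind e v)"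
        using fin by (intro ext sum.mono_neutral_left) (auto simp: Inl a'_def)
      finally show ?thesis .
    next
      case (Inr r0)
      then have "\<kappa> r0 \<in> E2" using that 2 by (auto simp: \<Phi>'_def)
      have "(\<Sum>e\<in>E1 \<union> E2. a' r e * ind e v) = (\<Sum>e\<in>{\<kappa> r0}. a' r e * ind e v)" for v
        using fin \<open>\<kappa> r0 \<in> E2\<close> by (intro sum.mono_neutral_right) (auto simp: Inr a'_def)
      then show ?thesis by (auto simp: Inr f'_def a'_def)
    qed
    show "card {r\<in>\<Phi>'. a' r e \<noteq> 0} \<le> 4" if "e \<in> E1 \<union> E2" for e
    proof (cases "e \<in> E1")
      case True
      then have "{r\<in>\<Phi>'. a' r e \<noteq> 0} = Inl ` {r\<in>\<Phi>. a r e \<noteq> 0}"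
        using kap by (auto simp: \<Phi>'_def a'_def)
      then show ?thesis using load[OF True] by (simp add: card_image)
    next
      case False
      then have "{r\<in>\<Phi>'. a' r e \<noteq> 0} = Inr ` {r\<in>{..<length ss2}. \<kappa> r = e}"
        by (auto simp: \<Phi>'_def a'_def)
      then show ?thesis using 2(4)[of e] that False by (simp add: card_image)
    qed
    have "perl (\<lambda>r s. rowdiff s (f' r)) (ss2 @ ss) \<Phi>'
        = perl (\<lambda>r s. rowdiff s (f' r)) ss2 (Inr ` {..<length ss2}) * perl (\<lambda>r s. rowdiff s (f' r)) ss (Inl ` \<Phi>)"
      unfolding \<Phi>'_def
      using assms 2 by (intro perl_append_block) (auto simp: card_image f'_def)
    also have "\<dots> \<noteq> 0" using 2(5) nz by (simp add: perl_reindex f'_def)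
    finally show "perl (\<lambda>r s. rowdiff s (f' r)) (ss2 @ ss) \<Phi>' \<noteq> 0" .
  qed
qed

text \<open>All exponents are at most 4 and thus below the size of the lists, which is at least 5.
  The vertex weights \<open>c\<close> enter as the constants of the linear factors.\<close>

lemma good_proper_weights:
  fixes S :: "'a set \<Rightarrow> real set" and c :: "'a \<Rightarrow> real"
  assumes "good E" "\<And>e. e \<in> E \<Longrightarrow> card e = 2" "\<And>e. e \<in> E \<Longrightarrow> finite (S e) \<and> 5 \<le> card (S e)"
  shows "\<exists>x. (\<forall>e\<in>E. x e \<in> S e) \<and>
    (\<forall>u v. {u, v} \<in> E \<longrightarrow> (\<Sum>e\<in>{e\<in>E. u \<in> e}. x e) + c u \<noteq> (\<Sum>e\<in>{e\<in>E. v \<in> e}. x e) + c v)"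
proof -
  obtain \<kappa> :: "nat \<Rightarrow> 'a set" and ss where
    g: "distinct ss" "set ss = E" "\<kappa> ` {..<length ss} \<subseteq> E"
    "\<And>e. e \<in> E \<Longrightarrow> card {r\<in>{..<length ss}. \<kappa> r = e} \<le> 4"
    "perl (\<lambda>r. (\<lambda>e s. rowdiff s (ind e)) (\<kappa> r)) ss {..<length ss} \<noteq> 0"
    using \<open>good E\<close> unfolding good_def by blast
  have fin: "finite E" using g(2) by auto
  have "\<exists>x. (\<forall>e\<in>E. x e \<in> S e) \<and> (\<forall>s\<in>set ss. (\<Sum>e\<in>E. rowdiff s (ind e) * x e) + rowdiff s c \<noteq> 0)"
  proof (rule nonvanishing_on_grid[OF fin _ _ g(3) _ g(5)])
    fix e assume "e \<in> E"
    then show "finite (S e) \<and> card {r\<in>{..<length ss}. \<kappa> r = e} < card (S e)"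
      using g(4)[of e] assms(3)[of e] by linarith
  qed auto
  then obtain x where x: "\<And>e. e \<in> E \<Longrightarrow> x e \<in> S e"
    "\<And>s. s \<in> E \<Longrightarrow> (\<Sum>e\<in>E. rowdiff s (ind e) * x e) + rowdiff s c \<noteq> 0" using g(2) by blast
  define t where "t = (\<lambda>v. (\<Sum>e\<in>{e\<in>E. v \<in> e}. x e) + c v)"
  have t: "t v = (\<Sum>e\<in>E. x e * ind e v) + c v" for v
    unfolding t_def ind_def using fin by (auto simp: sum.inter_filter of_bool_def intro!: sum.cong)
  have "t u \<noteq> t v" if e: "{u, v} \<in> E" for u v
  proof -
    have "rowdiff {u, v} t \<noteq> 0"
      using x(2)[OF e] rowdiff_sum[of "{u, v}" x ind E]
      unfolding rowdiff_def t by (simp add: mult.commute)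
    moreover have "{u, v} = {hdv {u, v}, tlv {u, v}}" using hdv_tlv assms(2)[OF e] by blast
    ultimately show ?thesis unfolding rowdiff_def by (auto simp: doubleton_eq_iff)
  qed
  then show ?thesis using x(1) unfolding t_def by blast
qed

lemma perl_diagonal:
  assumes "distinct ss" "set ss = \<Phi>" "\<And>r s. r \<in> \<Phi> \<Longrightarrow> s \<in> \<Phi> \<Longrightarrow> r \<noteq> s \<Longrightarrow> B r s = 0"
  shows "perl B ss \<Phi> = (\<Prod>s\<in>\<Phi>. B s s)"
  using assms
proof (induction ss arbitrary: \<Phi>)
  case (Cons s ss)
  then have \<Phi>: "\<Phi> = insert s (set ss)" "s \<notin> set ss" by auto
  have "perl B (s # ss) \<Phi> = B s s * perl B ss (\<Phi> - {s}) + (\<Sum>r\<in>set ss. B r s * perl B ss (\<Phi> - {r}))"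
    using \<Phi> by simp
  also have "(\<Sum>r\<in>set ss. B r s * perl B ss (\<Phi> - {r})) = 0"
    using Cons.prems \<Phi> by (intro sum.neutral) auto
  also have "perl B ss (\<Phi> - {s}) = (\<Prod>s\<in>set ss. B s s)"
    using Cons.IH[of "set ss"] Cons.prems \<Phi> by simp
  finally show ?case using \<Phi> by simp
qed simp


section \<open>Nonvanishing by averaging over roots of unity\<close>

text \<open>The coefficient of \<open>\<Prod>w\<in>J. y\<^sub>w ^ n w\<close> in \<open>\<Prod>r\<in>\<Phi>. \<Sum>w\<in>J. f r w * y\<^sub>w\<close>.\<close>

definition fibre_sum :: "'a set \<Rightarrow> ('r \<Rightarrow> 'a \<Rightarrow> real) \<Rightarrow> 'r set \<Rightarrow> ('a \<Rightarrow> nat) \<Rightarrow> real" where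
  "fibre_sum J f \<Phi> n = (\<Sum>h\<in>PiE \<Phi> (\<lambda>_. J).
     of_bool (\<forall>w\<in>J. card {r\<in>\<Phi>. h r = w} = n w) * (\<Prod>r\<in>\<Phi>. f r (h r)))"

lemma sum_PiE_insert:
  assumes "r \<notin> \<Phi>"
  shows "(\<Sum>h\<in>PiE (insert r \<Phi>) (\<lambda>_. J). F h) = (\<Sum>y\<in>J. \<Sum>g\<in>PiE \<Phi> (\<lambda>_. J). F (g(r := y)))"
proof -
  have "inj_on (\<lambda>(y, g). g(r := y)) (J \<times> PiE \<Phi> (\<lambda>_. J))"
    using inj_combinator[OF assms, of "\<lambda>_. J"] by simp
  then show ?thesis
    by (simp add: PiE_insert_eq sum.reindex sum.cartesian_product case_prod_unfold)
qed

text \<open>Double counting of the pairs \<open>(h, r)\<close> with \<open>h r = w\<close>: each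
  contributing assignment \<open>h\<close> has \<open>n w\<close> of them.\<close>

lemma fibre_sum_step:
  assumes "finite J" "finite \<Phi>" "w \<in> J" "n w > 0"
  shows "real (n w) * fibre_sum J f \<Phi> n = (\<Sum>r\<in>\<Phi>. f r w * fibre_sum J f (\<Phi> - {r}) (n(w := n w - 1)))"
proof -
  have "real (n w) * fibre_sum J f \<Phi> n
     = (\<Sum>h\<in>PiE \<Phi> (\<lambda>_. J). (\<Sum>r\<in>\<Phi>. of_bool (h r = w)) *
          (of_bool (\<forall>w\<in>J. card {r\<in>\<Phi>. h r = w} = n w) * (\<Prod>r\<in>\<Phi>. f r (h r))))"
    unfolding fibre_sum_def sum_distrib_left
  proof (rule sum.cong[OF refl])
    fix h
    have "(\<Sum>r\<in>\<Phi>. of_bool (h r = w)) = real (card {r\<in>\<Phi>. h r = w})"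
      using assms(2) by (simp add: Int_def)
    then show "real (n w) * (of_bool (\<forall>w\<in>J. card {r\<in>\<Phi>. h r = w} = n w) * (\<Prod>r\<in>\<Phi>. f r (h r)))
      = (\<Sum>r\<in>\<Phi>. of_bool (h r = w)) *
          (of_bool (\<forall>w\<in>J. card {r\<in>\<Phi>. h r = w} = n w) * (\<Prod>r\<in>\<Phi>. f r (h r)))"
      using assms(3) by auto
  qed
  also have "\<dots> = (\<Sum>r\<in>\<Phi>. \<Sum>h\<in>PiE \<Phi> (\<lambda>_. J). of_bool (h r = w) *
          (of_bool (\<forall>w\<in>J. card {r\<in>\<Phi>. h r = w} = n w) * (\<Prod>r\<in>\<Phi>. f r (h r))))"
    unfolding sum_distrib_right by (rule sum.swap)
  also have "\<dots> = (\<Sum>r\<in>\<Phi>. f r w * fibre_sum J f (\<Phi> - {r}) (n(w := n w - 1)))"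
  proof (rule sum.cong[OF refl])
    fix r assume r: "r \<in> \<Phi>"
    define \<Phi>' where "\<Phi>' = \<Phi> - {r}"
    have \<Phi>: "\<Phi> = insert r \<Phi>'" "r \<notin> \<Phi>'" "finite \<Phi>'" using r assms by (auto simp: \<Phi>'_def)
    define G where "G = (\<lambda>h. of_bool (h r = w) *
          (of_bool (\<forall>w\<in>J. card {r\<in>\<Phi>. h r = w} = n w) * (\<Prod>r\<in>\<Phi>. f r (h r))))"
    have Gw: "G (g(r := w)) = f r w * (of_bool (\<forall>v\<in>J. card {r\<in>\<Phi>'. g r = v} = (n(w := n w - 1)) v) * (\<Prod>r\<in>\<Phi>'. f r (g r)))" for g
    proof -
      have "card {r'\<in>\<Phi>. (g(r := w)) r' = v} = card {r'\<in>\<Phi>'. g r' = v} + of_bool (v = w)" for v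
      proof (cases "v = w")
        case True
        then have "{r'\<in>\<Phi>. (g(r := w)) r' = v} = insert r {r'\<in>\<Phi>'. g r' = v}" using \<Phi> by auto
        then show ?thesis using True \<Phi> by simp
      next
        case False
        then have "{r'\<in>\<Phi>. (g(r := w)) r' = v} = {r'\<in>\<Phi>'. g r' = v}" using \<Phi> by auto
        then show ?thesis using False by simp
      qed
      then have "(\<forall>v\<in>J. card {r'\<in>\<Phi>. (g(r := w)) r' = v} = n v)
        \<longleftrightarrow> (\<forall>v\<in>J. card {r\<in>\<Phi>'. g r = v} = (n(w := n w - 1)) v)"
        using assms(4) by (intro ball_cong) auto
      moreover have "(\<Prod>r'\<in>\<Phi>. f r' ((g(r := w)) r')) = f r w * (\<Prod>r'\<in>\<Phi>'. f r' (g r'))"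
        unfolding \<Phi>(1) using \<Phi>(2,3) by (simp add: prod.insert) (intro disjI2 prod.cong, auto)
      ultimately show ?thesis unfolding G_def by simp
    qed
    have "(\<Sum>h\<in>PiE \<Phi> (\<lambda>_. J). G h) = (\<Sum>y\<in>J. \<Sum>g\<in>PiE \<Phi>' (\<lambda>_. J). G (g(r := y)))"
      unfolding \<Phi>(1) by (rule sum_PiE_insert[OF \<Phi>(2)])
    also have "\<dots> = (\<Sum>y\<in>{w}. \<Sum>g\<in>PiE \<Phi>' (\<lambda>_. J). G (g(r := y)))"
      using assms by (intro sum.mono_neutral_right) (auto simp: G_def)
    also have "\<dots> = f r w * fibre_sum J f \<Phi>' (n(w := n w - 1))"
      by (simp add: Gw fibre_sum_def sum_distrib_left)
    finally show "(\<Sum>h\<in>PiE \<Phi> (\<lambda>_. J). of_bool (h r = w) *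
          (of_bool (\<forall>w\<in>J. card {r\<in>\<Phi>. h r = w} = n w) * (\<Prod>r\<in>\<Phi>. f r (h r))))
      = f r w * fibre_sum J f (\<Phi> - {r}) (n(w := n w - 1))"
      unfolding G_def \<Phi>'_def .
  qed
  finally show ?thesis .
qed

text \<open>Here it is the rows that repeat, one copy of \<open>w\<close> for each occurrence in
  \<open>ls\<close>; ordering equal rows gives the factorials.\<close>

lemma perl_eq_fibre_sum:
  assumes "finite J" "finite \<Phi>" "card \<Phi> = length ls" "set ls \<subseteq> J"
  shows "perl f ls \<Phi> = (\<Prod>w\<in>J. fact (count (mset ls) w)) * fibre_sum J f \<Phi> (count (mset ls))"
  using assms(2-)
proof (induction ls arbitrary: \<Phi>)
  case Nil
  then show ?case by (simp add: fibre_sum_def)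
next
  case (Cons w ls)
  define n where "n = count (mset (w # ls))"
  have n': "count (mset ls) = n(w := n w - 1)" by (auto simp: n_def)
  have "perl f (w # ls) \<Phi> = (\<Sum>r\<in>\<Phi>. f r w * ((\<Prod>w\<in>J. fact (count (mset ls) w)) * fibre_sum J f (\<Phi> - {r}) (count (mset ls))))"
    using Cons by (simp cong: sum.cong)
  also have "\<dots> = (\<Prod>v\<in>J. fact ((n(w := n w - 1)) v)) * (\<Sum>r\<in>\<Phi>. f r w * fibre_sum J f (\<Phi> - {r}) (n(w := n w - 1)))"
    unfolding n' by (simp add: sum_distrib_left mult_ac)
  also have "\<dots> = (\<Prod>v\<in>J. fact ((n(w := n w - 1)) v)) * (real (n w) * fibre_sum J f \<Phi> n)"
    using Cons.prems assms(1) by (subst fibre_sum_step) (auto simp: n_def)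
  also have "\<dots> = ((\<Prod>v\<in>J. fact ((n(w := n w - 1)) v)) * real (n w)) * fibre_sum J f \<Phi> n" by simp
  also have "(\<Prod>v\<in>J. fact ((n(w := n w - 1)) v)) * real (n w) = (\<Prod>v\<in>J. fact (n v))"
  proof -
    have w: "w \<in> J" using Cons.prems by simp
    have "(\<Prod>v\<in>J. fact (n v) :: real) = fact (n w) * (\<Prod>v\<in>J - {w}. fact (n v))"
      using assms(1) w by (simp add: prod.remove)
    moreover have "(\<Prod>v\<in>J. fact ((n(w := n w - 1)) v) :: real) = fact (n w - 1) * (\<Prod>v\<in>J - {w}. fact (n v))"
      using assms(1) w by (simp add: prod.remove[of J w])
    moreover have "(fact (n w) :: real) = real (n w) * fact (n w - 1)"
      by (rule fact_reduce) (simp add: n_def)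
    ultimately show ?thesis by simp
  qed
  finally show ?case unfolding n_def .
qed

definition rootv :: "nat \<Rightarrow> ('a \<Rightarrow> nat) \<Rightarrow> 'a \<Rightarrow> complex" where
  "rootv N \<theta> w = cis (2 * pi * real (\<theta> w) / real N)"

text \<open>Orthogonality of the characters of the cyclic group of order \<open>N\<close>; the
  bounds rule out distinct exponents that are congruent modulo \<open>N\<close>.\<close>

lemma sum_cis_orthogonal:
  assumes "c < N" "n < N"
  shows "(\<Sum>t<N. cis (2 * pi * real t / real N) ^ c * cnj (cis (2 * pi * real t / real N)) ^ n)
    = (if c = n then of_nat N else 0)"
proof -
  define z where "z = cis (2 * pi * (real c - real n) / real N)"
  have "cis (2 * pi * real t / real N) ^ c * cnj (cis (2 * pi * real t / real N)) ^ n = z ^ t" for t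
    unfolding z_def cis_cnj Complex.DeMoivre cis_mult using assms by (intro arg_cong[where f = cis]) (simp add: field_simps)
  then have eq: "(\<Sum>t<N. cis (2 * pi * real t / real N) ^ c * cnj (cis (2 * pi * real t / real N)) ^ n) = (\<Sum>t<N. z ^ t)"
    by simp
  show ?thesis
  proof (cases "c = n")
    case True
    then show ?thesis unfolding eq by (simp add: z_def)
  next
    case False
    have N: "z ^ N = 1"
    proof -
      have "z ^ N = cis (2 * pi * of_int (int c - int n))"
        using assms by (simp add: z_def Complex.DeMoivre)
      then show ?thesis by (simp only: cis_multiple_2pi[OF Ints_of_int])
    qed
    have "z \<noteq> 1"
    proof
      assume "z = 1"
      then have "cos (2 * pi * (real c - real n) / real N) = 1"
        unfolding z_def by (metis Re_complex_of_real cis.sel(1) one_complex.sel(1))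
      then obtain k :: int where "2 * pi * (real c - real n) / real N = of_int k * 2 * pi"
        by (auto simp: cos_one_2pi_int)
      then have "(2 * pi) * (real c - real n) = (2 * pi) * (of_int k * real N)"
        using assms by (simp add: field_simps)
      then have "real c - real n = of_int k * real N" using mult_left_cancel[of "2 * pi"] by simp
      then have k: "int c - int n = k * int N"
        by (metis of_int_diff of_int_eq_iff of_int_mult of_int_of_nat_eq)
      moreover have "\<bar>int c - int n\<bar> < int N" using assms by auto
      ultimately have "\<bar>k\<bar> * int N < 1 * int N" by (simp add: abs_mult)
      then have "\<bar>k\<bar> < 1" by (rule mult_right_less_imp_less) simp
      then have "k = 0" by simp
      with k False show False by simp
    qed
    then show ?thesis unfolding eq using False by (simp add: geometric_sum N)
  qed
qed

lemma prod_list_count: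
  assumes "finite J" "set ls \<subseteq> J"
  shows "(\<Prod>w\<leftarrow>ls. g w) = (\<Prod>w\<in>J. g w ^ count (mset ls) w :: 'b :: comm_monoid_mult)"
  using assms(2)
proof (induction ls)
  case (Cons v ls)
  have "(\<Prod>w\<in>J. g w ^ count (mset (v # ls)) w) = (\<Prod>w\<in>J. (if w = v then g w else 1) * g w ^ count (mset ls) w)"
    by (rule prod.cong) auto
  also have "\<dots> = g v * (\<Prod>w\<in>J. g w ^ count (mset ls) w)"
    using Cons.prems assms(1) by (simp add: prod.distrib)
  finally show ?case using Cons by simp
qed simp

text \<open>Discrete Fourier inversion: multiply by the conjugate of the wanted monomial and sum
  over all tuples of roots of unity. As \<open>N\<close> exceeds the degree, no other exponent is
  congruent to the wanted one.\<close>

lemma perl_eq_root_average: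
  assumes "finite J" "finite \<Phi>" "card \<Phi> = length ls" "set ls \<subseteq> J" "length ls < N"
  shows "of_real (perl f ls \<Phi>) * of_nat N ^ card J
    = (\<Prod>w\<in>J. fact (count (mset ls) w)) *
      (\<Sum>\<theta>\<in>PiE J (\<lambda>_. {..<N}). (\<Prod>r\<in>\<Phi>. \<Sum>w\<in>J. of_real (f r w) * rootv N \<theta> w) * (\<Prod>w\<leftarrow>ls. cnj (rootv N \<theta> w)))"
proof -
  define n where "n = count (mset ls)"
  define c where "c = (\<lambda>h w. card {r\<in>\<Phi>. h r = (w::'a)})"
  have nN: "n w < N" for w unfolding n_def using assms(5) count_le_size[of "mset ls" w] by simp
  have cN: "c h w < N" for h w
  proof -
    have "c h w \<le> card \<Phi>" unfolding c_def using assms(2) by (intro card_mono) auto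
    then show ?thesis using assms by simp
  qed
  have "(\<Sum>\<theta>\<in>PiE J (\<lambda>_. {..<N}). (\<Prod>r\<in>\<Phi>. \<Sum>w\<in>J. of_real (f r w) * rootv N \<theta> w) * (\<Prod>w\<leftarrow>ls. cnj (rootv N \<theta> w)))
     = (\<Sum>\<theta>\<in>PiE J (\<lambda>_. {..<N}). \<Sum>h\<in>PiE \<Phi> (\<lambda>_. J). (\<Prod>r\<in>\<Phi>. of_real (f r (h r))) *
          (\<Prod>w\<in>J. rootv N \<theta> w ^ c h w * cnj (rootv N \<theta> w) ^ n w))"
  proof (rule sum.cong[OF refl])
    fix \<theta>
    have "(\<Prod>r\<in>\<Phi>. \<Sum>w\<in>J. of_real (f r w) * rootv N \<theta> w)
      = (\<Sum>h\<in>PiE \<Phi> (\<lambda>_. J). \<Prod>r\<in>\<Phi>. of_real (f r (h r)) * rootv N \<theta> (h r))"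
      using assms by (simp add: prod_sum_PiE)
    also have "\<dots> = (\<Sum>h\<in>PiE \<Phi> (\<lambda>_. J). (\<Prod>r\<in>\<Phi>. of_real (f r (h r))) * (\<Prod>w\<in>J. rootv N \<theta> w ^ c h w))"
    proof (rule sum.cong[OF refl])
      fix h assume "h \<in> PiE \<Phi> (\<lambda>_. J)"
      then have "h ` \<Phi> \<subseteq> J" by auto
      have "(\<Prod>r\<in>\<Phi>. rootv N \<theta> (h r)) = (\<Prod>w\<in>J. \<Prod>r\<in>{r\<in>\<Phi>. h r = w}. rootv N \<theta> (h r))"
        by (rule prod.group[symmetric]) (use assms \<open>h ` \<Phi> \<subseteq> J\<close> in auto)
      also have "\<dots> = (\<Prod>w\<in>J. rootv N \<theta> w ^ c h w)"
        unfolding c_def by (intro prod.cong refl) simp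
      finally show "(\<Prod>r\<in>\<Phi>. of_real (f r (h r)) * rootv N \<theta> (h r))
         = (\<Prod>r\<in>\<Phi>. of_real (f r (h r))) * (\<Prod>w\<in>J. rootv N \<theta> w ^ c h w)"
        by (simp add: prod.distrib)
    qed
    finally show "(\<Prod>r\<in>\<Phi>. \<Sum>w\<in>J. of_real (f r w) * rootv N \<theta> w) * (\<Prod>w\<leftarrow>ls. cnj (rootv N \<theta> w))
      = (\<Sum>h\<in>PiE \<Phi> (\<lambda>_. J). (\<Prod>r\<in>\<Phi>. of_real (f r (h r))) *
          (\<Prod>w\<in>J. rootv N \<theta> w ^ c h w * cnj (rootv N \<theta> w) ^ n w))"
      using assms by (simp add: prod_list_count[where J = J] n_def prod.distrib sum_distrib_right mult.assoc)
  qed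
  also have "\<dots> = (\<Sum>h\<in>PiE \<Phi> (\<lambda>_. J). (\<Prod>r\<in>\<Phi>. of_real (f r (h r))) *
      (\<Sum>\<theta>\<in>PiE J (\<lambda>_. {..<N}). \<Prod>w\<in>J. rootv N \<theta> w ^ c h w * cnj (rootv N \<theta> w) ^ n w))"
    by (subst sum.swap) (simp add: sum_distrib_left)
  also have "\<dots> = (\<Sum>h\<in>PiE \<Phi> (\<lambda>_. J). (\<Prod>r\<in>\<Phi>. of_real (f r (h r))) *
      (of_nat N ^ card J * of_bool (\<forall>w\<in>J. c h w = n w)))"
  proof (rule sum.cong[OF refl])
    fix h
    have "(\<Sum>\<theta>\<in>PiE J (\<lambda>_. {..<N}). \<Prod>w\<in>J. rootv N \<theta> w ^ c h w * cnj (rootv N \<theta> w) ^ n w)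
       = (\<Prod>w\<in>J. \<Sum>t<N. cis (2 * pi * real t / real N) ^ c h w * cnj (cis (2 * pi * real t / real N)) ^ n w)"
      unfolding rootv_def using assms(1)
      by (subst prod_sum_PiE) auto
    also have "\<dots> = (\<Prod>w\<in>J. if c h w = n w then of_nat N else 0)"
      by (intro prod.cong refl sum_cis_orthogonal cN nN)
    also have "\<dots> = of_nat N ^ card J * of_bool (\<forall>w\<in>J. c h w = n w)"
    proof (cases "\<forall>w\<in>J. c h w = n w")
      case False
      then have "(\<Prod>w\<in>J. if c h w = n w then of_nat N else 0) = (0::complex)"
        using assms(1) by (intro prod_zero) auto
      then show ?thesis using False by simp
    qed simp
    finally show "(\<Prod>r\<in>\<Phi>. of_real (f r (h r))) *
        (\<Sum>\<theta>\<in>PiE J (\<lambda>_. {..<N}). \<Prod>w\<in>J. rootv N \<theta> w ^ c h w * cnj (rootv N \<theta> w) ^ n w)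
      = (\<Prod>r\<in>\<Phi>. of_real (f r (h r))) * (of_nat N ^ card J * of_bool (\<forall>w\<in>J. c h w = n w) :: complex)"
      by simp
  qed
  also have "\<dots> = of_nat N ^ card J * of_real (fibre_sum J f \<Phi> n)"
    unfolding fibre_sum_def c_def of_real_sum sum_distrib_left
    by (rule sum.cong) (auto simp: of_bool_def)
  finally show ?thesis
    using perl_eq_fibre_sum[OF assms(1-4), of f] by (simp add: n_def)
qed

text \<open>The two kinds of rows seen by a form that vanishes outside \<open>J\<close>: up to sign,
  an edge with one end \<open>w\<close> in \<open>J\<close> reads \<open>f w\<close>, and an edge
  inside \<open>J\<close> reads the difference of its ends.\<close>

fun rowval :: "('a \<Rightarrow> real) \<Rightarrow> 'a + 'a \<times> 'a \<Rightarrow> real" where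
  "rowval f (Inl w) = f w"
| "rowval f (Inr (w, p)) = f w - f p"

text \<open>A difference row splits by linearity into a row \<open>w\<close> and a row
  \<open>p\<close>. One more row \<open>w\<close> turns the factorial of \<open>n w\<close> into
  that of \<open>n w + 1\<close>, which is the origin of the weights
  \<open>Suc (count (mset ls) w)\<close>. The pairs in \<open>ms\<close> are disjoint, so splitting
  one leaves the counts at the others alone.\<close>

lemma perl_rows_eq_root_average:
  assumes "finite J" "finite \<Phi>" "card \<Phi> = length ls + length ms" "set ls \<subseteq> J"
    "length ls + length ms < N"
    "distinct (map fst ms @ map snd ms)" "set (map fst ms @ map snd ms) \<subseteq> J"
  shows "of_real (perl (\<lambda>r. rowval (f r)) (map Inl ls @ map Inr ms) \<Phi>) * of_nat N ^ card J
    = (\<Prod>w\<in>J. fact (count (mset ls) w)) *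
      (\<Sum>\<theta>\<in>PiE J (\<lambda>_. {..<N}). (\<Prod>r\<in>\<Phi>. \<Sum>w\<in>J. of_real (f r w) * rootv N \<theta> w) * (\<Prod>w\<leftarrow>ls. cnj (rootv N \<theta> w))
        * (\<Prod>(w, p)\<leftarrow>ms. of_nat (Suc (count (mset ls) w)) * cnj (rootv N \<theta> w)
             - of_nat (Suc (count (mset ls) p)) * cnj (rootv N \<theta> p)))"
  using assms(3-)
proof (induction ms arbitrary: ls)
  case Nil
  have "perl (\<lambda>r. rowval (f r)) (map Inl ls) \<Phi> = perl f ls \<Phi>"
    by (simp add: perl_map)
  then show ?case using perl_eq_root_average[OF assms(1,2), of ls N f] Nil by simp
next
  case (Cons m ms)
  obtain w p where m: "m = (w, p)" by (cases m)
  have wp: "w \<in> J" "p \<in> J" "w \<noteq> p" "w \<notin> fst ` set ms" "w \<notin> snd ` set ms" "p \<notin> fst ` set ms" "p \<notin> snd ` set ms"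
    using Cons.prems m by auto
  define n where "n = count (mset ls)"
  define W where "W = (\<lambda>\<theta>. (\<Prod>r\<in>\<Phi>. \<Sum>w\<in>J. of_real (f r w) * rootv N \<theta> w) * (\<Prod>w\<leftarrow>ls. cnj (rootv N \<theta> w)))"
  define M where "M = (\<lambda>\<theta>. (\<Prod>(w, p)\<leftarrow>ms. of_nat (Suc (n w)) * cnj (rootv N \<theta> w) - of_nat (Suc (n p)) * cnj (rootv N \<theta> p)))"
  define R where "R = (\<lambda>ls ms. of_real (perl (\<lambda>r. rowval (f r)) (map Inl ls @ map Inr ms) \<Phi>) * of_nat N ^ card J :: complex)"
  have step: "R (ls @ [v]) ms = (\<Prod>w\<in>J. fact (n w)) * (\<Sum>\<theta>\<in>PiE J (\<lambda>_. {..<N}). W \<theta> * (of_nat (Suc (n v)) * cnj (rootv N \<theta> v)) * M \<theta>)"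
    if v: "v \<in> J" "v \<notin> fst ` set ms" "v \<notin> snd ` set ms" for v
  proof -
    have cnt: "count (mset (ls @ [v])) x = (if x = v then Suc (n x) else n x)" for x by (simp add: n_def)
    have "(\<Prod>(w, p)\<leftarrow>ms. of_nat (Suc (count (mset (ls @ [v])) w)) * cnj (rootv N \<theta> w)
             - of_nat (Suc (count (mset (ls @ [v])) p)) * cnj (rootv N \<theta> p)) = M \<theta>" for \<theta>
      unfolding M_def
    proof (intro arg_cong[where f = prod_list] map_cong refl)
      fix q assume "q \<in> set ms"
      then have "fst q \<noteq> v" "snd q \<noteq> v" using v by auto
      then show "(case q of (w, p) \<Rightarrow> of_nat (Suc (count (mset (ls @ [v])) w)) * cnj (rootv N \<theta> w)
             - of_nat (Suc (count (mset (ls @ [v])) p)) * cnj (rootv N \<theta> p))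
          = (case q of (w, p) \<Rightarrow> of_nat (Suc (n w)) * cnj (rootv N \<theta> w) - of_nat (Suc (n p)) * cnj (rootv N \<theta> p))"
        unfolding cnt by (auto split: prod.splits)
    qed
    moreover have "(\<Prod>w\<in>J. fact (count (mset (ls @ [v])) w)) = (\<Prod>w\<in>J. fact (n w)) * (of_nat (Suc (n v)) :: complex)"
      unfolding cnt using v(1) assms(1) by (simp add: prod.remove[of J v] algebra_simps)
    moreover have "R (ls @ [v]) ms = (\<Prod>w\<in>J. fact (count (mset (ls @ [v])) w)) *
      (\<Sum>\<theta>\<in>PiE J (\<lambda>_. {..<N}). (\<Prod>r\<in>\<Phi>. \<Sum>w\<in>J. of_real (f r w) * rootv N \<theta> w) * (\<Prod>w\<leftarrow>ls @ [v]. cnj (rootv N \<theta> w))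
        * (\<Prod>(w, p)\<leftarrow>ms. of_nat (Suc (count (mset (ls @ [v])) w)) * cnj (rootv N \<theta> w)
             - of_nat (Suc (count (mset (ls @ [v])) p)) * cnj (rootv N \<theta> p)))"
      unfolding R_def by (rule Cons.IH) (use Cons.prems v in auto)
    ultimately show ?thesis
      unfolding W_def by (simp only: sum_distrib_left) (simp add: sum_distrib_left mult_ac)
  qed
  have "perl (\<lambda>r. rowval (f r)) (map Inl ls @ Inr (w, p) # map Inr ms) \<Phi>
    = 1 * perl (\<lambda>r. rowval (f r)) (map Inl ls @ Inl w # map Inr ms) \<Phi>
    + (- 1) * perl (\<lambda>r. rowval (f r)) (map Inl ls @ Inl p # map Inr ms) \<Phi>"
    by (rule perl_row_linear) simp
  then have "R ls (m # ms) = R (ls @ [w]) ms - R (ls @ [p]) ms"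
    unfolding R_def m by (simp add: left_diff_distrib)
  also have "\<dots> = (\<Prod>w\<in>J. fact (n w)) * (\<Sum>\<theta>\<in>PiE J (\<lambda>_. {..<N}).
      W \<theta> * ((of_nat (Suc (n w)) * cnj (rootv N \<theta> w) - of_nat (Suc (n p)) * cnj (rootv N \<theta> p)) * M \<theta>))"
    unfolding step[OF wp(1,4,5)] step[OF wp(2,6,7)] right_diff_distrib[symmetric] sum_subtractf[symmetric]
    by (intro arg_cong2[where f = "(*)"] refl sum.cong) (simp add: algebra_simps)
  finally show ?case unfolding R_def W_def M_def n_def m by simp
qed


section \<open>Signed pairs, triangle forms and the sign of the average\<close>

definition tform :: "'a \<times> 'a \<times> real \<Rightarrow> 'a \<Rightarrow> real" where
  "tform t v = (case t of (a, b, \<sigma>) \<Rightarrow> of_bool (v = a) + \<sigma> * of_bool (v = b))"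

definition gform :: "('a \<Rightarrow> nat) \<Rightarrow> 'a \<times> 'a \<Rightarrow> 'a \<Rightarrow> real" where
  "gform n m v = (case m of (w, p) \<Rightarrow> real (Suc (n w)) * of_bool (v = w) - real (Suc (n p)) * of_bool (v = p))"

lemma sum_of_bool_mult:
  assumes "finite J" "a \<in> J"
  shows "(\<Sum>w\<in>J. of_bool (w = a) * y w) = (y a :: complex)"
proof -
  have "(\<Sum>w\<in>J. of_bool (w = a) * y w) = (\<Sum>w\<in>J. if w = a then y w else 0)"
    by (rule sum.cong) auto
  then show ?thesis using assms by simp
qed

lemma sum_tform:
  assumes "finite J" "a \<in> J" "b \<in> J"
  shows "(\<Sum>w\<in>J. of_real (tform (a, b, \<sigma>) w) * y w) = y a + of_real \<sigma> * y b"
proof -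
  have "(\<Sum>w\<in>J. of_real (tform (a, b, \<sigma>) w) * y w)
     = (\<Sum>w\<in>J. of_bool (w = a) * y w) + of_real \<sigma> * (\<Sum>w\<in>J. of_bool (w = b) * y w)"
    unfolding tform_def sum_distrib_left sum.distrib[symmetric]
    by (rule sum.cong) (auto simp: of_bool_def algebra_simps)
  then show ?thesis using assms by (simp add: sum_of_bool_mult)
qed

lemma sum_gform:
  assumes "finite J" "w \<in> J" "p \<in> J"
  shows "(\<Sum>v\<in>J. of_real (gform n (w, p) v) * y v) = of_nat (Suc (n w)) * y w - of_nat (Suc (n p)) * y p"
proof -
  have "(\<Sum>v\<in>J. of_real (gform n (w, p) v) * y v)
     = of_nat (Suc (n w)) * (\<Sum>v\<in>J. of_bool (v = w) * y v) - of_nat (Suc (n p)) * (\<Sum>v\<in>J. of_bool (v = p) * y v)"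
    unfolding gform_def sum_distrib_left sum_subtractf[symmetric]
    by (rule sum.cong) (auto simp: of_bool_def algebra_simps)
  then show ?thesis using assms by (simp add: sum_of_bool_mult)
qed

text \<open>Exponents below \<open>N / 4\<close> put the roots on a quarter of the circle that
  starts at 1: their real parts are positive, so two of them cannot cancel, and any two of them
  enclose an angle below a right angle.\<close>

lemma rootv_inj:
  assumes "4 * \<theta> v < N" "4 * \<theta> w < N" "\<theta> v \<noteq> \<theta> w"
  shows "rootv N \<theta> v \<noteq> rootv N \<theta> w" "Re (rootv N \<theta> v) > 0" "Re (rootv N \<theta> v * cnj (rootv N \<theta> w)) > 0"
proof -
  define x where "x u = 2 * pi * real (\<theta> u) / real N" for u
  have N: "real N > 0" using assms by simp
  have x: "0 \<le> x u \<and> x u < pi / 2" if "4 * \<theta> u < N" for u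
  proof -
    have "real (4 * \<theta> u) < real N" using that by (simp only: of_nat_less_iff)
    then have "pi * (4 * real (\<theta> u)) < pi * real N" by simp
    then show ?thesis using N unfolding x_def by (simp add: field_simps)
  qed
  have xv: "0 \<le> x v" "x v < pi / 2" and xw: "0 \<le> x w" "x w < pi / 2"
    using x assms by auto
  have xne: "x v \<noteq> x w" using assms N by (simp add: x_def)
  have r: "rootv N \<theta> u = cis (x u)" for u by (simp add: rootv_def x_def)
  show "rootv N \<theta> v \<noteq> rootv N \<theta> w"
  proof
    assume "rootv N \<theta> v = rootv N \<theta> w"
    then have "cos (x v) = cos (x w)" unfolding r by (simp add: complex_eq_iff)
    then have "x v = x w" using xv xw cos_inj_pi[of "x v" "x w"] by linarith
    with xne show False by simp
  qed
  show "Re (rootv N \<theta> v) > 0" unfolding r using xv by (simp add: cos_gt_zero_pi)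
  show "Re (rootv N \<theta> v * cnj (rootv N \<theta> w)) > 0"
    unfolding r cis_cnj cis_mult using xv xw by (simp add: cos_gt_zero_pi)
qed

lemma norm_rootv [simp]: "cmod (rootv N \<theta> v) = 1"
  by (simp add: rootv_def)

lemma square_cnj_unit:
  assumes "cmod u = 1" "cmod v = 1" "\<sigma> = 1 \<or> \<sigma> = -1"
  shows "(u + of_real \<sigma> * v) * (u + of_real \<sigma> * v) * cnj u * cnj v = of_real (\<sigma> * (cmod (u + of_real \<sigma> * v))\<^sup>2)"
proof -
  have uu: "u * cnj u = 1" "v * cnj v = 1" using assms by (simp_all add: complex_norm_square[symmetric])
  have "(u + of_real \<sigma> * v) * cnj u * cnj v = (u * cnj u) * cnj v + of_real \<sigma> * (v * cnj v) * cnj u"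
    by (simp add: algebra_simps)
  also have "\<dots> = of_real \<sigma> * cnj (u + of_real \<sigma> * v)" using assms(3) uu by auto
  finally have "(u + of_real \<sigma> * v) * ((u + of_real \<sigma> * v) * cnj u * cnj v)
    = of_real \<sigma> * ((u + of_real \<sigma> * v) * cnj (u + of_real \<sigma> * v))" by simp
  then show ?thesis by (simp only: mult.assoc of_real_mult complex_norm_square[of "u + of_real \<sigma> * v", symmetric])
qed

text \<open>Each \<open>gform\<close> is the conjugate of what its row of type \<open>Inr\<close> contributes, each form of \<open>TS\<close> is
used twice, and the at most one remaining form contributes \<open>1 \<plusminus> y\<^sub>b / y\<^sub>a\<close>, whose real part is
nonnegative. So all terms of the average have real parts of the same sign.\<close>

theorem perl_positive:
  fixes TS sg :: "('a \<times> 'a \<times> real) list" and ms :: "('a \<times> 'a) list"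
  assumes "finite J"
    and TS: "\<And>a b \<sigma>. (a, b, \<sigma>) \<in> set (TS @ sg) \<Longrightarrow> a \<in> J \<and> b \<in> J \<and> a \<noteq> b \<and> (\<sigma> = 1 \<or> \<sigma> = -1)"
    and sg: "length sg \<le> 1"
    and ms: "distinct (map fst ms @ map snd ms)" "set (map fst ms @ map snd ms) \<subseteq> J"
    and ls: "mset ls = mset (concat (map (\<lambda>(a, b, \<sigma>). [a, b]) TS) @ map fst sg)"
    and fl: "fl = concat (map (\<lambda>t. [tform t, tform t]) TS) @ map tform sg @ map (gform (count (mset ls))) ms"
  shows "perl (\<lambda>r. rowval (fl ! r)) (map Inl ls @ map Inr ms) {..<length fl} \<noteq> 0"
proof
  assume 0: "perl (\<lambda>r. rowval (fl ! r)) (map Inl ls @ map Inr ms) {..<length fl} = 0"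
  define n where "n = count (mset ls)"
  \<comment> \<open>\<open>N\<close> exceeds the degree, as the inversion formula demands, and also
    four times \<open>card J\<close>, so that all labels can receive distinct exponents below
    \<open>N / 4\<close>.\<close>
  define N where "N = Suc (length fl + 4 * card J)"
  define sgn where "sgn = (\<Prod>(a, b, \<sigma>)\<leftarrow>TS. \<sigma>)"
  define P where "P = (\<lambda>\<theta>. (\<Prod>(a, b, \<sigma>)\<leftarrow>TS. (cmod (rootv N \<theta> a + of_real \<sigma> * rootv N \<theta> b))\<^sup>2)
      * (\<Prod>(w, p)\<leftarrow>ms. (cmod (of_nat (Suc (n w)) * rootv N \<theta> w - of_nat (Suc (n p)) * rootv N \<theta> p))\<^sup>2))"
  define Q where "Q = (\<lambda>\<theta>. \<Prod>(a, b, \<sigma>)\<leftarrow>sg. 1 + of_real \<sigma> * (rootv N \<theta> b * cnj (rootv N \<theta> a)))"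
  have len: "length fl = length ls + length ms"
  proof -
    have "length ls = size (mset ls)" by simp
    also have "\<dots> = 2 * length TS + length sg"
      unfolding ls by (simp add: length_concat sum_list_triv comp_def case_prod_unfold)
    finally show ?thesis unfolding fl by (simp add: length_concat sum_list_triv comp_def)
  qed
  have lsJ: "set ls \<subseteq> J"
  proof -
    have "set ls = set (concat (map (\<lambda>(a, b, \<sigma>). [a, b]) TS) @ map fst sg)"
      using ls by (metis set_mset_mset)
    then show ?thesis using TS by fastforce
  qed
  have sgn: "sgn = 1 \<or> sgn = -1"
  proof -
    have gen: "(\<Prod>(a, b, \<sigma>)\<leftarrow>TS. \<sigma>) = 1 \<or> (\<Prod>(a, b, \<sigma>)\<leftarrow>TS. \<sigma>) = -1"
      if "\<And>a b \<sigma>. (a, b, \<sigma>) \<in> set TS \<Longrightarrow> \<sigma> = 1 \<or> \<sigma> = -1" for TS :: "('a \<times> 'a \<times> real) list"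
      using that
    proof (induction TS)
      case (Cons t TS)
      obtain a b \<sigma> where t: "t = (a, b, \<sigma>)" by (cases t)
      then have "\<sigma> = 1 \<or> \<sigma> = -1" using Cons.prems[of a b \<sigma>] by simp
      moreover have "(\<Prod>(a, b, \<sigma>)\<leftarrow>TS. \<sigma>) = 1 \<or> (\<Prod>(a, b, \<sigma>)\<leftarrow>TS. \<sigma>) = -1"
        by (rule Cons.IH) (use Cons.prems in auto)
      ultimately show ?case by (auto simp: t)
    qed simp
    show ?thesis unfolding sgn_def
    proof (rule gen)
      fix a b \<sigma> assume "(a, b, \<sigma>) \<in> set TS"
      then show "\<sigma> = 1 \<or> \<sigma> = -1" using TS[of a b \<sigma>] by simp
    qed
  qed
  define Z where "Z = (\<lambda>\<theta>. (\<Prod>r<length fl. \<Sum>w\<in>J. of_real ((fl ! r) w) * rootv N \<theta> w) * (\<Prod>w\<leftarrow>ls. cnj (rootv N \<theta> w))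
        * (\<Prod>(w, p)\<leftarrow>ms. of_nat (Suc (n w)) * cnj (rootv N \<theta> w) - of_nat (Suc (n p)) * cnj (rootv N \<theta> p)))"
  \<comment> \<open>Two equal forms from \<open>TS\<close> absorb the conjugates of their two
    labels, the single form absorbs that of its first label, and each \<open>gform\<close> meets its
    own row.\<close>
  have Z: "Z \<theta> = of_real (sgn * P \<theta>) * Q \<theta>" for \<theta>
  proof -
    define y where "y = rootv N \<theta>"
    define e where "e = (\<lambda>f. \<Sum>w\<in>J. of_real (f w) * y w)"
    have "(\<Prod>r<length fl. \<Sum>w\<in>J. of_real ((fl ! r) w) * rootv N \<theta> w) = (\<Prod>f\<leftarrow>fl. e f)"
      by (simp add: e_def y_def prod.list_conv_set_nth atLeast0LessThan)
    also have "\<dots> = (\<Prod>t\<leftarrow>TS. e (tform t) * e (tform t)) * (\<Prod>t\<leftarrow>sg. e (tform t)) * (\<Prod>m\<leftarrow>ms. e (gform n m))"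
    proof -
      have "(\<Prod>f\<leftarrow>concat (map (\<lambda>t. [tform t, tform t]) TS). e f) = (\<Prod>t\<leftarrow>TS. e (tform t) * e (tform t))"
        by (induction TS) (auto simp: mult.assoc)
      then show ?thesis unfolding fl n_def by (simp add: comp_def mult.assoc)
    qed
    finally have F: "(\<Prod>r<length fl. \<Sum>w\<in>J. of_real ((fl ! r) w) * rootv N \<theta> w)
      = (\<Prod>t\<leftarrow>TS. e (tform t) * e (tform t)) * (\<Prod>t\<leftarrow>sg. e (tform t)) * (\<Prod>m\<leftarrow>ms. e (gform n m))" .
    have C: "(\<Prod>w\<leftarrow>ls. cnj (y w)) = (\<Prod>(a, b, \<sigma>)\<leftarrow>TS. cnj (y a) * cnj (y b)) * (\<Prod>t\<leftarrow>sg. cnj (y (fst t)))"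
    proof -
      have "(\<Prod>w\<leftarrow>ls. cnj (y w)) = (\<Prod>w\<leftarrow>concat (map (\<lambda>(a, b, \<sigma>). [a, b]) TS) @ map fst sg. cnj (y w))"
      proof -
        have "prod_mset (mset (map (\<lambda>w. cnj (y w)) ls))
          = prod_mset (mset (map (\<lambda>w. cnj (y w)) (concat (map (\<lambda>(a, b, \<sigma>). [a, b]) TS) @ map fst sg)))"
          unfolding mset_map ls ..
        then show ?thesis by (simp only: prod_mset_prod_list)
      qed
      also have "(\<Prod>w\<leftarrow>concat (map (\<lambda>(a, b, \<sigma>). [a, b]) TS). cnj (y w)) = (\<Prod>(a, b, \<sigma>)\<leftarrow>TS. cnj (y a) * cnj (y b))"
        by (induction TS) (auto simp: mult.assoc)
      then have "(\<Prod>w\<leftarrow>concat (map (\<lambda>(a, b, \<sigma>). [a, b]) TS) @ map fst sg. cnj (y w))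
          = (\<Prod>(a, b, \<sigma>)\<leftarrow>TS. cnj (y a) * cnj (y b)) * (\<Prod>t\<leftarrow>sg. cnj (y (fst t)))"
        by (simp add: comp_def)
      finally show ?thesis .
    qed
    have 1: "(\<Prod>t\<leftarrow>TS. e (tform t) * e (tform t)) * (\<Prod>(a, b, \<sigma>)\<leftarrow>TS. cnj (y a) * cnj (y b))
      = of_real (sgn * (\<Prod>(a, b, \<sigma>)\<leftarrow>TS. (cmod (y a + of_real \<sigma> * y b))\<^sup>2))"
    proof -
      have gen: "(\<Prod>t\<leftarrow>TS. e (tform t) * e (tform t)) * (\<Prod>(a, b, \<sigma>)\<leftarrow>TS. cnj (y a) * cnj (y b))
        = of_real ((\<Prod>(a, b, \<sigma>)\<leftarrow>TS. \<sigma>) * (\<Prod>(a, b, \<sigma>)\<leftarrow>TS. (cmod (y a + of_real \<sigma> * y b))\<^sup>2))"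
        if "\<And>a b \<sigma>. (a, b, \<sigma>) \<in> set TS \<Longrightarrow> a \<in> J \<and> b \<in> J \<and> a \<noteq> b \<and> (\<sigma> = 1 \<or> \<sigma> = -1)"
        for TS :: "('a \<times> 'a \<times> real) list"
        using that
      proof (induction TS)
        case (Cons t TS)
        obtain a b \<sigma> where t: "t = (a, b, \<sigma>)" by (cases t)
        then have ab: "a \<in> J" "b \<in> J" "\<sigma> = 1 \<or> \<sigma> = -1" using Cons.prems[of a b \<sigma>] by auto
        have "e (tform t) * e (tform t) * (cnj (y a) * cnj (y b)) = of_real (\<sigma> * (cmod (y a + of_real \<sigma> * y b))\<^sup>2)"
          unfolding e_def t sum_tform[OF assms(1) ab(1,2)]
          using square_cnj_unit[of "y a" "y b" \<sigma>] ab(3) by (simp add: y_def mult.assoc)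
        moreover have "(\<Prod>t\<leftarrow>TS. e (tform t) * e (tform t)) * (\<Prod>(a, b, \<sigma>)\<leftarrow>TS. cnj (y a) * cnj (y b))
        = of_real ((\<Prod>(a, b, \<sigma>)\<leftarrow>TS. \<sigma>) * (\<Prod>(a, b, \<sigma>)\<leftarrow>TS. (cmod (y a + of_real \<sigma> * y b))\<^sup>2))"
          by (rule Cons.IH) (use Cons.prems in auto)
        ultimately have "(e (tform t) * e (tform t) * (cnj (y a) * cnj (y b))) * ((\<Prod>t\<leftarrow>TS. e (tform t) * e (tform t)) * (\<Prod>(a, b, \<sigma>)\<leftarrow>TS. cnj (y a) * cnj (y b)))
          = of_real (\<sigma> * (cmod (y a + of_real \<sigma> * y b))\<^sup>2) * of_real ((\<Prod>(a, b, \<sigma>)\<leftarrow>TS. \<sigma>) * (\<Prod>(a, b, \<sigma>)\<leftarrow>TS. (cmod (y a + of_real \<sigma> * y b))\<^sup>2))"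
          by (simp only:)
        then show ?case by (simp add: t mult_ac)
      qed simp
      show ?thesis unfolding sgn_def
      proof (rule gen)
        fix a b \<sigma> assume "(a, b, \<sigma>) \<in> set TS"
        then show "a \<in> J \<and> b \<in> J \<and> a \<noteq> b \<and> (\<sigma> = 1 \<or> \<sigma> = -1)" using TS[of a b \<sigma>] by simp
      qed
    qed
    have 2: "(\<Prod>t\<leftarrow>sg. e (tform t)) * (\<Prod>t\<leftarrow>sg. cnj (y (fst t))) = Q \<theta>"
    proof (cases sg)
      case (Cons t sg')
      then have sg': "sg = [t]" using sg by simp
      obtain a b \<sigma> where t: "t = (a, b, \<sigma>)" by (cases t)
      then have ab: "a \<in> J" "b \<in> J" using TS[of a b \<sigma>] sg' by auto
      have "y a * cnj (y a) = 1" by (simp add: y_def complex_norm_square[symmetric])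
      moreover have "e (tform t) = y a + of_real \<sigma> * y b"
        unfolding e_def t by (rule sum_tform[OF assms(1) ab])
      ultimately show ?thesis unfolding Q_def sg'
        by (simp add: t distrib_right mult.assoc flip: y_def)
    qed (simp add: Q_def)
    have 3: "(\<Prod>m\<leftarrow>ms. e (gform n m)) * (\<Prod>(w, p)\<leftarrow>ms. of_nat (Suc (n w)) * cnj (y w) - of_nat (Suc (n p)) * cnj (y p))
       = of_real (\<Prod>(w, p)\<leftarrow>ms. (cmod (of_nat (Suc (n w)) * y w - of_nat (Suc (n p)) * y p))\<^sup>2)"
    proof -
      have "(\<Prod>m\<leftarrow>ms. e (gform n m)) * (\<Prod>(w, p)\<leftarrow>ms. of_nat (Suc (n w)) * cnj (y w) - of_nat (Suc (n p)) * cnj (y p))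
       = of_real (\<Prod>(w, p)\<leftarrow>ms. (cmod (of_nat (Suc (n w)) * y w - of_nat (Suc (n p)) * y p))\<^sup>2)"
        if "set (map fst ms @ map snd ms) \<subseteq> J" for ms
        using that
      proof (induction ms)
        case (Cons m ms)
        obtain w p where m: "m = (w, p)" by (cases m)
        define g where "g = of_nat (Suc (n w)) * y w - of_nat (Suc (n p)) * y p"
        have wp: "w \<in> J" "p \<in> J" using Cons.prems m by auto
        have "e (gform n m) = g" unfolding e_def m g_def by (rule sum_gform[OF assms(1) wp])
        moreover have "of_nat (Suc (n w)) * cnj (y w) - of_nat (Suc (n p)) * cnj (y p) = cnj g"
          by (simp add: g_def)
        moreover have "g * cnj g = of_real ((cmod g)\<^sup>2)" by (rule complex_norm_square[symmetric])
        moreover have "(\<Prod>m\<leftarrow>ms. e (gform n m)) * (\<Prod>(w, p)\<leftarrow>ms. of_nat (Suc (n w)) * cnj (y w) - of_nat (Suc (n p)) * cnj (y p))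
       = of_real (\<Prod>(w, p)\<leftarrow>ms. (cmod (of_nat (Suc (n w)) * y w - of_nat (Suc (n p)) * y p))\<^sup>2)"
          by (rule Cons.IH) (use Cons.prems in auto)
        ultimately have "(e (gform n m) * (of_nat (Suc (n w)) * cnj (y w) - of_nat (Suc (n p)) * cnj (y p)))
         * ((\<Prod>m\<leftarrow>ms. e (gform n m)) * (\<Prod>(w, p)\<leftarrow>ms. of_nat (Suc (n w)) * cnj (y w) - of_nat (Suc (n p)) * cnj (y p)))
         = of_real ((cmod g)\<^sup>2) * of_real (\<Prod>(w, p)\<leftarrow>ms. (cmod (of_nat (Suc (n w)) * y w - of_nat (Suc (n p)) * y p))\<^sup>2)"
          by (simp only:)
        then show ?case unfolding m list.map prod_list.Cons prod.case g_def[symmetric]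
          by (simp only: mult_ac of_real_mult)
      qed simp
      then show ?thesis using ms(2) by blast
    qed
    have "Z \<theta> = ((\<Prod>t\<leftarrow>TS. e (tform t) * e (tform t)) * (\<Prod>(a, b, \<sigma>)\<leftarrow>TS. cnj (y a) * cnj (y b)))
        * ((\<Prod>t\<leftarrow>sg. e (tform t)) * (\<Prod>t\<leftarrow>sg. cnj (y (fst t))))
        * ((\<Prod>m\<leftarrow>ms. e (gform n m)) * (\<Prod>(w, p)\<leftarrow>ms. of_nat (Suc (n w)) * cnj (y w) - of_nat (Suc (n p)) * cnj (y p)))"
      unfolding Z_def F unfolding y_def[symmetric] C by (simp only: mult_ac)
    then show ?thesis unfolding 1 2 3 P_def y_def[symmetric] by (simp add: mult_ac)
  qed
  have "of_real 0 * of_nat N ^ card J = (\<Prod>w\<in>J. fact (count (mset ls) w)) * (\<Sum>\<theta>\<in>PiE J (\<lambda>_. {..<N}). Z \<theta>)"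
    unfolding Z_def n_def 0[symmetric]
    by (rule perl_rows_eq_root_average) (use assms(1) ms len lsJ in \<open>auto simp: N_def\<close>)
  then have "(\<Sum>\<theta>\<in>PiE J (\<lambda>_. {..<N}). Z \<theta>) = 0"
    using assms(1) by (simp add: prod_zero_iff)
  then have "Re (\<Sum>\<theta>\<in>PiE J (\<lambda>_. {..<N}). Z \<theta>) = 0" by simp
  then have "sgn * (\<Sum>\<theta>\<in>PiE J (\<lambda>_. {..<N}). P \<theta> * Re (Q \<theta>)) = 0"
    unfolding Z by (simp add: sum_distrib_left mult.assoc)
  then have S0: "(\<Sum>\<theta>\<in>PiE J (\<lambda>_. {..<N}). P \<theta> * Re (Q \<theta>)) = 0" using sgn by auto
  have Pnn: "P \<theta> \<ge> 0" for \<theta>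
  proof -
    have "(\<Prod>(a, b, \<sigma>)\<leftarrow>TS. (cmod (rootv N \<theta> a + of_real \<sigma> * rootv N \<theta> b))\<^sup>2) \<ge> 0"
      by (induction TS) auto
    moreover have "(\<Prod>(w, p)\<leftarrow>ms. (cmod (of_nat (Suc (n w)) * rootv N \<theta> w - of_nat (Suc (n p)) * rootv N \<theta> p))\<^sup>2) \<ge> 0"
      by (induction ms) auto
    ultimately show ?thesis unfolding P_def by simp
  qed
  have Qnn: "Re (Q \<theta>) \<ge> 0" for \<theta>
  proof (cases sg)
    case (Cons t sg')
    then have sg': "sg = [t]" using sg by simp
    obtain a b \<sigma> where t: "t = (a, b, \<sigma>)" by (cases t)
    then have \<sigma>: "\<sigma> = 1 \<or> \<sigma> = -1" using TS[of a b \<sigma>] sg' by auto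
    have "cmod (rootv N \<theta> b * cnj (rootv N \<theta> a)) = 1" by (simp add: norm_mult)
    then have "\<bar>Re (rootv N \<theta> b * cnj (rootv N \<theta> a))\<bar> \<le> 1" by (metis abs_Re_le_cmod)
    moreover have "Re (Q \<theta>) = 1 + \<sigma> * Re (rootv N \<theta> b * cnj (rootv N \<theta> a))"
      unfolding Q_def sg' t by simp
    ultimately show ?thesis using \<sigma> by auto
  qed (simp add: Q_def)
  \<comment> \<open>It remains to find one strictly positive term; distinct small exponents for the
    labels provide it.\<close>
  obtain g where g: "bij_betw g J {0..<card J}" using ex_bij_betw_finite_nat[OF assms(1)] by blast
  define \<theta> where "\<theta> = restrict g J"
  have \<theta>small: "4 * \<theta> v < N" if "v \<in> J" for v
  proof -
    have "g v < card J" using g that by (auto simp: bij_betw_def)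
    then show ?thesis using that by (simp add: \<theta>_def N_def)
  qed
  have \<theta>inj: "\<theta> v \<noteq> \<theta> w" if "v \<in> J" "w \<in> J" "v \<noteq> w" for v w
    using g that by (auto simp: \<theta>_def bij_betw_def inj_on_def)
  have \<theta>P: "\<theta> \<in> PiE J (\<lambda>_. {..<N})" using \<theta>small by (fastforce simp: \<theta>_def)
  have root: "rootv N \<theta> v \<noteq> rootv N \<theta> w" "Re (rootv N \<theta> v) > 0"
    "Re (rootv N \<theta> v * cnj (rootv N \<theta> w)) > 0" if "v \<in> J" "w \<in> J" "v \<noteq> w" for v w
    using rootv_inj[of \<theta> v N w] \<theta>small \<theta>inj that by simp_all
  have "P \<theta> \<noteq> 0"
  proof -
    have "rootv N \<theta> a + of_real \<sigma> * rootv N \<theta> b \<noteq> 0" if "(a, b, \<sigma>) \<in> set TS" for a b \<sigma>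
    proof -
      have ab: "a \<in> J" "b \<in> J" "a \<noteq> b" "\<sigma> = 1 \<or> \<sigma> = -1" using TS[of a b \<sigma>] that by auto
      then show ?thesis using root(1)[of a b] root(2)[of a b] root(2)[of b a] by (auto simp: complex_eq_iff)
    qed
    moreover have "of_nat (Suc (n w)) * rootv N \<theta> w - of_nat (Suc (n p)) * rootv N \<theta> p \<noteq> 0" if "(w, p) \<in> set ms" for w p
    proof
      assume "of_nat (Suc (n w)) * rootv N \<theta> w - of_nat (Suc (n p)) * rootv N \<theta> p = 0"
      then have eq: "of_nat (Suc (n w)) * rootv N \<theta> w = of_nat (Suc (n p)) * rootv N \<theta> p" by simp
      then have "cmod (of_nat (Suc (n w)) * rootv N \<theta> w) = cmod (of_nat (Suc (n p)) * rootv N \<theta> p)" by (rule arg_cong)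
      \<comment> \<open>Equal moduli force \<open>n w = n p\<close>, and then the two roots would
        coincide.\<close>
      then have "n w = n p" unfolding norm_mult norm_of_nat by simp
      then have "rootv N \<theta> w = rootv N \<theta> p" using eq by (simp del: of_nat_Suc)
      moreover have "w \<in> set (map fst ms)" "p \<in> set (map snd ms)" using that by force+
      then have "w \<in> J" "p \<in> J" "w \<noteq> p" using ms by auto
      ultimately show False using root(1)[of w p] by simp
    qed
    ultimately show ?thesis unfolding P_def by (auto simp: prod_list_zero_iff)
  qed
  moreover have "Re (Q \<theta>) \<noteq> 0"
  proof (cases sg)
    case (Cons t sg')
    then have sg': "sg = [t]" using sg by simp
    obtain a b \<sigma> where t: "t = (a, b, \<sigma>)" by (cases t)
    then have ab: "a \<in> J" "b \<in> J" "a \<noteq> b" "\<sigma> = 1 \<or> \<sigma> = -1" using TS[of a b \<sigma>] sg' by auto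
    define z where "z = rootv N \<theta> b * cnj (rootv N \<theta> a)"
    have "cmod z = 1" by (simp add: z_def norm_mult)
    moreover have "Re z > 0" unfolding z_def using root(3)[of b a] ab by auto
    moreover have "z \<noteq> 1"
    proof
      assume "z = 1"
      then have "z * rootv N \<theta> a = rootv N \<theta> a" by simp
      moreover have "z * rootv N \<theta> a = rootv N \<theta> b * (rootv N \<theta> a * cnj (rootv N \<theta> a))" by (simp add: z_def)
      moreover have "rootv N \<theta> a * cnj (rootv N \<theta> a) = 1" by (simp add: complex_norm_square[symmetric])
      ultimately show False using root(1)[of a b] ab by simp
    qed
    moreover have "Re z \<noteq> 1"
    proof
      assume "Re z = 1"
      moreover have "(Re z)\<^sup>2 + (Im z)\<^sup>2 = 1" using \<open>cmod z = 1\<close> by (metis cmod_power2 one_power2)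
      ultimately show False using \<open>z \<noteq> 1\<close> by (simp add: complex_eq_iff)
    qed
    moreover have "Re z \<le> 1" using complex_Re_le_cmod[of z] \<open>cmod z = 1\<close> by simp
    \<comment> \<open>With \<open>Re z\<close> strictly between 0 and 1, the value
      \<open>1 + \<sigma> * Re z\<close> is positive for both signs.\<close>
    ultimately have "Re z < 1 \<and> Re z > 0" by simp
    moreover have "Re (Q \<theta>) = 1 + \<sigma> * Re z"
      unfolding Q_def sg' t z_def by simp
    ultimately show ?thesis using ab(4) by auto
  qed (simp add: Q_def)
  ultimately have "P \<theta> * Re (Q \<theta>) > 0" using Pnn[of \<theta>] Qnn[of \<theta>] by (simp add: less_le)
  then have "(\<Sum>\<theta>\<in>PiE J (\<lambda>_. {..<N}). P \<theta> * Re (Q \<theta>)) > 0"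
    using \<theta>P Pnn Qnn assms(1) by (intro sum_pos2[of _ \<theta>]) (auto intro!: finite_PiE)
  with S0 show False by simp
qed


section \<open>Boundaries of edge sets modulo 2\<close>

text \<open>The boundary map over the field with two elements; the sum of edge sets is
  \<open>sym_diff\<close>.\<close>

definition bd :: "'a set set \<Rightarrow> 'a set" where
  "bd D = {v. odd (card {e\<in>D. v \<in> e})}"

lemma odd_card_sym_diff:
  assumes "finite A" "finite B"
  shows "odd (card (sym_diff A B)) \<longleftrightarrow> odd (card A) \<noteq> odd (card B)"
proof -
  have "card (sym_diff A B) = card (A - B) + card (B - A)"
    using assms by (intro card_Un_disjoint) auto
  moreover have "card A = card (A - B) + card (A \<inter> B)" "card B = card (B - A) + card (A \<inter> B)"
    using assms by (metis card_Diff_subset_Int card_Int_Diff inf_commute add.commute finite_Int)+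
  ultimately show ?thesis by presburger
qed

lemma bd_sym_diff:
  assumes "finite A" "finite B"
  shows "v \<in> bd (sym_diff A B) \<longleftrightarrow> (v \<in> bd A) \<noteq> (v \<in> bd B)"
proof -
  have "{e\<in>sym_diff A B. v \<in> e} = sym_diff {e\<in>A. v \<in> e} {e\<in>B. v \<in> e}" by auto
  then show ?thesis using odd_card_sym_diff[of "{e\<in>A. v \<in> e}" "{e\<in>B. v \<in> e}"] assms
    by (simp add: bd_def)
qed

lemma bd_empty [simp]: "bd {} = {}"
  by (simp add: bd_def)

lemma bd_singleton [simp]: "bd {e} = e"
proof -
  have "{e'\<in>{e}. v \<in> e'} = (if v \<in> e then {e} else {})" for v by auto
  then show ?thesis by (auto simp: bd_def)
qed

lemma bd_insert:
  assumes "finite D" "e \<notin> D"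
  shows "v \<in> bd (insert e D) \<longleftrightarrow> (v \<in> e) \<noteq> (v \<in> bd D)"
proof -
  have "insert e D = sym_diff {e} D" using assms by auto
  then show ?thesis using bd_sym_diff[of "{e}" D v] assms by simp
qed

lemma bd_remove:
  assumes "finite D" "e \<in> D"
  shows "v \<in> bd (D - {e}) \<longleftrightarrow> (v \<in> e) \<noteq> (v \<in> bd D)"
  using bd_insert[of "D - {e}" e v] assms by (auto simp: insert_absorb)

lemma bd_Diff:
  assumes "finite D" "D1 \<subseteq> D"
  shows "v \<in> bd (D - D1) \<longleftrightarrow> (v \<in> bd D) \<noteq> (v \<in> bd D1)"
proof -
  have "D - D1 = sym_diff D D1" using assms by auto
  then show ?thesis using bd_sym_diff[of D D1 v] assms by (simp add: finite_subset)
qed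

lemma bd_in_edge:
  assumes "v \<in> bd D"
  shows "\<exists>e\<in>D. v \<in> e"
proof (rule ccontr)
  assume "\<not> ?thesis"
  then have "{e\<in>D. v \<in> e} = {}" by auto
  with assms show False by (simp add: bd_def)
qed

lemma closed_or_odd_end:
  assumes "finite D" "\<And>e. e \<in> D \<Longrightarrow> card e = 2" "{t, u} \<in> D"
  shows "\<exists>D1\<subseteq>D. D1 \<noteq> {} \<and> (bd D1 = {} \<or> (\<exists>s. s \<in> bd D \<and> s \<noteq> t \<and> bd D1 = {t, s}))"
  using assms
proof (induction "card D" arbitrary: D t u)
  case 0
  then show ?case by auto
next
  case (Suc n)
  have tu: "t \<noteq> u" using Suc.prems(2)[OF Suc.prems(3)] by auto
  show ?case
  proof (cases "u \<in> bd D")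
    case True
    then show ?thesis using tu Suc.prems by (intro exI[of _ "{{t, u}}"]) auto
  next
    case False
    define D' where "D' = D - {{t, u}}"
    have bdD': "v \<in> bd D' \<longleftrightarrow> (v \<in> {t, u}) \<noteq> (v \<in> bd D)" for v
      unfolding D'_def using Suc.prems by (intro bd_remove)
    then obtain e where e: "e \<in> D'" "u \<in> e" using bd_in_edge[of u D'] False by auto
    then obtain u' where u': "e = {u, u'}" using Suc.prems(2)[of e] by (auto simp: D'_def card_2_iff)
    have "n = card D'" using Suc.hyps(2) Suc.prems by (simp add: D'_def)
    moreover have "finite D'" "{u, u'} \<in> D'" "\<And>e. e \<in> D' \<Longrightarrow> card e = 2"
      using Suc.prems e u' by (auto simp: D'_def)
    ultimately obtain D1 where D1: "D1 \<subseteq> D'" "D1 \<noteq> {}"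
      "bd D1 = {} \<or> (\<exists>s. s \<in> bd D' \<and> s \<noteq> u \<and> bd D1 = {u, s})"
      using Suc.hyps(1)[of D' u u'] by blast
    from D1(3) show ?thesis
    proof
      assume "bd D1 = {}"
      then show ?thesis using D1 by (intro exI[of _ D1]) (auto simp: D'_def)
    next
      assume "\<exists>s. s \<in> bd D' \<and> s \<noteq> u \<and> bd D1 = {u, s}"
      then obtain s where s: "s \<in> bd D'" "s \<noteq> u" "bd D1 = {u, s}" by auto
      have "{t, u} \<notin> D1" "finite D1" using D1 \<open>finite D'\<close> by (auto simp: D'_def finite_subset)
      then have bd: "v \<in> bd (insert {t, u} D1) \<longleftrightarrow> (v \<in> {t, u}) \<noteq> (v \<in> {u, s})" for v
        using bd_insert[of D1 "{t, u}" v] s by simp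
      show ?thesis
      proof (cases "s = t")
        case True
        then have "bd (insert {t, u} D1) = {}" using bd by auto
        then show ?thesis using D1 Suc.prems(3)
          by (intro exI[of _ "insert {t, u} D1"]) (auto simp: D'_def)
      next
        case False
        then have "bd (insert {t, u} D1) = {t, s}" "s \<in> bd D" using bd s bdD' tu by auto
        then show ?thesis using D1 Suc.prems(3) False
          by (intro exI[of _ "insert {t, u} D1"]) (auto simp: D'_def)
      qed
    qed
  qed
qed

section \<open>Span of edges modulo 2\<close>

definition espan :: "'a set set \<Rightarrow> 'a set set" where
  "espan F = {bd D | D. finite D \<and> D \<subseteq> F}"

lemma espan_empty [simp]: "{} \<in> espan F"
  unfolding espan_def by (auto intro: exI[of _ "{}"])

lemma espan_edge: "e \<in> F \<Longrightarrow> e \<in> espan F"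
  unfolding espan_def by (auto intro!: exI[of _ "{e}"])


lemma espan_sym_diff:
  assumes "a \<in> espan F" "b \<in> espan F"
  shows "sym_diff a b \<in> espan F"
proof -
  obtain A B where AB: "finite A" "A \<subseteq> F" "a = bd A" "finite B" "B \<subseteq> F" "b = bd B"
    using assms by (auto simp: espan_def)
  have "bd (sym_diff A B) = sym_diff a b" using bd_sym_diff[of A B] AB by auto
  moreover have "finite (sym_diff A B)" "sym_diff A B \<subseteq> F" using AB by auto
  ultimately show ?thesis unfolding espan_def by blast
qed

lemma espan_least:
  assumes "\<And>e. e \<in> F \<Longrightarrow> e \<in> espan F'"
  shows "espan F \<subseteq> espan F'"
proof -
  have "bd D \<in> espan F'" if "finite D" "D \<subseteq> F" for D
    using that
  proof (induction D)
    case (insert e D)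
    have "bd (insert e D) = sym_diff e (bd D)" using bd_insert[of D e] insert by auto
    moreover have "sym_diff e (bd D) \<in> espan F'" by (rule espan_sym_diff) (use insert assms in auto)
    ultimately show ?case by simp
  qed simp
  then show ?thesis by (auto simp: espan_def)
qed

text \<open>Connectedness of \<open>U\<close> in linear form, which is easy to preserve when edges
  are exchanged. For \<open>u = v\<close> the term \<open>sym_diff {u} {v}\<close> is the zero
  vector, which \<open>{u, v}\<close> would not be.\<close>

definition spans_pairs :: "'a set set \<Rightarrow> 'a set \<Rightarrow> bool" where
  "spans_pairs F U \<longleftrightarrow> (\<forall>u\<in>U. \<forall>v\<in>U. sym_diff {u} {v} \<in> espan F)"

lemma spans_even:
  assumes "spans_pairs F U" "finite S" "S \<subseteq> U" "even (card S)"
  shows "S \<in> espan F"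
  using assms(2-)
proof (induction "card S" arbitrary: S rule: less_induct)
  case less
  show ?case
  proof (cases "S = {}")
    case False
    then obtain u where u: "u \<in> S" by auto
    have "S \<noteq> {u}" using less.prems by auto
    then obtain v where v: "v \<in> S" "v \<noteq> u" using u by auto
    define S' where "S' = S - {u} - {v}"
    have "S = insert u (insert v S')" "u \<notin> insert v S'" "v \<notin> S'" "finite S'"
      using u v less.prems by (auto simp: S'_def)
    then have card: "card S = Suc (Suc (card S'))" by simp
    have "S' \<in> espan F"
      by (rule less.hyps) (use card less.prems in \<open>auto simp: S'_def\<close>)
    moreover have "sym_diff {u} {v} \<in> espan F"
      using assms(1) u v less.prems unfolding spans_pairs_def by blast
    moreover have "S = sym_diff S' (sym_diff {u} {v})" using u v by (auto simp: S'_def)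
    ultimately show ?thesis using espan_sym_diff by metis
  qed simp
qed

text \<open>A signed pair \<open>(a, b, \<sigma>)\<close> stands for the form \<open>y\<^sub>a + \<sigma> y\<^sub>b\<close>; it is realized by edge coefficients
with that vertex sum.\<close>

abbreviation ends :: "'a \<times> 'a \<times> real \<Rightarrow> 'a list" where
  "ends t \<equiv> [fst t, fst (snd t)]"

definition realizes :: "'a set set \<Rightarrow> ('a \<times> 'a \<times> real) \<times> ('a set \<Rightarrow> real) \<Rightarrow> bool" where
  "realizes A q \<longleftrightarrow> (snd (snd (fst q)) = 1 \<or> snd (snd (fst q)) = -1) \<and>
     (\<forall>v. (\<Sum>e\<in>A. snd q e * ind e v) = tform (fst q) v)"

text \<open>Multiplying by \<open>\<sigma>\<close> exchanges the two coefficients because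
  \<open>\<sigma> * \<sigma> = 1\<close>; the support of \<open>c\<close> stays the same.\<close>

lemma realizes_swap:
  assumes "realizes A ((a, b, \<sigma>), c)"
  shows "realizes A ((b, a, \<sigma>), \<lambda>e. \<sigma> * c e)"
proof -
  have \<sigma>: "\<sigma> = 1 \<or> \<sigma> = -1" using assms by (simp add: realizes_def)
  have "(\<Sum>e\<in>A. \<sigma> * c e * ind e v) = \<sigma> * tform (a, b, \<sigma>) v" for v
    using assms by (simp add: realizes_def mult.assoc flip: sum_distrib_left)
  moreover have "\<sigma> * tform (a, b, \<sigma>) v = tform (b, a, \<sigma>) v" for v
    using \<sigma> by (auto simp: tform_def)
  ultimately show ?thesis using \<sigma> by (simp add: realizes_def)
qed

text \<open>Edge-disjoint trails join the odd vertices of \<open>D\<close> in pairs, and the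
  alternating sum of edges along a trail from \<open>a\<close> to \<open>b\<close> has vertex sum
  \<open>y_a + y_b\<close> or \<open>y_a - y_b\<close>, depending on the parity of its length. The
  induction builds these sums directly, one edge at an odd vertex at a time.\<close>

lemma boundary_decomposition:
  assumes "finite A" "D \<subseteq> A" "\<And>e. e \<in> D \<Longrightarrow> card e = 2"
  shows "\<exists>L. (\<forall>q\<in>set L. realizes A q \<and> (\<forall>e. e \<notin> D \<longrightarrow> snd q e = 0)) \<and>
    distinct (concat (map (\<lambda>q. ends (fst q)) L)) \<and> set (concat (map (\<lambda>q. ends (fst q)) L)) = bd D \<and>
    (\<forall>e. length (filter (\<lambda>q. snd q e \<noteq> 0) L) \<le> 1)"
  using assms(2,3)
proof (induction "card D" arbitrary: D)
  case 0
  then have "D = {}" using assms(1) by (simp add: finite_subset)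
  then show ?case by (intro exI[of _ "[]"]) auto
next
  case (Suc n)
  have finD: "finite D" using Suc.prems assms(1) by (simp add: finite_subset)
  show ?case
  proof (cases "bd D = {}")
    case True
    then show ?thesis by (intro exI[of _ "[]"]) auto
  next
    case False
    then obtain s where s: "s \<in> bd D" by auto
    obtain e where e: "e \<in> D" "s \<in> e" using bd_in_edge[OF s] by auto
    then obtain u where u: "e = {s, u}" "u \<noteq> s" using Suc.prems(2)[of e] by (auto simp: card_2_iff)
    define D' where "D' = D - {e}"
    have bdD': "v \<in> bd D' \<longleftrightarrow> (v \<in> {s, u}) \<noteq> (v \<in> bd D)" for v
      unfolding D'_def using bd_remove[of D e v] finD e u by simp
    have bdD'': "bd D' = sym_diff {s, u} (bd D)" by (rule set_eqI) (unfold bdD', blast)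
    have eA: "e \<in> A" using e Suc.prems by auto
    have sum1: "(\<Sum>e'\<in>A. of_bool (e' = e) * ind e' v) = ind e v" for v
    proof -
      have "(\<Sum>e'\<in>A. of_bool (e' = e) * ind e' v) = (\<Sum>e'\<in>A. if e' = e then ind e' v else 0)"
        by (rule sum.cong) auto
      then show ?thesis using assms(1) eA by simp
    qed
    have inde: "ind e v = of_bool (v = s) + of_bool (v = u)" for v using u by (auto simp: ind_def)
    have "n = card D'" using Suc.hyps(2) e finD by (simp add: D'_def)
    have D'A: "D' \<subseteq> A" and D'2: "\<And>e. e \<in> D' \<Longrightarrow> card e = 2" using Suc.prems by (auto simp: D'_def)
    obtain L where L: "\<And>q. q \<in> set L \<Longrightarrow> realizes A q \<and> (\<forall>e. e \<notin> D' \<longrightarrow> snd q e = 0)"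
      "distinct (concat (map (\<lambda>q. ends (fst q)) L))" "set (concat (map (\<lambda>q. ends (fst q)) L)) = bd D'"
      "\<And>e. length (filter (\<lambda>q. snd q e \<noteq> 0) L) \<le> 1"
      using Suc.hyps(1)[OF \<open>n = card D'\<close> D'A D'2] by blast
    have Le: "filter (\<lambda>q. snd q e \<noteq> 0) L = []"
      using L(1) by (auto simp: filter_empty_conv D'_def)
    show ?thesis
    proof (cases "u \<in> bd D")
      case True
      define q where "q = ((s, u, 1::real), \<lambda>e'. of_bool (e' = e) :: real)"
      have "realizes A q" unfolding realizes_def q_def using sum1 inde by (auto simp: tform_def)
      moreover have "length (filter (\<lambda>q. snd q e' \<noteq> 0) (q # L)) \<le> 1" for e'
        using L(4)[of e'] Le by (cases "e' = e") (auto simp: q_def)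
      moreover have "s \<notin> bd D'" "u \<notin> bd D'" "insert s (insert u (bd D')) = bd D"
        unfolding bdD'' using s True by blast+
      moreover have "\<forall>e. e \<notin> D \<longrightarrow> snd q e = 0" using e by (auto simp: q_def)
      moreover have "\<forall>q\<in>set L. realizes A q \<and> (\<forall>e. e \<notin> D \<longrightarrow> snd q e = 0)"
        using L(1) by (auto simp: D'_def)
      moreover have "concat (map (\<lambda>q. ends (fst q)) (q # L)) = s # u # concat (map (\<lambda>q. ends (fst q)) L)"
        by (simp add: q_def)
      ultimately show ?thesis using L(2,3) u(2) by (intro exI[of _ "q # L"]) auto
    next
      case False
      then have "u \<in> bd D'" unfolding bdD'' using u by blast
      then have "u \<in> set (concat (map (\<lambda>q. ends (fst q)) L))" unfolding L(3) .
      then obtain q where q: "q \<in> set L" "u \<in> set (ends (fst q))" unfolding set_concat set_map by blast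
      then obtain L1 L2 where L12: "L = L1 @ q # L2" by (meson split_list)
      obtain b \<sigma> c where b: "realizes A ((u, b, \<sigma>), c)" "\<And>e. e \<notin> D' \<Longrightarrow> c e = 0"
        "\<And>e. c e \<noteq> 0 \<Longrightarrow> snd q e \<noteq> 0" "set (ends (fst q)) = {u, b}"
      proof -
        obtain a a' \<sigma> c where qq: "q = ((a, a', \<sigma>), c)" by (metis prod.collapse)
        have r: "realizes A ((a, a', \<sigma>), c)" "\<And>e. e \<notin> D' \<Longrightarrow> c e = 0" using L(1)[OF q(1)] qq by auto
        consider "a = u" | "a' = u" using q(2) qq by auto
        then show thesis
        proof cases
          case 1
          show thesis by (rule that[of a' \<sigma> c]) (use r qq 1 in auto)
        next
          case 2
          show thesis by (rule that[of a \<sigma> "\<lambda>e. \<sigma> * c e"]) (use realizes_swap r qq 2 in auto)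
        qed
      qed
      \<comment> \<open>Without \<open>e\<close> the vertex \<open>u\<close> is odd, so some form
        ends there and is lengthened by \<open>e\<close>: subtracting
        \<open>y_u + \<sigma> y_b\<close> from the vertex sum \<open>y_s + y_u\<close> of
        \<open>e\<close> cancels \<open>u\<close> and leaves the sign
        \<open>- \<sigma>\<close>.\<close>
      define q' where "q' = ((s, b, - \<sigma>), \<lambda>e'. of_bool (e' = e) - c e')"
      have "realizes A q'"
      proof -
        have "(\<Sum>e'\<in>A. (of_bool (e' = e) - c e') * ind e' v) = ind e v - tform (u, b, \<sigma>) v" for v
          using b(1) sum1 by (simp add: realizes_def left_diff_distrib sum_subtractf)
        moreover have "ind e v - tform (u, b, \<sigma>) v = tform (s, b, - \<sigma>) v" for v
          unfolding inde tform_def by simp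
        ultimately show ?thesis using b(1) by (auto simp: realizes_def q'_def)
      qed
      moreover have "length (filter (\<lambda>q. snd q e' \<noteq> 0) (q' # L1 @ L2)) \<le> 1" for e'
        using L(4)[of e'] Le b(3)[of e'] unfolding L12
        by (cases "e' = e") (auto simp: q'_def split: if_splits)
      moreover have d: "distinct (ends (fst q) @ concat (map (\<lambda>q. ends (fst q)) (L1 @ L2)))"
        using L(2) unfolding L12 by auto
      moreover have "{u, b} \<union> set (concat (map (\<lambda>q. ends (fst q)) (L1 @ L2))) = bd D'"
        using L(3) b(4) unfolding L12 by auto
      moreover have "u \<noteq> b" using d b(4) by (auto simp: doubleton_eq_iff)
      moreover have "s \<notin> bd D'" "bd D = insert s (bd D' - {u})" unfolding bdD'' using s False u by blast+
      moreover have "{u, b} \<inter> set (concat (map (\<lambda>q. ends (fst q)) (L1 @ L2))) = {}"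
        using d unfolding distinct_append b(4) by blast
      moreover have "concat (map (\<lambda>q. ends (fst q)) (q' # L1 @ L2)) = s # b # concat (map (\<lambda>q. ends (fst q)) (L1 @ L2))"
        by (simp add: q'_def)
      moreover have "\<forall>e. e \<notin> D \<longrightarrow> snd q' e = 0" using e b(2) by (auto simp: q'_def D'_def)
      moreover have "\<forall>q\<in>set (L1 @ L2). realizes A q \<and> (\<forall>e. e \<notin> D \<longrightarrow> snd q e = 0)"
        using L(1) L12 by (auto simp: D'_def)
      ultimately show ?thesis
        apply (intro exI[of _ "q' # L1 @ L2"] conjI)
        subgoal by simp
        subgoal by (simp only: distinct.simps distinct_append) auto
        subgoal by (simp only: list.set) blast
        subgoal by blast
        done
    qed
  qed
qed


section \<open>Tokens, their pairing and the resulting load\<close>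

abbreviation labels :: "(('a \<times> 'a \<times> real) \<times> 'c) list \<Rightarrow> 'a list" where
  "labels TS \<equiv> concat (map (\<lambda>q. ends (fst q)) TS)"

abbreviation usage :: "('b \<times> ('e \<Rightarrow> real)) list \<Rightarrow> 'e \<Rightarrow> nat" where
  "usage TS e \<equiv> length (filter (\<lambda>q. snd q e \<noteq> 0) TS)"

lemma even_set_pairing:
  assumes "finite B" "even (card B)"
  shows "\<exists>ps. distinct (concat (map (\<lambda>p. [fst p, snd p]) ps)) \<and> set (concat (map (\<lambda>p. [fst p, snd p]) ps)) = B"
  using assms
proof (induction "card B" arbitrary: B rule: less_induct)
  case less
  show ?case
  proof (cases "B = {}")
    case True
    then show ?thesis by (intro exI[of _ "[]"]) auto
  next
    case False
    then obtain u where u: "u \<in> B" by auto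
    have "B \<noteq> {u}" using less.prems by auto
    then obtain v where v: "v \<in> B" "v \<noteq> u" using u by auto
    define B' where "B' = B - {u} - {v}"
    have B: "B = insert u (insert v B')" "u \<notin> insert v B'" "v \<notin> B'" "finite B'"
      using u v less.prems by (auto simp: B'_def)
    then have card: "card B = Suc (Suc (card B'))" by simp
    obtain ps where ps: "distinct (concat (map (\<lambda>p. [fst p, snd p]) ps))"
      "set (concat (map (\<lambda>p. [fst p, snd p]) ps)) = B'"
      using less.hyps[of B'] card less.prems B(4) by auto
    have eq: "concat (map (\<lambda>p. [fst p, snd p]) ((u, v) # ps)) = u # v # concat (map (\<lambda>p. [fst p, snd p]) ps)"
      by simp
    show ?thesis
    proof (intro exI[of _ "(u, v) # ps"] conjI)
      show "distinct (concat (map (\<lambda>p. [fst p, snd p]) ((u, v) # ps)))"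
        unfolding eq distinct.simps list.set ps(2) using ps(1) B by simp
      show "set (concat (map (\<lambda>p. [fst p, snd p]) ((u, v) # ps))) = B"
        unfolding eq list.set ps(2) using B by simp
    qed
  qed
qed

text \<open>The ends are pairwise distinct, so each pair can choose its two labels independently of
  the others.\<close>

lemma choose_labels:
  assumes "distinct (concat (map (\<lambda>q. [g q, h q]) L))"
    and "\<And>q. q \<in> set L \<Longrightarrow> \<exists>a\<in>M (g q). \<exists>b\<in>M (h q). a \<noteq> b"
  shows "\<exists>lab. \<forall>q\<in>set L. lab (g q) \<in> M (g q) \<and> lab (h q) \<in> M (h q) \<and> lab (g q) \<noteq> lab (h q)"
  using assms
proof (induction L)
  case (Cons q L)
  have "\<And>q. q \<in> set L \<Longrightarrow> \<exists>a\<in>M (g q). \<exists>b\<in>M (h q). a \<noteq> b" using Cons.prems(2) by auto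
  then obtain lab where lab: "\<forall>q\<in>set L. lab (g q) \<in> M (g q) \<and> lab (h q) \<in> M (h q) \<and> lab (g q) \<noteq> lab (h q)"
    using Cons.IH Cons.prems(1) by auto
  obtain a b where ab: "a \<in> M (g q)" "b \<in> M (h q)" "a \<noteq> b" using Cons.prems(2)[of q] by auto
  have ne: "g q \<noteq> h q" "\<And>q'. q' \<in> set L \<Longrightarrow> g q' \<noteq> g q \<and> g q' \<noteq> h q \<and> h q' \<noteq> g q \<and> h q' \<noteq> h q"
    using Cons.prems(1) by fastforce+
  show ?case
    by (intro exI[of _ "lab(g q := a, h q := b)"]) (use lab ab ne in auto)
qed simp

lemma distinct_concat_snd:
  assumes "distinct us" "\<And>v. v \<in> set us \<Longrightarrow> distinct (f v)" "\<And>v t. v \<in> set us \<Longrightarrow> t \<in> set (f v) \<Longrightarrow> snd t = v"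
  shows "distinct (concat (map f us))"
  using assms
proof (induction us)
  case (Cons u us)
  have "set (f u) \<inter> set (concat (map f us)) = {}"
  proof (rule ccontr)
    assume "\<not> ?thesis"
    then obtain t v where "t \<in> set (f u)" "v \<in> set us" "t \<in> set (f v)" by auto
    then show False using Cons.prems(3)[of u t] Cons.prems(3)[of v t] Cons.prems(1) by auto
  qed
  moreover have "distinct (concat (map f us))" by (rule Cons.IH) (use Cons.prems in auto)
  ultimately show ?case using Cons.prems(2)[of u] by simp
qed simp

lemma length_filter_concat_le:
  assumes "\<And>x. x \<in> set xs \<Longrightarrow> P x \<Longrightarrow> \<exists>y\<in>set (g x). Q y"
  shows "length (filter P xs) \<le> length (filter Q (concat (map g xs)))"
  using assms
proof (induction xs)
  case (Cons x xs)
  have "of_bool (P x) \<le> length (filter Q (g x))"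
    using Cons.prems[of x] by (cases "P x") (auto simp: Suc_le_eq filter_empty_conv)
  moreover have "length (filter P (x # xs)) = of_bool (P x) + length (filter P xs)" by simp
  moreover have "length (filter P xs) \<le> length (filter Q (concat (map g xs)))"
    by (rule Cons.IH) (use Cons.prems in auto)
  ultimately show ?case by (simp del: filter.simps of_bool_eq_iff split_of_bool)
qed simp

lemma length_filter_mono:
  assumes "\<And>x. x \<in> set xs \<Longrightarrow> P x \<Longrightarrow> Q x"
  shows "length (filter P xs) \<le> length (filter Q xs)"
  using assms by (induction xs) (auto simp: le_SucI)

lemma length_filter_or: "length (filter (\<lambda>x. P x \<or> Q x) xs) \<le> length (filter P xs) + length (filter Q xs)"
  by (induction xs) auto

lemma length_filter_distinct: "distinct xs \<Longrightarrow> length (filter P xs) = card {x\<in>set xs. P x}"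
  by (metis distinct_card distinct_filter set_filter)

lemma count_map_distinct: "distinct xs \<Longrightarrow> count (mset (map f xs)) l = card {x\<in>set xs. f x = l}"
proof (induction xs)
  case (Cons x xs)
  have "{y\<in>set (x # xs). f y = l} = (if f x = l then insert x {y\<in>set xs. f y = l} else {y\<in>set xs. f y = l})"
    by auto
  then show ?case using Cons by simp
qed simp

lemma sum_arm:
  assumes "finite A" "{l, v} \<in> A" "l \<noteq> v"
  shows "(\<Sum>e\<in>A. of_bool (e = {l, v}) * ind e x) = (of_bool (x = l) + of_bool (x = v) :: real)"
proof -
  have "(\<Sum>e\<in>A. of_bool (e = {l, v}) * ind e x) = (\<Sum>e\<in>A. if e = {l, v} then ind e x else 0)"
    by (rule sum.cong) auto
  then show ?thesis using assms by (auto simp: ind_def)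
qed

text \<open>Vertex \<open>v\<close> carries one token for every label in \<open>Mv v\<close>. The connectors decomposing \<open>D\<close> pair one
token of each vertex with an odd number of them; the remaining tokens are paired at their
vertex.\<close>

lemma trails_from_tokens:
  assumes "finite (A :: 'a set set)" "D \<subseteq> A" "\<And>e. e \<in> D \<Longrightarrow> card e = 2" "finite U"
    and MJ: "\<And>v. v \<in> U \<Longrightarrow> v \<in> J \<Longrightarrow> Mv v \<subseteq> {v}"
    and MX: "\<And>v l. v \<in> U \<Longrightarrow> v \<notin> J \<Longrightarrow> l \<in> Mv v \<Longrightarrow> l \<in> J \<and> {l, v} \<in> A"
    and Mfin: "\<And>v. v \<in> U \<Longrightarrow> finite (Mv v)"
    and bdD: "bd D = {v\<in>U. odd (card (Mv v))}"
    and choice: "\<And>s s'. s \<in> bd D \<Longrightarrow> s' \<in> bd D \<Longrightarrow> s \<noteq> s' \<Longrightarrow> \<exists>a\<in>Mv s. \<exists>b\<in>Mv s'. a \<noteq> b"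
  shows "\<exists>TS. (\<forall>q\<in>set TS. realizes A q \<and> set (ends (fst q)) \<subseteq> J \<and> distinct (ends (fst q))) \<and>
    (\<forall>l. count (mset (labels TS)) l = card {v\<in>U. l \<in> Mv v}) \<and>
    (\<forall>e. usage TS e
       \<le> of_bool (\<exists>v\<in>U - J. \<exists>l\<in>Mv v. e = {l, v}) + of_bool (e \<in> D))"
proof -
  obtain L where L: "\<And>q. q \<in> set L \<Longrightarrow> realizes A q \<and> (\<forall>e. e \<notin> D \<longrightarrow> snd q e = 0)"
    "distinct (labels L)" "set (labels L) = bd D"
    "\<And>e. usage L e \<le> 1"
    using boundary_decomposition[OF assms(1-3)] by blast
  have Lends: "fst (fst q) \<in> bd D" "fst (snd (fst q)) \<in> bd D" "fst (fst q) \<noteq> fst (snd (fst q))" if q: "q \<in> set L" for q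
  proof -
    show "fst (fst q) \<in> bd D" "fst (snd (fst q)) \<in> bd D" using q unfolding L(3)[symmetric] by auto
    obtain L1 L2 where "L = L1 @ q # L2" using q by (meson split_list)
    then show "fst (fst q) \<noteq> fst (snd (fst q))" using L(2) by auto
  qed
  have "\<exists>lab. \<forall>q\<in>set L. lab (fst (fst q)) \<in> Mv (fst (fst q)) \<and> lab (fst (snd (fst q))) \<in> Mv (fst (snd (fst q)))
      \<and> lab (fst (fst q)) \<noteq> lab (fst (snd (fst q)))"
    by (rule choose_labels) (use L(2) Lends choice in auto)
  then obtain lab where lab2: "\<And>q. q \<in> set L \<Longrightarrow> lab (fst (fst q)) \<in> Mv (fst (fst q))
      \<and> lab (fst (snd (fst q))) \<in> Mv (fst (snd (fst q))) \<and> lab (fst (fst q)) \<noteq> lab (fst (snd (fst q)))" by blast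
  have lab: "lab s \<in> Mv s" if "s \<in> bd D" for s
    using that lab2 unfolding L(3)[symmetric] by auto
  \<comment> \<open>The tokens still to be paired at \<open>v\<close>: an odd number loses one to a
    connector, so an even number is left.\<close>
  define R where "R = (\<lambda>v. Mv v - (if v \<in> bd D then {lab v} else {}))"
  have Rfin: "finite (R v)" and Reven: "even (card (R v))" if "v \<in> U" for v
    using that Mfin[OF that] lab[of v] bdD by (auto simp: R_def)
  have "\<forall>v\<in>U. \<exists>ps. distinct (concat (map (\<lambda>p. [fst p, snd p]) ps))
      \<and> set (concat (map (\<lambda>p. [fst p, snd p]) ps)) = R v"
    using even_set_pairing[OF Rfin Reven] by blast
  from bchoice[OF this] obtain pl where pl: "\<And>v. v \<in> U \<Longrightarrow> distinct (concat (map (\<lambda>p. [fst p, snd p]) (pl v)))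
      \<and> set (concat (map (\<lambda>p. [fst p, snd p]) (pl v))) = R v" by blast
  obtain us where us: "distinct us" "set us = U" using finite_distinct_list[OF \<open>finite U\<close>] by blast
  \<comment> \<open>A label \<open>l\<close> is reached from an outside vertex \<open>s\<close> by
    subtracting the arm \<open>{l, s}\<close>, and \<open>y_s - (y_l + y_s) = - y_l\<close> flips
    the sign. In \<open>J\<close> the token is the vertex itself.\<close>
  define \<tau> where "\<tau> s = (if s \<in> J then 1 else -1 :: real)" for s
  define arm where "arm s e = (of_bool (s \<notin> J \<and> e = {lab s, s}) :: real)" for s e
  \<comment> \<open>An entry stores a form, its edge coefficients and the tokens it consumes. The
    factor \<open>\<tau> s\<close> normalizes the coefficient of the first label to 1.\<close>
  define e1 where "e1 q = (case q of ((s, s', \<sigma>), c) \<Rightarrow>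
      (((lab s, lab s', \<tau> s * \<sigma> * \<tau> s'), \<lambda>e. \<tau> s * (c e - arm s e - \<sigma> * arm s' e)), [(lab s, s), (lab s', s')]))" for q
  \<comment> \<open>Two tokens at one outside vertex: the difference of their arms cancels the
    vertex.\<close>
  define e2 where "e2 v p = (((fst p, snd p, -1 :: real), \<lambda>e. of_bool (e = {fst p, v}) - of_bool (e = {snd p, v}) :: real),
      [(fst p, v), (snd p, v)])" for v :: 'a and p :: "'a \<times> 'a"
  define TX2 where "TX2 = concat (map (\<lambda>v. map (e2 v) (pl v)) us)"
  define TX where "TX = map e1 L @ TX2"
  have toks1: "concat (map snd (map e1 L)) = map (\<lambda>s. (lab s, s)) (labels L)"
    by (induction L) (auto simp: e1_def split: prod.splits)
  have toks2: "concat (map snd TX2) = concat (map (\<lambda>v. map (\<lambda>l. (l, v)) (concat (map (\<lambda>p. [fst p, snd p]) (pl v)))) us)"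
  proof -
    have *: "concat (map snd (map (e2 v) ps)) = map (\<lambda>l. (l, v)) (concat (map (\<lambda>p. [fst p, snd p]) ps))" for v ps
      by (induction ps) (auto simp: e2_def)
    have "concat (map snd (concat (map (\<lambda>v. map (e2 v) (pl v)) us)))
      = concat (map (\<lambda>v. concat (map snd (map (e2 v) (pl v)))) us)" for us
      by (induction us) auto
    then show ?thesis unfolding TX2_def * .
  qed
  have set1: "set (concat (map snd (map e1 L))) = (\<lambda>s. (lab s, s)) ` bd D"
    unfolding toks1 set_map L(3) ..
  have set2: "set (concat (map snd TX2)) = (\<Union>v\<in>U. (\<lambda>l. (l, v)) ` R v)"
  proof -
    have "set (concat (map (\<lambda>v. map (\<lambda>l. (l, v)) (concat (map (\<lambda>p. [fst p, snd p]) (pl v)))) us))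
      = (\<Union>v\<in>U. (\<lambda>l. (l, v)) ` set (concat (map (\<lambda>p. [fst p, snd p]) (pl v))))"
      unfolding set_concat set_map us(2) by (simp add: image_image)
    then show ?thesis unfolding toks2 using pl by simp
  qed
  have dist: "distinct (concat (map snd TX))"
  proof -
    have "distinct (concat (map snd (map e1 L)))"
      unfolding toks1 distinct_map using L(2) by (auto simp: inj_on_def)
    moreover have "distinct (concat (map snd TX2))"
      unfolding toks2 by (rule distinct_concat_snd) (use us pl in \<open>auto simp: distinct_map inj_on_def\<close>)
    moreover have "set (concat (map snd (map e1 L))) \<inter> set (concat (map snd TX2)) = {}"
      unfolding set1 set2 by (auto simp: R_def)
    ultimately show ?thesis unfolding TX_def by simp
  qed
  have setTX: "set (concat (map snd TX)) = {(l, v). v \<in> U \<and> l \<in> Mv v}"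
  proof -
    have "set (concat (map snd TX)) = (\<lambda>s. (lab s, s)) ` bd D \<union> (\<Union>v\<in>U. (\<lambda>l. (l, v)) ` R v)"
      unfolding TX_def map_append concat_append set_append set1 set2 ..
    also have "\<dots> = {(l, v). v \<in> U \<and> l \<in> Mv v}"
    proof (intro set_eqI iffI)
      fix t assume "t \<in> (\<lambda>s. (lab s, s)) ` bd D \<union> (\<Union>v\<in>U. (\<lambda>l. (l, v)) ` R v)"
      then show "t \<in> {(l, v). v \<in> U \<and> l \<in> Mv v}" using lab bdD by (auto simp: R_def)
    next
      fix t assume "t \<in> {(l, v). v \<in> U \<and> l \<in> Mv v}"
      then obtain l v where t: "t = (l, v)" "v \<in> U" "l \<in> Mv v" by auto
      show "t \<in> (\<lambda>s. (lab s, s)) ` bd D \<union> (\<Union>v\<in>U. (\<lambda>l. (l, v)) ` R v)"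
      proof (cases "v \<in> bd D \<and> l = lab v")
        case True
        then show ?thesis using t by blast
      next
        case False
        then have "l \<in> R v" using t by (auto simp: R_def)
        then show ?thesis using t by blast
      qed
    qed
    finally show ?thesis .
  qed
  have ends_toks: "labels (map fst TX) = map fst (concat (map snd TX))"
  proof -
    have "ends (fst (fst x)) = map fst (snd x)" if "x \<in> set TX" for x
      using that unfolding TX_def TX2_def by (auto simp: e1_def e2_def split: prod.splits)
    then show ?thesis by (simp add: map_concat comp_def cong: map_cong)
  qed
  have \<tau>: "\<tau> s = 1 \<or> \<tau> s = -1" for s by (simp add: \<tau>_def)
  have real1: "realizes A (fst (e1 q)) \<and> set (ends (fst (fst (e1 q)))) \<subseteq> J \<and> distinct (ends (fst (fst (e1 q))))"
    if q: "q \<in> set L" for q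
  proof -
    obtain s s' \<sigma> c where qq: "q = ((s, s', \<sigma>), c)" by (metis prod.collapse)
    have s: "s \<in> bd D" "s' \<in> bd D" using Lends[OF q] qq by auto
    have labs: "lab s \<noteq> lab s'" using lab2[OF q] qq by auto
    have inJ: "lab v \<in> J" if "v \<in> bd D" for v
      using lab[OF that] MJ[of v] MX[of v "lab v"] that bdD by (cases "v \<in> J") auto
    have \<sigma>: "\<sigma> = 1 \<or> \<sigma> = -1" "\<And>v. (\<Sum>e\<in>A. c e * ind e v) = of_bool (v = s) + \<sigma> * of_bool (v = s')"
      using L(1)[OF q] by (auto simp: realizes_def qq tform_def)
    have arm: "of_bool (x = v) - (\<Sum>e\<in>A. arm v e * ind e x) = \<tau> v * of_bool (x = lab v)" if v: "v \<in> bd D" for x v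
    proof (cases "v \<in> J")
      case True
      then have "lab v = v" using lab[OF v] MJ[of v] v bdD by auto
      then show ?thesis using True by (simp add: arm_def \<tau>_def)
    next
      case False
      then have "lab v \<in> J" "{lab v, v} \<in> A" "lab v \<noteq> v"
        using MX[of v "lab v"] lab[OF v] v bdD by auto
      then show ?thesis using False sum_arm[OF assms(1), of "lab v" v x] by (simp add: arm_def \<tau>_def)
    qed
    have "(\<Sum>e\<in>A. \<tau> s * (c e - arm s e - \<sigma> * arm s' e) * ind e x) = tform (lab s, lab s', \<tau> s * \<sigma> * \<tau> s') x" for x
    proof -
    have "(\<Sum>e\<in>A. \<tau> s * (c e - arm s e - \<sigma> * arm s' e) * ind e x)
        = \<tau> s * ((\<Sum>e\<in>A. c e * ind e x) - (\<Sum>e\<in>A. arm s e * ind e x) - \<sigma> * (\<Sum>e\<in>A. arm s' e * ind e x))"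
      by (simp add: sum_distrib_left sum_subtractf sum.distrib algebra_simps)
    also have "\<dots> = \<tau> s * ((of_bool (x = s) - (\<Sum>e\<in>A. arm s e * ind e x)) + \<sigma> * (of_bool (x = s') - (\<Sum>e\<in>A. arm s' e * ind e x)))"
      unfolding \<sigma>(2) by (simp add: algebra_simps)
    also have "\<dots> = \<tau> s * (\<tau> s * of_bool (x = lab s) + \<sigma> * (\<tau> s' * of_bool (x = lab s')))"
      unfolding arm[OF s(1)] arm[OF s(2)] ..
    also have "\<dots> = tform (lab s, lab s', \<tau> s * \<sigma> * \<tau> s') x"
      using \<tau>[of s] by (auto simp: tform_def)
    finally show ?thesis .
    qed
    then have "realizes A (fst (e1 q))"
      using \<tau>[of s] \<tau>[of s'] \<sigma>(1) by (auto simp: realizes_def e1_def qq)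
    then show ?thesis using labs inJ s by (auto simp: e1_def qq)
  qed
  have real2: "realizes A (fst (e2 v p)) \<and> set (ends (fst (fst (e2 v p)))) \<subseteq> J \<and> distinct (ends (fst (fst (e2 v p))))"
    if v: "v \<in> U" and p: "p \<in> set (pl v)" for v p
  proof -
    have mem: "fst p \<in> R v" "snd p \<in> R v" using pl[OF v] p by auto
    obtain p1 p2 where "pl v = p1 @ p # p2" using p by (meson split_list)
    then have ne: "fst p \<noteq> snd p" using pl[OF v] by auto
    have "v \<notin> J" using MJ[of v] v mem ne by (auto simp: R_def)
    then have fs: "fst p \<in> J" "{fst p, v} \<in> A" "fst p \<noteq> v" "snd p \<in> J" "{snd p, v} \<in> A" "snd p \<noteq> v"
      using MX[of v "fst p"] MX[of v "snd p"] v mem by (auto simp: R_def)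
    have "(\<Sum>e\<in>A. (of_bool (e = {fst p, v}) - of_bool (e = {snd p, v})) * ind e x) = tform (fst p, snd p, -1) x" for x
      unfolding left_diff_distrib sum_subtractf using sum_arm[OF assms(1) fs(2,3), of x] sum_arm[OF assms(1) fs(5,6), of x]
      by (simp add: tform_def)
    then show ?thesis using ne fs by (auto simp: realizes_def e2_def)
  qed
  \<comment> \<open>Each token occurs in one entry only, so an arm is charged once for its token and
    once more if a connector runs through it.\<close>
  have load: "usage (map fst TX) e
       \<le> of_bool (\<exists>v\<in>U - J. \<exists>l\<in>Mv v. e = {l, v}) + of_bool (e \<in> D)" for e
  proof -
    define Q where "Q = (\<lambda>t. snd t \<notin> J \<and> e = {fst t, snd t})"
    have "usage (map fst TX) e = length (filter (\<lambda>x. snd (fst x) e \<noteq> 0) TX)"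
      by (simp add: filter_map comp_def)
    also have "\<dots> \<le> length (filter (\<lambda>x. (\<exists>t\<in>set (snd x). Q t)) TX) + usage L e"
    proof -
      have "length (filter (\<lambda>x. snd (fst x) e \<noteq> 0) (map e1 L)) = length (filter (\<lambda>q. snd (fst (e1 q)) e \<noteq> 0) L)"
        by (simp add: filter_map comp_def)
      also have "\<dots> \<le> length (filter (\<lambda>q. (\<exists>t\<in>set (snd (e1 q)). Q t) \<or> snd q e \<noteq> 0) L)"
      proof (rule length_filter_mono)
        fix q assume nz: "snd (fst (e1 q)) e \<noteq> 0"
        obtain s s' \<sigma> c where qq: "q = ((s, s', \<sigma>), c)" by (metis prod.collapse)
        have Q: "Q (lab s, s)" if "arm s e \<noteq> 0" for s
          using that by (cases "s \<notin> J \<and> e = {lab s, s}") (auto simp: arm_def Q_def)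
        have "c e \<noteq> 0 \<or> arm s e \<noteq> 0 \<or> arm s' e \<noteq> 0"
          using nz by (auto simp: e1_def qq)
        then show "(\<exists>t\<in>set (snd (e1 q)). Q t) \<or> snd q e \<noteq> 0"
          using Q[of s] Q[of s'] by (auto simp: e1_def qq)
      qed
      also have "\<dots> \<le> length (filter (\<lambda>q. \<exists>t\<in>set (snd (e1 q)). Q t) L) + usage L e"
        by (rule length_filter_or)
      also have "length (filter (\<lambda>q. \<exists>t\<in>set (snd (e1 q)). Q t) L) = length (filter (\<lambda>x. \<exists>t\<in>set (snd x). Q t) (map e1 L))"
        by (simp add: filter_map comp_def)
      finally have 1: "length (filter (\<lambda>x. snd (fst x) e \<noteq> 0) (map e1 L))
        \<le> length (filter (\<lambda>x. \<exists>t\<in>set (snd x). Q t) (map e1 L)) + usage L e" .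
      have 2: "length (filter (\<lambda>x. snd (fst x) e \<noteq> 0) TX2) \<le> length (filter (\<lambda>x. \<exists>t\<in>set (snd x). Q t) TX2)"
      proof (rule length_filter_mono)
        fix x assume "x \<in> set TX2" and nz: "snd (fst x) e \<noteq> 0"
        then obtain v p where v: "v \<in> U" "p \<in> set (pl v)" "x = e2 v p" unfolding TX2_def using us by auto
        have "v \<notin> J"
        proof
          assume "v \<in> J"
          then have "R v \<subseteq> {v}" using MJ[of v] v by (auto simp: R_def)
          moreover have "fst p \<in> R v" "snd p \<in> R v" using pl[OF v(1)] v(2) by auto
          moreover obtain p1 p2 where "pl v = p1 @ p # p2" using v(2) by (meson split_list)
          then have "fst p \<noteq> snd p" using pl[OF v(1)] by auto
          ultimately show False by auto
        qed
        then show "\<exists>t\<in>set (snd x). Q t"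
          using nz unfolding v(3)
          by (cases "e = {fst p, v}"; cases "e = {snd p, v}") (simp_all add: e2_def Q_def)
      qed
      show ?thesis using 1 2 unfolding TX_def by simp
    qed
    also have "usage L e \<le> of_bool (e \<in> D)"
    proof (cases "e \<in> D")
      case True
      then show ?thesis using L(4)[of e] by simp
    next
      case False
      then have "filter (\<lambda>q. snd q e \<noteq> 0) L = []" using L(1) by (auto simp: filter_empty_conv)
      then show ?thesis by simp
    qed
    also have "length (filter (\<lambda>x. \<exists>t\<in>set (snd x). Q t) TX) \<le> length (filter Q (concat (map snd TX)))"
      by (rule length_filter_concat_le) auto
    also have "\<dots> = card {t. t \<in> {(l, v). v \<in> U \<and> l \<in> Mv v} \<and> Q t}"
      unfolding length_filter_distinct[OF dist] setTX ..
    also have "\<dots> \<le> of_bool (\<exists>v\<in>U - J. \<exists>l\<in>Mv v. e = {l, v})"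
    proof (cases "\<exists>v\<in>U - J. \<exists>l\<in>Mv v. e = {l, v}")
      case True
      then obtain v l where vl: "v \<in> U" "v \<notin> J" "l \<in> Mv v" "e = {l, v}" by auto
      have "l \<in> J" using MX vl by blast
      have "{t. t \<in> {(l, v). v \<in> U \<and> l \<in> Mv v} \<and> Q t} \<subseteq> {(l, v)}"
        using vl \<open>l \<in> J\<close> by (auto simp: Q_def doubleton_eq_iff)
      then have "card {t. t \<in> {(l, v). v \<in> U \<and> l \<in> Mv v} \<and> Q t} \<le> card {(l, v)}"
        by (intro card_mono) auto
      then show ?thesis using True by simp
    next
      case False
      then have "{t. t \<in> {(l, v). v \<in> U \<and> l \<in> Mv v} \<and> Q t} = {}" by (auto simp: Q_def)
      then show ?thesis by (simp only: card.empty le0)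
    qed
    finally show ?thesis by simp
  qed
  have cnt: "count (mset (labels (map fst TX))) l = card {v\<in>U. l \<in> Mv v}" for l
  proof -
    have "count (mset (labels (map fst TX))) l = card {t\<in>set (concat (map snd TX)). fst t = l}"
      unfolding ends_toks by (rule count_map_distinct[OF dist])
    also have "{t\<in>set (concat (map snd TX)). fst t = l} = (\<lambda>v. (l, v)) ` {v\<in>U. l \<in> Mv v}"
      unfolding setTX by auto
    also have "card \<dots> = card {v\<in>U. l \<in> Mv v}" by (intro card_image) (auto simp: inj_on_def)
    finally show ?thesis .
  qed
  have "\<forall>q\<in>set (map fst TX). realizes A q \<and> set (ends (fst q)) \<subseteq> J \<and> distinct (ends (fst q))"
  proof
    fix q assume "q \<in> set (map fst TX)"
    then consider q0 where "q0 \<in> set L" "q = fst (e1 q0)" | v p where "v \<in> U" "p \<in> set (pl v)" "q = fst (e2 v p)"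
      unfolding TX_def TX2_def using us(2) by auto
    then show "realizes A q \<and> set (ends (fst q)) \<subseteq> J \<and> distinct (ends (fst q))"
      by cases (use real1 real2 in blast)+
  qed
  then show ?thesis using cnt load by blast
qed


section \<open>Labels, tokens and free joins\<close>

text \<open>\<open>J\<close> is the set of labels. The edges inside \<open>J\<close> form a matching, and a triple \<open>(w, p, x) \<in> T\<close> is
a matched pair \<open>w, p\<close> together with a common neighbour \<open>x\<close> outside \<open>J\<close>, its witness.\<close>

locale core =
  fixes E :: "'a set set" and J :: "'a set" and T :: "('a \<times> 'a \<times> 'a) set"
  assumes finE: "finite E" and card2: "\<And>e. e \<in> E \<Longrightarrow> card e = 2"
    and J_sub: "J \<subseteq> \<Union>E"
    and J_edge: "\<And>u v. {u, v} \<in> E \<Longrightarrow> u \<in> J \<Longrightarrow> v \<in> J \<Longrightarrow> \<exists>x. (u, v, x) \<in> T \<or> (v, u, x) \<in> T"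
    and T_triangle: "\<And>w p x. (w, p, x) \<in> T \<Longrightarrow>
      w \<in> J \<and> p \<in> J \<and> x \<notin> J \<and> {w, p} \<in> E \<and> {w, x} \<in> E \<and> {p, x} \<in> E"
    and T_matching: "\<And>w p x w' p' x'. (w, p, x) \<in> T \<Longrightarrow> (w', p', x') \<in> T \<Longrightarrow>
      {w, p} \<inter> {w', p'} \<noteq> {} \<Longrightarrow> (w, p, x) = (w', p', x')"
    and private_unique: "\<And>w x y. x \<notin> J \<Longrightarrow> y \<notin> J \<Longrightarrow> {l\<in>J. {l, x} \<in> E} = {w} \<Longrightarrow>
      {l\<in>J. {l, y} \<in> E} = {w} \<Longrightarrow> x = y"
    and T_private: "\<And>w p x y. (w, p, x) \<in> T \<Longrightarrow> y \<notin> J \<Longrightarrow>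
      {l\<in>J. {l, y} \<in> E} \<noteq> {w} \<and> {l\<in>J. {l, y} \<in> E} \<noteq> {p}"
    and connected: "spans_pairs {e\<in>E. e \<inter> J \<noteq> {}} (J \<union> {x. x \<notin> J \<and> {l\<in>J. {l, x} \<in> E} \<noteq> {}})"
    and two_labels: "\<exists>a\<in>J. \<exists>b\<in>J. a \<noteq> b"
    and isolated_edge: "\<And>e x. e \<in> E \<Longrightarrow> e \<inter> J = {} \<Longrightarrow>
      (\<And>e'. e' \<in> E \<Longrightarrow> e' \<inter> J = {} \<Longrightarrow> e' \<inter> e \<noteq> {} \<Longrightarrow> e' = e) \<Longrightarrow> x \<in> e \<Longrightarrow> {l\<in>J. {l, x} \<in> E} \<noteq> {}"
begin

definition N :: "'a \<Rightarrow> 'a set" where "N x = {l\<in>J. {l, x} \<in> E}"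
definition X :: "'a set" where "X = {x. x \<notin> J \<and> N x \<noteq> {}}"
definition U :: "'a set" where "U = J \<union> X"
definition EJ :: "'a set set" where "EJ = {e\<in>E. e \<inter> J \<noteq> {}}"
text \<open>The isolated edges of what remains after deleting \<open>EJ\<close>. The induction
  hypothesis does not admit them, so they join the present block.\<close>

definition E0 :: "'a set set" where
  "E0 = {e\<in>E. e \<inter> J = {} \<and> (\<forall>e'\<in>E. e' \<inter> J = {} \<longrightarrow> e' \<inter> e \<noteq> {} \<longrightarrow> e' = e)}"
text \<open>The triangle edge \<open>{l, x}\<close> could be charged twice for its token, twice for
  \<open>D\<close> and once for the triangle form, five times in all. Moving the token away prevents
  this. With just two labels at \<open>x\<close> the move would leave a lone token, and
  \<open>light_witness_arm\<close> is used instead.\<close>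

definition heavy :: "'a \<Rightarrow> 'a \<Rightarrow> bool" where
  "heavy l x \<longleftrightarrow> (\<exists>p. (l, p, x) \<in> T) \<and> 3 \<le> card (N x)"
text \<open>Every edge from a label \<open>l\<close> to a vertex \<open>x\<close> outside \<open>J\<close> yields one token \<open>l\<close>. It is placed at \<open>x\<close>,
except that it moves to \<open>l\<close> itself if \<open>l\<close> is the only label at \<open>x\<close> or \<open>heavy l x\<close> holds.\<close>

definition Mv :: "'a \<Rightarrow> 'a set" where
  "Mv v = (if v \<in> J then (if (\<exists>y. y \<notin> J \<and> N y = {v}) \<or> (\<exists>x. heavy v x) then {v} else {})
     else if 2 \<le> card (N v) then N v - {l. heavy l v} else {})"
text \<open>The join must never use the triangle edge \<open>{p, x}\<close>, which may carry a token
  and is charged by the triangle form as well.\<close>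

definition F0 :: "'a set set" where "F0 = EJ - {{p, x} | p x. \<exists>w. (w, p, x) \<in> T}"
text \<open>The isolated edges offered to the join, and those for which \<open>free\<close> has to
  keep an arm out of \<open>D\<close>. Any other isolated edge has an endpoint with fewer than two
  labels, whose arm carries no token, or a witness as endpoint, whose triangle edge can
  serve.\<close>

definition Ex :: "'a set set" where
  "Ex = {e\<in>E0. \<forall>x\<in>e. 2 \<le> card (N x) \<and> (\<forall>w p. (w, p, x) \<notin> T)}"
definition free :: "'a set set \<Rightarrow> bool" where
  "free D \<longleftrightarrow> (\<forall>e\<in>Ex. \<exists>x\<in>e. \<exists>c\<in>N x. {c, x} \<notin> D)"

lemma edge_neq: "{u, v} \<in> E \<Longrightarrow> u \<noteq> v"
  using card2[of "{u, v}"] by auto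

lemma finite_V: "finite (\<Union>E)"
proof (rule finite_Union[OF finE])
  fix e assume "e \<in> E"
  then have "card e = 2" by (rule card2)
  then show "finite e" by (simp add: card_ge_0_finite)
qed

lemma finite_J: "finite J" using J_sub finite_V finite_subset by blast
lemma finite_N: "finite (N x)" using finite_J by (simp add: N_def)
lemma X_sub: "X \<subseteq> \<Union>E" by (auto simp: X_def N_def)
lemma finite_X: "finite X" using X_sub finite_V finite_subset by blast
lemma finite_U: "finite U" using finite_J finite_X by (simp add: U_def)
lemma finite_EJ: "finite EJ" "finite E0" using finE by (auto simp: EJ_def E0_def)
lemma EJ_E0_disjoint: "EJ \<inter> E0 = {}" by (auto simp: EJ_def E0_def)

lemma in_N: "l \<in> N x \<longleftrightarrow> l \<in> J \<and> {l, x} \<in> E" by (simp add: N_def)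

lemma arm_in_EJ: "l \<in> N x \<Longrightarrow> {l, x} \<in> EJ" by (auto simp: N_def EJ_def)

lemma T_facts:
  assumes "(w, p, x) \<in> T"
  shows "w \<in> N x" "p \<in> N x" "w \<noteq> p" "x \<in> X" "x \<notin> J" "2 \<le> card (N x)" "{w, p} \<in> EJ" "w \<in> J" "p \<in> J"
proof -
  note t = T_triangle[OF assms]
  show 1: "w \<in> N x" "p \<in> N x" "w \<noteq> p" "x \<in> X" "x \<notin> J" "{w, p} \<in> EJ" "w \<in> J" "p \<in> J"
    using t edge_neq[of w p] by (auto simp: N_def X_def EJ_def)
  have "card {w, p} \<le> card (N x)" using 1 finite_N by (intro card_mono) auto
  then show "2 \<le> card (N x)" using 1 by simp
qed

lemma heavy_facts: "heavy l x \<Longrightarrow> l \<in> N x \<and> x \<notin> J"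
  using T_facts(1,5) unfolding heavy_def by blast

lemma EJ_cases:
  assumes "e \<in> EJ"
  obtains (arm) l x where "x \<in> X" "l \<in> N x" "e = {l, x}"
    | (mat) w p x where "(w, p, x) \<in> T" "e = {w, p}"
proof -
  have e: "e \<in> E" "card e = 2" using assms card2 by (auto simp: EJ_def)
  obtain l where l: "l \<in> e" "l \<in> J" using assms by (auto simp: EJ_def)
  then obtain v where v: "e = {l, v}" using e(2) by (auto simp: card_2_iff)
  show thesis
  proof (cases "v \<in> J")
    case True
    then obtain x where "(l, v, x) \<in> T \<or> (v, l, x) \<in> T" using J_edge[of l v] e l v by auto
    then show thesis using mat v by (metis insert_commute)
  next
    case False
    then show thesis using arm[of v l] e l v by (auto simp: X_def N_def)
  qed
qed

lemma E0_facts: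
  assumes "e \<in> E0"
  shows "e \<in> E" "e \<inter> J = {}" "e \<subseteq> X" "card e = 2"
proof -
  show e: "e \<in> E" "e \<inter> J = {}" using assms by (auto simp: E0_def)
  then show "card e = 2" using card2 by simp
  show "e \<subseteq> X"
  proof
    fix x assume x: "x \<in> e"
    have "{l\<in>J. {l, x} \<in> E} \<noteq> {}"
      by (rule isolated_edge[OF e _ x]) (use assms in \<open>auto simp: E0_def\<close>)
    then show "x \<in> X" using x e by (auto simp: X_def N_def)
  qed
qed

lemma E0_disjoint: "e \<in> E0 \<Longrightarrow> e' \<in> E0 \<Longrightarrow> x \<in> e \<Longrightarrow> x \<in> e' \<Longrightarrow> e = e'"
  by (auto simp: E0_def)

lemma Mv_J: "v \<in> J \<Longrightarrow> Mv v \<subseteq> {v}" by (simp add: Mv_def)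
lemma Mv_X: "v \<notin> J \<Longrightarrow> Mv v \<subseteq> N v" by (auto simp: Mv_def)
lemma finite_Mv: "finite (Mv v)" using finite_N[of v] by (auto simp: Mv_def)

text \<open>The map \<open>\<phi>\<close> sends an outside neighbour of \<open>l\<close> to the
  place of its token. At most one token moves to \<open>l\<close>: a private neighbour is unique by
  \<open>private_unique\<close>, a heavy witness by \<open>T_matching\<close>, and
  \<open>T_private\<close> excludes having both.\<close>

lemma token_count:
  assumes l: "l \<in> J"
  shows "card {v\<in>U. l \<in> Mv v} = card {x\<in>X. l \<in> N x}"
proof -
  define \<phi> where "\<phi> x = (if N x = {l} \<or> heavy l x then l else x)" for x
  have special: "x = y" if "x \<in> X" "y \<in> X" "N x = {l} \<or> heavy l x" "N y = {l} \<or> heavy l y" for x y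
  proof -
    note s = that
    have J: "x \<notin> J" "y \<notin> J" using that by (auto simp: X_def)
    have no: False if "N x = {l}" "heavy l y" "x \<notin> J" for x y
      using that T_private[of l _ y x] by (auto simp: heavy_def N_def)
    consider "N x = {l}" "N y = {l}" | "heavy l x" "heavy l y"
      using s no[of x y] no[of y x] J by blast
    then show ?thesis
    proof cases
      case 1
      then show ?thesis using private_unique[OF J] by (simp add: N_def)
    next
      case 2
      then obtain p p' where "(l, p, x) \<in> T" "(l, p', y) \<in> T" by (auto simp: heavy_def)
      then show ?thesis using T_matching[of l p x l p' y] by auto
    qed
  qed
  have "bij_betw \<phi> {x\<in>X. l \<in> N x} {v\<in>U. l \<in> Mv v}"
    unfolding bij_betw_def
  proof
    show "inj_on \<phi> {x\<in>X. l \<in> N x}"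
    proof (rule inj_onI)
      fix x y assume x: "x \<in> {x\<in>X. l \<in> N x}" and y: "y \<in> {x\<in>X. l \<in> N x}" and eq: "\<phi> x = \<phi> y"
      have "x \<noteq> l" "y \<noteq> l" using x y l by (auto simp: X_def)
      then consider "N x = {l} \<or> heavy l x" "N y = {l} \<or> heavy l y" | "x = y"
        using eq unfolding \<phi>_def by metis
      then show "x = y" using special x y by cases auto
    qed
    show "\<phi> ` {x\<in>X. l \<in> N x} = {v\<in>U. l \<in> Mv v}"
    proof (intro set_eqI iffI)
      fix v assume "v \<in> \<phi> ` {x\<in>X. l \<in> N x}"
      then obtain x where x: "x \<in> X" "l \<in> N x" "v = \<phi> x" by auto
      show "v \<in> {v\<in>U. l \<in> Mv v}"
      proof (cases "N x = {l} \<or> heavy l x")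
        case True
        then have "v = l" using x by (simp add: \<phi>_def)
        moreover have "l \<in> Mv l" using True l x by (auto simp: Mv_def X_def)
        ultimately show ?thesis using l by (simp add: U_def)
      next
        case False
        then have v: "v = x" using x by (simp add: \<phi>_def)
        have "2 \<le> card (N x)"
        proof -
          obtain l' where "l' \<in> N x" "l' \<noteq> l" using False x by auto
          then have "card {l, l'} \<le> card (N x)" using x finite_N by (intro card_mono) auto
          then show ?thesis using \<open>l' \<noteq> l\<close> by simp
        qed
        then show ?thesis using False x v by (auto simp: Mv_def X_def U_def)
      qed
    next
      fix v assume "v \<in> {v\<in>U. l \<in> Mv v}"
      then have v: "v \<in> U" "l \<in> Mv v" by auto
      show "v \<in> \<phi> ` {x\<in>X. l \<in> N x}"
      proof (cases "v \<in> J")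
        case True
        then have "v = l" using Mv_J[of v] v by auto
        then have "(\<exists>y. y \<notin> J \<and> N y = {l}) \<or> (\<exists>x. heavy l x)" using v True by (auto simp: Mv_def split: if_splits)
        then obtain x where x: "x \<notin> J" "N x = {l} \<or> heavy l x" "l \<in> N x"
          using heavy_facts by blast
        then have "x \<in> X" by (auto simp: X_def)
        moreover have "\<phi> x = v" using x \<open>v = l\<close> by (simp add: \<phi>_def)
        ultimately show ?thesis using x by blast
      next
        case False
        then have "l \<in> N v" "\<not> heavy l v" "2 \<le> card (N v)" using v by (auto simp: Mv_def split: if_splits)
        then have "\<phi> v = v" by (auto simp: \<phi>_def)
        moreover have "v \<in> X" using False v by (auto simp: U_def)
        ultimately show ?thesis using \<open>l \<in> N v\<close> by force
      qed
    qed
  qed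
  from bij_betw_same_card[OF this] show ?thesis by simp
qed

text \<open>This allows the two ends of a connector to receive different labels. A heavy label that
  moves leaves its partner behind, and the second token is a third label at \<open>v\<close> or, if
  that one is heavy too, its partner.\<close>

lemma Mv_two:
  assumes "v \<notin> J" "Mv v \<noteq> {}"
  shows "\<exists>a\<in>Mv v. \<exists>b\<in>Mv v. a \<noteq> b"
proof -
  have M: "Mv v = N v - {l. heavy l v}" and k: "2 \<le> card (N v)"
    using assms by (auto simp: Mv_def split: if_splits)
  show ?thesis
  proof (cases "\<exists>l. heavy l v")
    case False
    then have "Mv v = N v" using M by auto
    then obtain a b where "a \<in> Mv v" "b \<in> Mv v" "a \<noteq> b"
      using k card_le_Suc0_iff_eq[OF finite_N[of v]] by force
    then show ?thesis by blast
  next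
    case True
    then obtain l p where lp: "(l, p, v) \<in> T" "3 \<le> card (N v)" by (auto simp: heavy_def)
    have partner: "p' \<in> Mv v" if "(l', p', v) \<in> T" for l' p'
    proof -
      have "\<not> heavy p' v"
      proof
        assume "heavy p' v"
        then obtain p'' where "(p', p'', v) \<in> T" by (auto simp: heavy_def)
        then have "l' = p'" using T_matching[OF that, of p' p'' v] by auto
        then show False using T_facts(3)[OF that] by simp
      qed
      then show ?thesis using T_facts(2)[OF that] M by auto
    qed
    have "\<not> N v \<subseteq> {l, p}"
    proof
      assume "N v \<subseteq> {l, p}"
      then have "card (N v) \<le> card {l, p}" by (intro card_mono) auto
      moreover have "card {l, p} \<le> 2" by (simp add: card_insert_if)
      ultimately show False using lp by simp
    qed
    then obtain c where c: "c \<in> N v" "c \<noteq> l" "c \<noteq> p" by auto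
    show ?thesis
    proof (cases "heavy c v")
      case True
      then obtain p' where p': "(c, p', v) \<in> T" by (auto simp: heavy_def)
      have "p' \<noteq> p" using T_matching[OF p' lp(1)] c by auto
      then show ?thesis using partner[OF p'] partner[OF lp(1)] by blast
    next
      case False
      then have "c \<in> Mv v" using c M by auto
      then show ?thesis using partner[OF lp(1)] c by blast
    qed
  qed
qed

lemma EJ_edge_at:
  assumes "e \<in> EJ" "x \<in> e" "x \<notin> J"
  shows "\<exists>c\<in>N x. e = {c, x}"
  using assms(1)
proof (cases e rule: EJ_cases)
  case (arm l y)
  then show ?thesis using assms by (auto simp: N_def)
next
  case (mat w p y)
  then show ?thesis using assms T_facts(8,9)[OF mat(1)] by auto
qed

text \<open>Exchange along a cycle: an edge \<open>e\<close> of \<open>Y\<close> together with a set of boundary \<open>e\<close> lets \<open>e\<close> replace an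
edge from an endpoint of \<open>e\<close> to a label.\<close>

lemma exchange:
  assumes "Y \<subseteq> E0" "finite Y" "spans_pairs F0 U"
  shows "\<exists>F. F \<subseteq> F0 \<union> Y \<and> spans_pairs F U \<and> (\<forall>e\<in>Y. \<exists>x\<in>e. \<exists>c\<in>N x. {c, x} \<notin> F)"
  using assms(2,1)
proof (induction Y)
  case empty
  then show ?case using assms(3) by auto
next
  case (insert e Y)
  then obtain F where F: "F \<subseteq> F0 \<union> Y" "spans_pairs F U" "\<forall>e\<in>Y. \<exists>x\<in>e. \<exists>c\<in>N x. {c, x} \<notin> F" by auto
  have e: "e \<in> E0" "e \<notin> Y" using insert by auto
  obtain x x' where x: "e = {x, x'}" "x \<noteq> x'" using E0_facts(4)[OF e(1)] by (auto simp: card_2_iff)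
  have xX: "x \<in> X" "x' \<in> X" "x \<notin> J" using E0_facts(2,3)[OF e(1)] x by auto
  have "sym_diff {x} {x'} \<in> espan F" using F(2) xX by (auto simp: spans_pairs_def U_def)
  moreover have "sym_diff {x} {x'} = e" using x by auto
  ultimately obtain D where D: "finite D" "D \<subseteq> F" "bd D = e" by (auto simp: espan_def)
  obtain a where a: "a \<in> D" "x \<in> a" using bd_in_edge[of x D] D(3) x by auto
  \<comment> \<open>An edge of \<open>D\<close> at \<open>x\<close> must be an arm, because two
    edges of \<open>E0\<close> that share \<open>x\<close> coincide and \<open>e\<close> is not yet
    in \<open>Y\<close>.\<close>
  have "a \<notin> Y"
  proof
    assume "a \<in> Y"
    then have "a = e" using E0_disjoint[of a e x] insert.prems e a x by auto
    then show False using \<open>a \<in> Y\<close> e by simp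
  qed
  then have "a \<in> EJ" using a D F by (auto simp: F0_def)
  then obtain c where c: "c \<in> N x" "a = {c, x}" using EJ_edge_at a(2) xX by blast
  have eEJ: "e \<notin> EJ" using e EJ_E0_disjoint by auto
  then have eD: "e \<notin> D" using e D F by (auto simp: F0_def)
  have ae: "a \<noteq> e" using \<open>a \<in> EJ\<close> eEJ by auto
  define F' where "F' = insert e (F - {a})"
  \<comment> \<open>\<open>a\<close> is the sum of \<open>e\<close> and the rest of
    \<open>D\<close>, so replacing \<open>a\<close> by \<open>e\<close> loses nothing from the
    span.\<close>
  have "a \<in> espan F'"
  proof -
    define D' where "D' = insert e (D - {a})"
    have "v \<in> bd D' \<longleftrightarrow> v \<in> a" for v
      unfolding D'_def using bd_insert[of "D - {a}" e v] bd_remove[of D a v] D a eD by auto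
    then have "bd D' = a" by blast
    moreover have "finite D'" "D' \<subseteq> F'" using D by (auto simp: D'_def F'_def)
    ultimately show ?thesis by (auto simp: espan_def)
  qed
  then have "espan F \<subseteq> espan F'"
    by (intro espan_least) (metis DiffI F'_def espan_edge insertCI singletonD)
  then have "spans_pairs F' U" using F(2) unfolding spans_pairs_def by blast
  moreover have "F' \<subseteq> F0 \<union> insert e Y" using F by (auto simp: F'_def)
  moreover have "\<forall>e'\<in>insert e Y. \<exists>x\<in>e'. \<exists>c\<in>N x. {c, x} \<notin> F'"
  proof
    fix e' assume e': "e' \<in> insert e Y"
    show "\<exists>x\<in>e'. \<exists>c\<in>N x. {c, x} \<notin> F'"
    proof (cases "e' = e")
      case True
      then show ?thesis using c x ae by (auto simp: F'_def)
    next
      case False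
      then obtain y d where y: "y \<in> e'" "d \<in> N y" "{d, y} \<notin> F" using F(3) e' by blast
      have "{d, y} \<noteq> e" using arm_in_EJ[OF y(2)] eEJ by auto
      then show ?thesis using y by (auto simp: F'_def)
    qed
  qed
  ultimately show ?case by blast
qed

text \<open>A dropped edge \<open>{p, x}\<close> is the sum of the other two edges of its triangle,
  both of which stay in \<open>F0\<close>.\<close>

lemma spans_F0: "spans_pairs F0 U"
proof -
  have "e \<in> espan F0" if e: "e \<in> EJ" for e
  proof (cases "e \<in> F0")
    case False
    then obtain w p x where t: "(w, p, x) \<in> T" "e = {p, x}" using e by (auto simp: F0_def)
    note f = T_facts[OF t(1)]
    have "{w, p} \<noteq> {p', x'}" if "(w', p', x') \<in> T" for w' p' x' using f T_facts(5)[OF that] by auto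
    then have 1: "{w, p} \<in> F0" using f by (auto simp: F0_def)
    have "{w, x} \<noteq> {p', x'}" if t': "(w', p', x') \<in> T" for w' p' x'
    proof
      assume eq: "{w, x} = {p', x'}"
      then have "w = p'" using f T_facts(5)[OF t'] by (auto simp: doubleton_eq_iff)
      then have "w' = w" using T_matching[OF t' t(1)] by auto
      then show False using \<open>w = p'\<close> T_facts(3)[OF t'] by simp
    qed
    then have 2: "{w, x} \<in> F0" using f arm_in_EJ[of w x] by (auto simp: F0_def)
    have "sym_diff {w, p} {w, x} = e" using t f by auto
    then show ?thesis using espan_sym_diff[OF espan_edge[OF 1] espan_edge[OF 2]] by simp
  qed (rule espan_edge)
  then have "espan EJ \<subseteq> espan F0" by (rule espan_least)
  then show ?thesis using connected unfolding spans_pairs_def EJ_def[symmetric] N_def[symmetric] X_def[symmetric] U_def[symmetric]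
    by blast
qed

text \<open>The join is taken inside the spanning set prepared by \<open>exchange\<close>, and every
  subset of that set is free.\<close>

lemma free_join:
  assumes "S \<subseteq> U" "even (card S)"
  shows "\<exists>D\<subseteq>F0 \<union> Ex. bd D = S \<and> free D"
proof -
  have "Ex \<subseteq> E0" "finite Ex" using finite_EJ by (auto simp: Ex_def)
  from exchange[OF this spans_F0] obtain F where F: "F \<subseteq> F0 \<union> Ex" "spans_pairs F U" "\<forall>e\<in>Ex. \<exists>x\<in>e. \<exists>c\<in>N x. {c, x} \<notin> F"
    by blast
  have "finite S" using assms finite_U finite_subset by blast
  then have "S \<in> espan F" using spans_even[OF F(2)] assms by blast
  then obtain D where D: "D \<subseteq> F" "bd D = S" by (auto simp: espan_def)
  then have "free D" using F(3) unfolding free_def by blast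
  then show ?thesis using D F by blast
qed

text \<open>At a witness with two labels, \<open>{p, x}\<close> is barred by \<open>F0\<close> and
  edges of \<open>Ex\<close> avoid witnesses. So \<open>{w, x}\<close> would be the only edge of
  \<open>D\<close> at \<open>x\<close>, making \<open>x\<close> odd.\<close>

lemma light_witness_arm:
  assumes "D \<subseteq> F0 \<union> Ex" "(w, p, x) \<in> T" "card (N x) = 2" "x \<notin> bd D"
  shows "{w, x} \<notin> D"
proof
  assume wx: "{w, x} \<in> D"
  note f = T_facts[OF assms(2)]
  have N: "N x = {w, p}"
    using f assms(3) finite_N[of x] by (intro card_seteq[symmetric]) auto
  have "{e\<in>D. x \<in> e} = {{w, x}}"
  proof (intro set_eqI iffI)
    fix e assume "e \<in> {e\<in>D. x \<in> e}"
    then have e: "e \<in> D" "x \<in> e" by auto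
    show "e \<in> {{w, x}}"
    proof (cases "e \<in> Ex")
      case True
      then show ?thesis using assms(2) e by (auto simp: Ex_def)
    next
      case False
      then have F: "e \<in> F0" using e assms by auto
      then obtain c where c: "c \<in> N x" "e = {c, x}" using EJ_edge_at[of e x] e f by (auto simp: F0_def)
      have "c \<noteq> p" using F c assms(2) by (auto simp: F0_def)
      then show ?thesis using c N by auto
    qed
  qed (use wx in auto)
  then have "x \<in> bd D" by (simp add: bd_def)
  with assms(4) show False by simp
qed

definition TE :: "'a set set" where
  "TE = {e. \<exists>w p x. (w, p, x) \<in> T \<and> (e = {w, p} \<or> e = {w, x} \<or> e = {p, x})}"
definition own :: "'a set \<Rightarrow> bool" where
  "own e \<longleftrightarrow> (\<exists>v\<in>U - J. \<exists>l\<in>Mv v. e = {l, v})"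

lemma own_iff: "l \<in> J \<Longrightarrow> x \<notin> J \<Longrightarrow> own {l, x} \<longleftrightarrow> x \<in> U \<and> l \<in> Mv x"
  using Mv_X by (auto simp: own_def doubleton_eq_iff in_N)

lemma choose_arms:
  assumes "free D"
  shows "\<exists>arm. \<forall>e\<in>E0. \<exists>x\<in>e. \<exists>c\<in>N x. arm e = {c, x} \<and> (own (arm e) \<and> arm e \<in> D \<longrightarrow> arm e \<in> TE)"
proof -
  have "\<exists>a. \<exists>x\<in>e. \<exists>c\<in>N x. a = {c, x} \<and> (own a \<and> a \<in> D \<longrightarrow> a \<in> TE)" if e: "e \<in> E0" for e
  proof (cases "e \<in> Ex")
    case True
    then show ?thesis using assms unfolding free_def by blast
  next
    case False
    then obtain x where x: "x \<in> e" "\<not> 2 \<le> card (N x) \<or> (\<exists>w p. (w, p, x) \<in> T)" using e by (auto simp: Ex_def)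
    have xX: "x \<in> X" "x \<notin> J" using E0_facts[OF e] x by auto
    then obtain c where c: "c \<in> N x" by (auto simp: X_def)
    from x(2) show ?thesis
    proof
      assume "\<not> 2 \<le> card (N x)"
      then have "Mv x = {}" using xX by (simp add: Mv_def)
      then have "\<not> own {c, x}" using own_iff[of c x] c xX by (auto simp: in_N)
      then show ?thesis using x c by blast
    next
      assume "\<exists>w p. (w, p, x) \<in> T"
      then obtain w p where t: "(w, p, x) \<in> T" by auto
      then have "{p, x} \<in> TE" by (auto simp: TE_def)
      then show ?thesis using x T_facts(2)[OF t] by blast
    qed
  qed
  then show ?thesis by metis
qed

text \<open>Squared forms count twice, so \<open>own\<close> and \<open>D\<close> together exhaust
  the four uses; if at most one of them occurs, a triangle form and the arm of an isolated edge
  still fit. The critical triangle edge is \<open>{w, x}\<close>: either \<open>w\<close> is heavy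
  there and its token has moved, or \<open>x\<close> has two labels and \<open>light\<close>
  applies.\<close>

lemma load_bound:
  assumes D: "D \<subseteq> F0 \<union> Ex"
    and light: "\<And>w p x. (w, p, x) \<in> T \<Longrightarrow> card (N x) = 2 \<Longrightarrow> {w, x} \<notin> D"
    and arm: "\<And>e. e \<in> E0 \<Longrightarrow> \<exists>x\<in>e. \<exists>c\<in>N x. arm e = {c, x} \<and> (own (arm e) \<and> arm e \<in> D \<longrightarrow> arm e \<in> TE)"
  shows "2 * (of_bool (own e) + of_bool (e \<in> D)) + of_bool (e \<in> TE) + of_bool (e \<in> arm ` E0) \<le> (4 :: nat)"
proof (cases "e \<in> TE")
  case True
  then obtain w p x where t: "(w, p, x) \<in> T" "e = {w, p} \<or> e = {w, x} \<or> e = {p, x}" by (auto simp: TE_def)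
  note f = T_facts[OF t(1)]
  have "\<not> (own e \<and> e \<in> D)"
  proof
    assume *: "own e \<and> e \<in> D"
    have "e \<notin> Ex"
      using t(2) f(8,9) E0_facts(2)[of e] by (auto simp: Ex_def)
    then have "e \<in> F0" using * D by auto
    then have "e \<noteq> {p, x}" using t(1) by (auto simp: F0_def)
    moreover have "e \<noteq> {w, p}" using * f(8,9) by (auto simp: own_def doubleton_eq_iff)
    ultimately have e: "e = {w, x}" using t(2) by simp
    then have "w \<in> Mv x" using * own_iff[of w x] f by auto
    then have "\<not> heavy w x" using f by (auto simp: Mv_def split: if_splits)
    then have "card (N x) = 2" using f(6) t(1) by (auto simp: heavy_def)
    then show False using light[OF t(1)] * e by simp
  qed
  then show ?thesis by (auto simp: of_bool_def)
next
  case False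
  show ?thesis
  proof (cases "e \<in> arm ` E0")
    case True
    then have "\<not> (own e \<and> e \<in> D)" using arm False by blast
    then show ?thesis using False by (auto simp: of_bool_def)
  qed (use False in \<open>auto simp: of_bool_def\<close>)
qed

end


section \<open>The block of edges at the labels\<close>

lemma perl_scale_rows: "perl (\<lambda>r s. g s * B r s) ss \<Phi> = (\<Prod>s\<leftarrow>ss. g s) * perl B ss \<Phi>"
  by (induction ss arbitrary: \<Phi>) (simp_all add: sum_distrib_left mult_ac)

lemma rowdiff_doubleton:
  assumes "u \<noteq> v"
  shows "rowdiff {u, v} = (\<lambda>f. f u - f v) \<or> rowdiff {u, v} = (\<lambda>f. f v - f u)"
proof -
  have "{u, v} = {hdv {u, v}, tlv {u, v}}" using hdv_tlv(2)[of "{u, v}"] assms by simp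
  then have "hdv {u, v} = u \<and> tlv {u, v} = v \<or> hdv {u, v} = v \<and> tlv {u, v} = u"
    unfolding doubleton_eq_iff by auto
  then show ?thesis by (auto simp: rowdiff_def fun_eq_iff)
qed

context core
begin

text \<open>The solution of three linear equations on the triangle: vertex sums
  \<open>n w + 1\<close> at \<open>w\<close>, \<open>- (n p + 1)\<close> at \<open>p\<close> and 0
  at \<open>x\<close>.\<close>

definition gcoef :: "('a \<Rightarrow> nat) \<Rightarrow> 'a \<times> 'a \<times> 'a \<Rightarrow> 'a set \<Rightarrow> real" where
  "gcoef n t e = (case t of (w, p, x) \<Rightarrow>
     (real (Suc (n w)) - real (Suc (n p))) / 2 * of_bool (e = {w, p})
     + (real (Suc (n w)) + real (Suc (n p))) / 2 * of_bool (e = {w, x})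
     - (real (Suc (n w)) + real (Suc (n p))) / 2 * of_bool (e = {p, x}))"

lemma sum_gcoef:
  assumes "(w, p, x) \<in> T"
  shows "(\<Sum>e\<in>EJ \<union> E0. gcoef n (w, p, x) e * ind e v) = gform n (w, p) v"
proof -
  note f = T_facts[OF assms]
  define a b where "a = real (Suc (n w))" and "b = real (Suc (n p))"
  have fin: "finite (EJ \<union> E0)" using finite_EJ by simp
  have s: "(\<Sum>e\<in>EJ \<union> E0. of_bool (e = {c, d}) * ind e v) = (of_bool (v = c) + of_bool (v = d) :: real)"
    if "{c, d} \<in> EJ" for c d
    using sum_arm[OF fin, of c d v] that edge_neq[of c d] by (auto simp: EJ_def)
  have "(\<Sum>e\<in>EJ \<union> E0. gcoef n (w, p, x) e * ind e v)
    = (a - b) / 2 * (\<Sum>e\<in>EJ \<union> E0. of_bool (e = {w, p}) * ind e v)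
    + (a + b) / 2 * (\<Sum>e\<in>EJ \<union> E0. of_bool (e = {w, x}) * ind e v)
    - (a + b) / 2 * (\<Sum>e\<in>EJ \<union> E0. of_bool (e = {p, x}) * ind e v)"
    unfolding gcoef_def a_def[symmetric] b_def[symmetric] sum_distrib_left sum_subtractf[symmetric] sum.distrib[symmetric]
    by (rule sum.cong) (simp_all add: a_def b_def left_diff_distrib distrib_right mult.assoc)
  also have "\<dots> = a * of_bool (v = w) - b * of_bool (v = p)"
    unfolding s[OF f(7)] s[OF arm_in_EJ[OF f(1)]] s[OF arm_in_EJ[OF f(2)]]
    by (simp add: field_simps)
  finally show ?thesis by (simp add: gform_def a_def b_def)
qed

lemma rowdiff_vanish:
  assumes "\<And>v. v \<notin> J \<Longrightarrow> f v = 0" "s \<in> E" "s \<inter> J = {}"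
  shows "rowdiff s f = 0"
proof -
  have "s = {hdv s, tlv s}" using hdv_tlv(2)[OF card2[OF assms(2)]] .
  then have "hdv s \<notin> J" "tlv s \<notin> J" using assms(3) by blast+
  then show ?thesis using assms(1) by (simp add: rowdiff_def)
qed

text \<open>Label forms vanish on edges away from \<open>J\<close>, and among those edges the arm of
  an isolated edge touches only that edge. So the matrix is block triangular: the rows
  \<open>E0\<close> give a diagonal block, the rows at \<open>J\<close> are handled by
  \<open>perl_positive\<close>, and \<open>good_union\<close> adds the rest.\<close>

theorem block_good:
  assumes forms: "\<And>q. q \<in> set (TS @ sg) \<Longrightarrow>
      realizes (EJ \<union> E0) q \<and> set (ends (fst q)) \<subseteq> J \<and> distinct (ends (fst q))"
    and sg: "length sg \<le> 1"
    and cnt: "\<And>l. l \<in> J \<Longrightarrow>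
      count (mset (labels TS @ map (\<lambda>q. fst (fst q)) sg)) l = card {x\<in>X. l \<in> N x}"
    and arm: "\<And>e. e \<in> E0 \<Longrightarrow> \<exists>x\<in>e. \<exists>c\<in>N x. arm e = {c, x}"
    and load: "\<And>e. 2 * usage TS e + usage sg e
      + of_bool (e \<in> TE) + of_bool (e \<in> arm ` E0) \<le> (4 :: nat)"
    and rest: "good (E - (EJ \<union> E0))"
  shows "good E"
proof -
  have finT: "finite T"
  proof -
    have "T \<subseteq> J \<times> J \<times> X" using T_facts by auto
    then show ?thesis using finite_J finite_X finite_subset by blast
  qed
  obtain tl where tl: "distinct tl" "set tl = T" using finite_distinct_list[OF finT] by blast
  define ms where "ms = map (\<lambda>(w, p, x). (w, p)) tl"
  define Arms where "Arms = {e\<in>EJ. card (e \<inter> J) = 1}"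
  obtain ssA where ssA: "distinct ssA" "set ssA = Arms"
    using finite_distinct_list[of Arms] finite_EJ by (auto simp: Arms_def)
  obtain ss0 where ss0: "distinct ss0" "set ss0 = E0" using finite_distinct_list[of E0] finite_EJ by auto
  define lab where "lab e = (THE l. l \<in> e \<inter> J)" for e
  have lab: "lab {l, x} = l" if "l \<in> J" "x \<notin> J" for l x
    unfolding lab_def by (rule the_equality) (use that in auto)
  define ls where "ls = map lab ssA"
  define n where "n = count (mset ls)"
  have Arms_cases: "\<exists>l x. x \<in> X \<and> l \<in> N x \<and> e = {l, x}" if e: "e \<in> Arms" for e
  proof -
    have "e \<in> EJ" "card (e \<inter> J) = 1" using e by (auto simp: Arms_def)
    then show ?thesis
    proof (cases rule: EJ_cases)
      case (mat w p x)
      then have "e \<inter> J = {w, p}" using T_facts(8,9)[OF mat(1)] by auto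
      then show ?thesis using \<open>card (e \<inter> J) = 1\<close> T_facts(3)[OF mat(1)] by simp
    qed blast
  qed
  have arm_Arms: "{l, x} \<in> Arms" if "x \<in> X" "l \<in> N x" for l x
  proof -
    have "{l, x} \<inter> J = {l}" using that by (auto simp: X_def in_N)
    then show ?thesis using arm_in_EJ[OF that(2)] by (simp add: Arms_def)
  qed
  have n_eq: "n l = card {x\<in>X. l \<in> N x}" if "l \<in> J" for l
  proof -
    have "n l = card {e\<in>Arms. lab e = l}"
      unfolding n_def ls_def using count_map_distinct[OF ssA(1), of lab l] ssA(2) by simp
    also have "{e\<in>Arms. lab e = l} = (\<lambda>x. {l, x}) ` {x\<in>X. l \<in> N x}"
    proof (intro set_eqI iffI)
      fix e assume "e \<in> {e\<in>Arms. lab e = l}"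
      then obtain l' x where x: "x \<in> X" "l' \<in> N x" "e = {l', x}" "lab e = l" using Arms_cases by blast
      then have "l' = l" using lab[of l' x] by (auto simp: X_def in_N)
      then show "e \<in> (\<lambda>x. {l, x}) ` {x\<in>X. l \<in> N x}" using x by blast
    next
      fix e assume "e \<in> (\<lambda>x. {l, x}) ` {x\<in>X. l \<in> N x}"
      then show "e \<in> {e\<in>Arms. lab e = l}" using arm_Arms lab by (auto simp: X_def in_N)
    qed
    also have "card \<dots> = card {x\<in>X. l \<in> N x}"
      using that by (intro card_image) (auto simp: inj_on_def doubleton_eq_iff X_def)
    finally show ?thesis .
  qed
  have TJ: "fst (fst q) \<in> J" "fst (snd (fst q)) \<in> J" "fst (fst q) \<noteq> fst (snd (fst q))"
    "snd (snd (fst q)) = 1 \<or> snd (snd (fst q)) = -1"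
    "\<And>v. (\<Sum>e\<in>EJ \<union> E0. snd q e * ind e v) = tform (fst q) v" if "q \<in> set (TS @ sg)" for q
    using forms[OF that] by (auto simp: realizes_def)
  have lsJ: "set ls \<subseteq> J"
    unfolding ls_def set_map ssA(2) using Arms_cases lab by (fastforce simp: X_def in_N)
  have mls: "mset ls = mset (concat (map (\<lambda>(a, b, \<sigma>). [a, b]) (map fst TS)) @ map fst (map fst sg))"
  proof (rule multiset_eqI)
    fix l
    have eq: "concat (map (\<lambda>(a, b, \<sigma>). [a, b]) (map fst TS)) @ map fst (map fst sg)
      = labels TS @ map (\<lambda>q. fst (fst q)) sg"
      by (simp add: comp_def case_prod_unfold)
    show "count (mset ls) l = count (mset (concat (map (\<lambda>(a, b, \<sigma>). [a, b]) (map fst TS)) @ map fst (map fst sg))) l"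
    proof (cases "l \<in> J")
      case True
      then show ?thesis unfolding eq cnt[OF True] using n_eq[OF True] by (simp add: n_def)
    next
      case False
      have "l \<notin> set ls" using False lsJ by auto
      moreover have "l \<notin> set (labels TS @ map (\<lambda>q. fst (fst q)) sg)"
      proof
        assume "l \<in> set (labels TS @ map (\<lambda>q. fst (fst q)) sg)"
        then obtain q where "q \<in> set (TS @ sg)" "l = fst (fst q) \<or> l = fst (snd (fst q))" by auto
        then show False using TJ(1,2)[of q] False by auto
      qed
      ultimately have "count (mset ls) l = 0"
        "count (mset (labels TS @ map (\<lambda>q. fst (fst q)) sg)) l = 0"
        unfolding count_mset_0_iff by blast+
      then show ?thesis unfolding eq by metis
    qed
  qed
  \<comment> \<open>Every form is stored with its edge coefficients; those from \<open>TS\<close>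
    occur twice to make squares.\<close>
  define PL where "PL = concat (map (\<lambda>q. [(tform (fst q), snd q), (tform (fst q), snd q)]) TS)
      @ map (\<lambda>q. (tform (fst q), snd q)) sg @ map (\<lambda>t. (gform n (fst t, fst (snd t)), gcoef n t)) tl"
  define fl where "fl = map fst PL"
  have fl: "fl = concat (map (\<lambda>t. [tform t, tform t]) (map fst TS)) @ map tform (map fst sg) @ map (gform (count (mset ls))) ms"
    unfolding fl_def PL_def ms_def n_def by (simp add: map_concat comp_def case_prod_unfold)
  have PLset: "(\<exists>q\<in>set (TS @ sg). y = (tform (fst q), snd q)) \<or>
      (\<exists>t\<in>T. y = (gform n (fst t, fst (snd t)), gcoef n t))" if "y \<in> set PL" for y
    using that unfolding PL_def using tl(2) by auto
  have PLsum: "fst y = (\<lambda>v. \<Sum>e\<in>EJ \<union> E0. snd y e * ind e v)" and PLJ: "\<And>v. v \<notin> J \<Longrightarrow> fst y v = 0"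
    if "y \<in> set PL" for y
  proof -
    from PLset[OF that] consider q where "q \<in> set (TS @ sg)" "y = (tform (fst q), snd q)"
      | w p x where "(w, p, x) \<in> T" "y = (gform n (w, p), gcoef n (w, p, x))" by auto
    then have "fst y = (\<lambda>v. \<Sum>e\<in>EJ \<union> E0. snd y e * ind e v) \<and> (\<forall>v. v \<notin> J \<longrightarrow> fst y v = 0)"
    proof cases
      case 1
      obtain a b \<sigma> where q: "fst q = (a, b, \<sigma>)" by (metis prod.collapse)
      then show ?thesis using TJ[OF 1(1)] 1(2) by (auto simp: tform_def)
    next
      case 2
      then show ?thesis using sum_gcoef[OF 2(1), of n] T_facts(8,9)[OF 2(1)] by (auto simp: gform_def)
    qed
    then show "fst y = (\<lambda>v. \<Sum>e\<in>EJ \<union> E0. snd y e * ind e v)" "\<And>v. v \<notin> J \<Longrightarrow> fst y v = 0" by auto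
  qed
  define ssM where "ssM = map (\<lambda>(w, p, x). {w, p}) tl"
  have Tinj: "t = t'" if "t \<in> T" "t' \<in> T" "{fst t, fst (snd t)} \<inter> {fst t', fst (snd t')} \<noteq> {}" for t t'
    using that T_matching[of "fst t" "fst (snd t)" "snd (snd t)" "fst t'" "fst (snd t')" "snd (snd t')"]
    by (simp add: prod_eq_iff)
  have ssM: "distinct ssM" "set ssM = EJ - Arms"
  proof -
    have "inj_on (\<lambda>(w, p, x). {w, p}) (set tl)"
      unfolding tl(2) by (rule inj_onI, rule Tinj) (auto simp: case_prod_unfold)
    then show "distinct ssM" unfolding ssM_def using tl(1) by (simp add: distinct_map)
    show "set ssM = EJ - Arms"
    proof (intro set_eqI iffI)
      fix e assume "e \<in> set ssM"
      then obtain w p x where t: "(w, p, x) \<in> T" "e = {w, p}" by (auto simp: ssM_def tl(2))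
      then have "e \<inter> J = {w, p}" using T_facts(8,9)[OF t(1)] by auto
      then show "e \<in> EJ - Arms" using T_facts(3,7)[OF t(1)] t(2) by (simp add: Arms_def)
    next
      fix e assume e: "e \<in> EJ - Arms"
      then have "e \<in> EJ" by simp
      then show "e \<in> set ssM"
      proof (cases rule: EJ_cases)
        case (arm l x)
        then show ?thesis using arm_Arms e by auto
      next
        case (mat w p x)
        then show ?thesis by (force simp: ssM_def tl(2))
      qed
    qed
  qed
  \<comment> \<open>Translates an edge at \<open>J\<close> into an index for \<open>rowval\<close>.
    The choice operator recovers the order of a matched pair, which \<open>T_matching\<close> makes
    unique.\<close>
  define \<rho> where "\<rho> s = (if s \<in> Arms then Inl (lab s) else
      Inr (SOME m. \<exists>x. (fst m, snd m, x) \<in> T \<and> s = {fst m, snd m}))" for s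
  have \<rho>A: "map \<rho> ssA = map Inl ls" unfolding ls_def using ssA(2) by (simp add: \<rho>_def)
  have \<rho>T: "\<rho> {w, p} = Inr (w, p)" if t: "(w, p, x) \<in> T" for w p x
  proof -
    have "{w, p} \<in> set ssM" using t by (force simp: ssM_def tl(2))
    then have "{w, p} \<notin> Arms" using ssM(2) by auto
    moreover have "(SOME m. \<exists>x. (fst m, snd m, x) \<in> T \<and> {w, p} = {fst m, snd m}) = (w, p)"
    proof (rule some_equality)
      show "\<exists>x. (fst (w, p), snd (w, p), x) \<in> T \<and> {w, p} = {fst (w, p), snd (w, p)}" using t by auto
      fix m assume "\<exists>x. (fst m, snd m, x) \<in> T \<and> {w, p} = {fst m, snd m}"
      then obtain y where "(fst m, snd m, y) \<in> T" "{w, p} = {fst m, snd m}" by auto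
      then show "m = (w, p)" using T_matching[OF t, of "fst m" "snd m" y] by (auto simp: prod_eq_iff)
    qed
    ultimately show ?thesis by (simp add: \<rho>_def)
  qed
  have \<rho>M: "map \<rho> ssM = map Inr ms"
    unfolding ssM_def ms_def using \<rho>T tl(2) by auto
  \<comment> \<open>The orientation in \<open>rowdiff\<close> is arbitrary, so the rows agree only
    up to a sign.\<close>
  have row: "\<exists>g. (g = 1 \<or> g = -1) \<and> (\<forall>f. (\<forall>v. v \<notin> J \<longrightarrow> f v = 0) \<longrightarrow> rowdiff s f = g * rowval f (\<rho> s))"
    if s: "s \<in> EJ" for s
    using s
  proof (cases rule: EJ_cases)
    case (arm l x)
    then have "\<rho> s = Inl l" using arm_Arms lab[of l x] by (simp add: \<rho>_def X_def in_N)
    moreover have "x \<notin> J" "l \<noteq> x" using arm by (auto simp: X_def in_N)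
    ultimately show ?thesis using rowdiff_doubleton[of l x] arm(3)
      by (auto intro: exI[of _ "1::real"] exI[of _ "-1::real"])
  next
    case (mat w p x)
    then show ?thesis using rowdiff_doubleton[of w p] T_facts(3)[OF mat(1)] \<rho>T[OF mat(1)]
      by (auto intro: exI[of _ "1::real"] exI[of _ "-1::real"])
  qed
  then have "\<forall>s\<in>EJ. \<exists>g. (g = 1 \<or> g = -1) \<and> (\<forall>f. (\<forall>v. v \<notin> J \<longrightarrow> f v = 0) \<longrightarrow> rowdiff s f = g * rowval f (\<rho> s))"
    by blast
  from bchoice[OF this] obtain g where g: "\<And>s. s \<in> EJ \<Longrightarrow> g s = 1 \<or> g s = (-1 :: real)"
    "\<And>s f. s \<in> EJ \<Longrightarrow> (\<And>v. v \<notin> J \<Longrightarrow> f v = 0) \<Longrightarrow> rowdiff s f = g s * rowval f (\<rho> s)" by blast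
  have flJ: "(fl ! r) v = 0" if "r < length fl" "v \<notin> J" for r v
    using PLJ[of "PL ! r" v] that by (simp add: fl_def)
  have ssAM: "set (ssA @ ssM) = EJ" using ssA ssM by (auto simp: Arms_def)
  have perlJ: "perl (\<lambda>r s. rowdiff s (fl ! r)) (ssA @ ssM) {..<length fl} \<noteq> 0"
  proof -
    have "perl (\<lambda>r s. rowdiff s (fl ! r)) (ssA @ ssM) {..<length fl}
        = perl (\<lambda>r s. g s * rowval (fl ! r) (\<rho> s)) (ssA @ ssM) {..<length fl}"
    proof (rule perl_cong)
      fix r s assume "r \<in> {..<length fl}" "s \<in> set (ssA @ ssM)"
      then show "rowdiff s (fl ! r) = g s * rowval (fl ! r) (\<rho> s)"
        unfolding ssAM using flJ by (intro g(2)) auto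
    qed
    also have "\<dots> = (\<Prod>s\<leftarrow>ssA @ ssM. g s) * perl (\<lambda>r s. rowval (fl ! r) (\<rho> s)) (ssA @ ssM) {..<length fl}"
      by (rule perl_scale_rows)
    also have "perl (\<lambda>r s. rowval (fl ! r) (\<rho> s)) (ssA @ ssM) {..<length fl}
        = perl (\<lambda>r. rowval (fl ! r)) (map Inl ls @ map Inr ms) {..<length fl}"
      unfolding \<rho>A[symmetric] \<rho>M[symmetric] map_append[symmetric] perl_map ..
    finally have eq: "perl (\<lambda>r s. rowdiff s (fl ! r)) (ssA @ ssM) {..<length fl}
        = (\<Prod>s\<leftarrow>ssA @ ssM. g s) * perl (\<lambda>r. rowval (fl ! r)) (map Inl ls @ map Inr ms) {..<length fl}" .
    have "perl (\<lambda>r. rowval (fl ! r)) (map Inl ls @ map Inr ms) {..<length fl} \<noteq> 0"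
    proof (rule perl_positive[OF finite_J _ _ _ _ mls fl])
      fix a b \<sigma> assume "(a, b, \<sigma>) \<in> set (map fst TS @ map fst sg)"
      then have "(a, b, \<sigma>) \<in> fst ` set (TS @ sg)" by (simp add: image_Un)
      then obtain q where q: "q \<in> set (TS @ sg)" "fst q = (a, b, \<sigma>)" by (metis imageE)
      then show "a \<in> J \<and> b \<in> J \<and> a \<noteq> b \<and> (\<sigma> = 1 \<or> \<sigma> = -1)" using TJ[OF q(1)] by simp
    next
      show "length (map fst sg) \<le> 1" using sg by simp
      show "set (map fst ms @ map snd ms) \<subseteq> J" using T_facts(8,9) tl(2) by (fastforce simp: ms_def)
      have "inj_on (\<lambda>t. fst t) T" by (rule inj_onI, rule Tinj) auto
      moreover have "inj_on (\<lambda>t. fst (snd t)) T" by (rule inj_onI, rule Tinj) auto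
      moreover have "map fst ms = map fst tl" "map snd ms = map (\<lambda>t. fst (snd t)) tl"
        by (simp_all add: ms_def case_prod_unfold)
      moreover have "fst ` T \<inter> (\<lambda>t. fst (snd t)) ` T = {}"
      proof (rule ccontr)
        assume "\<not> ?thesis"
        then obtain t t' where t: "t \<in> T" "t' \<in> T" "fst t = fst (snd t')" by blast
        then have "t = t'" using Tinj[of t t'] by simp
        obtain w p x where "t = (w, p, x)" by (metis prod.collapse)
        then show False using t \<open>t = t'\<close> T_facts(3)[of w p x] by simp
      qed
      ultimately show "distinct (map fst ms @ map snd ms)" using tl by (simp add: distinct_map)
    qed
    moreover have "(\<Prod>s\<leftarrow>ssA @ ssM. g s) \<noteq> 0"
    proof -
      have "g s \<noteq> 0" if "s \<in> set (ssA @ ssM)" for s using g(1)[of s] that unfolding ssAM by auto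
      then show ?thesis by (auto simp: prod_list_zero_iff)
    qed
    ultimately show ?thesis unfolding eq by simp
  qed
  define \<Phi> :: "(nat + 'a set) set" where "\<Phi> = Inl ` {..<length fl} \<union> Inr ` E0"
  define f where "f = case_sum (\<lambda>r. fl ! r) (\<lambda>e. ind (arm e))"
  define a :: "nat + 'a set \<Rightarrow> 'a set \<Rightarrow> real" where
    "a = case_sum (\<lambda>r. snd (PL ! r)) (\<lambda>e e'. of_bool (e' = arm e))"
  have lenfl: "length fl = length (ssA @ ssM)"
  proof -
    have "length (concat (map (\<lambda>t. [tform t, tform t]) (map fst TS))) = length (concat (map (\<lambda>(a, b, \<sigma>). [a, b]) (map fst TS)))"
      by (induction TS) auto
    moreover have "length ls = length (concat (map (\<lambda>(a, b, \<sigma>). [a, b]) (map fst TS)) @ map fst (map fst sg))"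
      using mls by (metis size_mset)
    ultimately show ?thesis unfolding fl by (simp add: ls_def ms_def ssM_def)
  qed
  have Armfacts: "arm e \<in> EJ" "ind (arm e) v = 0 \<longleftrightarrow> v \<notin> arm e" if "e \<in> E0" for e v
    using arm[OF that] arm_in_EJ by (auto simp: ind_def)
  have diag: "rowdiff s (ind (arm e)) = 0" if e: "e \<in> E0" and s: "s \<in> E" "s \<inter> J = {}" "s \<noteq> e" for e s
  proof -
    obtain x c where x: "x \<in> e" "c \<in> N x" "arm e = {c, x}" using arm[OF e] by auto
    have "x \<notin> s" using e s x by (auto simp: E0_def)
    moreover have "c \<notin> s" using s x by (auto simp: in_N)
    moreover have "hdv s \<in> s" "tlv s \<in> s" using hdv_tlv(2)[OF card2[OF s(1)]] by (metis insertCI)+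
    ultimately have "hdv s \<notin> {c, x}" "tlv s \<notin> {c, x}" by auto
    then have "hdv s \<notin> arm e" "tlv s \<notin> arm e" unfolding x(3) .
    then show ?thesis by (simp add: rowdiff_def ind_def)
  qed
  have diag1: "rowdiff e (ind (arm e)) \<noteq> 0" if e: "e \<in> E0" for e
  proof -
    obtain x c where x: "x \<in> e" "c \<in> N x" "arm e = {c, x}" using arm[OF e] by auto
    obtain y where y: "e = {x, y}" "x \<noteq> y" using E0_facts(4)[OF e] x by (auto simp: card_2_iff)
    have "y \<noteq> c" using E0_facts(2)[OF e] x y(1) by (auto simp: in_N)
    then have i: "ind (arm e) x = 1" "ind (arm e) y = 0" using y(2) unfolding x(3) by (auto simp: ind_def)
    from rowdiff_doubleton[OF y(2)] have "rowdiff {x, y} (ind (arm e)) \<noteq> 0"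
    proof
      assume "rowdiff {x, y} = (\<lambda>f. f x - f y)"
      then show ?thesis using i by simp
    next
      assume "rowdiff {x, y} = (\<lambda>f. f y - f x)"
      then show ?thesis using i by simp
    qed
    then show ?thesis by (simp only: y(1)[symmetric] not_False_eq_True)
  qed
  have "good ((EJ \<union> E0) \<union> (E - (EJ \<union> E0)))"
  proof (rule good_union[where \<Phi> = \<Phi> and f = f and a = a and ss = "ss0 @ ssA @ ssM"])
    show "finite \<Phi>" using finite_EJ by (simp add: \<Phi>_def)
    have "card \<Phi> = length fl + card E0"
      unfolding \<Phi>_def using finite_EJ by (subst card_Un_disjoint) (auto simp: card_image)
    then show "card \<Phi> = length (ss0 @ ssA @ ssM)" using lenfl ss0 by (metis distinct_card length_append add.commute)
    show "distinct (ss0 @ ssA @ ssM)"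
      using ss0 ssA ssM EJ_E0_disjoint by (auto simp: Arms_def)
    show "set (ss0 @ ssA @ ssM) = EJ \<union> E0" using ssAM ss0 by auto
    show "f r = (\<lambda>v. \<Sum>e\<in>EJ \<union> E0. a r e * ind e v)" if r: "r \<in> \<Phi>" for r
    proof (cases r)
      case (Inl i)
      then show ?thesis using PLsum[of "PL ! i"] r by (auto simp: \<Phi>_def f_def a_def fl_def)
    next
      case (Inr e)
      then have "arm e \<in> EJ" using r Armfacts by (auto simp: \<Phi>_def)
      have "(\<Sum>e'\<in>EJ \<union> E0. of_bool (e' = arm e) * ind e' v) = (\<Sum>e'\<in>{arm e}. of_bool (e' = arm e) * ind e' v)" for v
        using finite_EJ \<open>arm e \<in> EJ\<close> by (intro sum.mono_neutral_right) auto
      then show ?thesis by (simp add: Inr f_def a_def)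
    qed
    show "card {r\<in>\<Phi>. a r e \<noteq> 0} \<le> 4" if "e \<in> EJ \<union> E0" for e
    proof -
      have "{r\<in>\<Phi>. a r e \<noteq> 0} = Inl ` {i. i < length PL \<and> snd (PL ! i) e \<noteq> 0} \<union> Inr ` {e0\<in>E0. e = arm e0}"
        by (auto simp: \<Phi>_def a_def fl_def)
      also have "card \<dots> \<le> card {i. i < length PL \<and> snd (PL ! i) e \<noteq> 0} + card {e0\<in>E0. e = arm e0}"
        using finite_EJ by (intro order_trans[OF card_Un_le] add_mono card_image_le) auto
      also have "card {i. i < length PL \<and> snd (PL ! i) e \<noteq> 0} = length (filter (\<lambda>y. snd y e \<noteq> 0) PL)"
        by (simp add: length_filter_conv_card)
      also have "\<dots> = 2 * usage TS e + usage sg e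
          + length (filter (\<lambda>t. gcoef n t e \<noteq> 0) tl)"
      proof -
        have "length (filter (\<lambda>y. snd y e \<noteq> 0) (concat (map (\<lambda>q. [(tform (fst q), snd q), (tform (fst q), snd q)]) TS)))
          = 2 * usage TS e"
          by (induction TS) auto
        then show ?thesis unfolding PL_def by (simp add: filter_map comp_def)
      qed
      also have "length (filter (\<lambda>t. gcoef n t e \<noteq> 0) tl) \<le> of_bool (e \<in> TE)"
      proof -
        define tri where "tri = (\<lambda>t. e = {fst t, fst (snd t)} \<or> e = {fst t, snd (snd t)} \<or> e = {fst (snd t), snd (snd t :: 'a \<times> 'a)})"
        have tri: "tri t" if "gcoef n t e \<noteq> 0" for t
          using that unfolding gcoef_def tri_def case_prod_unfold
          by (cases "e = {fst t, fst (snd t)}"; cases "e = {fst t, snd (snd t)}"; cases "e = {fst (snd t), snd (snd t)}") simp_all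
        have uniq: "t = t'" if t: "t \<in> T" "t' \<in> T" "tri t" "tri t'" for t t'
        proof (rule Tinj[OF t(1,2)])
          have *: "e \<inter> J \<noteq> {} \<and> e \<inter> J \<subseteq> {fst t, fst (snd t)}" if "t \<in> T" "tri t" for t
            using that T_facts(5,8,9)[of "fst t" "fst (snd t)" "snd (snd t)"] unfolding tri_def by auto
          show "{fst t, fst (snd t)} \<inter> {fst t', fst (snd t')} \<noteq> {}" using *[OF t(1,3)] *[OF t(2,4)] by blast
        qed
        have "length (filter (\<lambda>t. gcoef n t e \<noteq> 0) tl) = card {t\<in>T. gcoef n t e \<noteq> 0}"
          using length_filter_distinct[OF tl(1)] tl(2) by simp
        also have "\<dots> \<le> card {t\<in>T. tri t}" using finT tri by (intro card_mono) auto
        also have "\<dots> \<le> of_bool (e \<in> TE)"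
        proof (cases "\<exists>t\<in>T. tri t")
          case True
          then obtain t where t: "t \<in> T" "tri t" by auto
          obtain w p x where wpx: "t = (w, p, x)" by (metis prod.collapse)
          have "(w, p, x) \<in> T" "e = {w, p} \<or> e = {w, x} \<or> e = {p, x}"
            using t unfolding wpx tri_def by simp_all
          then have "e \<in> TE" unfolding TE_def by blast
          moreover have "{t\<in>T. tri t} \<subseteq> {t}" using uniq t by blast
          then have "card {t\<in>T. tri t} \<le> card {t}" by (intro card_mono) auto
          ultimately show ?thesis by simp
        next
          case False
          then have "{t\<in>T. tri t} = {}" by auto
          then show ?thesis by (simp only: card.empty le0)
        qed
        finally show ?thesis .
      qed
      \<comment> \<open>An arm determines its isolated edge: the end outside \<open>J\<close> lies
        in only one edge of \<open>E0\<close>.\<close>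
      also have "card {e0\<in>E0. e = arm e0} \<le> of_bool (e \<in> arm ` E0)"
      proof (cases "e \<in> arm ` E0")
        case True
        then obtain e0 where e0: "e0 \<in> E0" "e = arm e0" by auto
        have "e1 = e0" if e1: "e1 \<in> E0" "e = arm e1" for e1
        proof -
          obtain x c where x: "x \<in> e0" "c \<in> N x" "e = {c, x}" using arm[OF e0(1)] e0 by auto
          obtain x' c' where x': "x' \<in> e1" "c' \<in> N x'" "e = {c', x'}" using arm[OF e1(1)] e1 by auto
          have "x \<notin> J" "x' \<notin> J" using E0_facts(2) e0 e1 x x' by auto
          then have "x = x'" using x x' by (auto simp: doubleton_eq_iff in_N)
          then show ?thesis using E0_disjoint[OF e1(1) e0(1), of x] x(1) x'(1) by simp
        qed
        then have "card {e0\<in>E0. e = arm e0} \<le> card {e0}" by (intro card_mono) auto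
        then show ?thesis using True by simp
      next
        case False
        then have "{e0\<in>E0. e = arm e0} = {}" by auto
        then show ?thesis by (simp only: card.empty le0)
      qed
      finally show ?thesis using load[of e] by linarith
    qed
    show "rowdiff s (f r) = 0" if r: "r \<in> \<Phi>" and s: "s \<in> E - (EJ \<union> E0)" for r s
    proof (cases r)
      case (Inl i)
      then show ?thesis using flJ r s rowdiff_vanish[of "fl ! i" s] by (auto simp: \<Phi>_def f_def EJ_def)
    next
      case (Inr e)
      then show ?thesis using diag[of e s] r s by (auto simp: \<Phi>_def f_def EJ_def)
    qed
    show "(EJ \<union> E0) \<inter> (E - (EJ \<union> E0)) = {}" by auto
    have "perl (\<lambda>r s. rowdiff s (f r)) (ss0 @ ssA @ ssM) \<Phi>
      = perl (\<lambda>r s. rowdiff s (f r)) ss0 (Inr ` E0) * perl (\<lambda>r s. rowdiff s (f r)) (ssA @ ssM) (Inl ` {..<length fl})"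
      unfolding \<Phi>_def
    proof (rule perl_append_block)
      show "card (Inr ` E0) = length ss0" using ss0 by (simp add: card_image distinct_card[symmetric])
      fix r :: "nat + 'a set" and s assume "r \<in> Inl ` {..<length fl}" "s \<in> set ss0"
      then show "rowdiff s (f r) = 0" using flJ ss0(2) E0_facts(1,2)[of s]
        by (auto simp: f_def intro!: rowdiff_vanish)
    qed (use finite_EJ in auto)
    also have "\<dots> \<noteq> 0"
    proof -
      have "perl (\<lambda>r s. rowdiff s (f r)) ss0 (Inr ` E0) = perl (\<lambda>e s. rowdiff s (ind (arm e))) ss0 E0"
        by (simp add: perl_reindex f_def)
      also have "\<dots> = (\<Prod>e\<in>E0. rowdiff e (ind (arm e)))"
        by (rule perl_diagonal[OF ss0]) (use diag E0_facts(1,2) in auto)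
      also have "\<dots> \<noteq> 0" using diag1 finite_EJ by simp
      finally have "perl (\<lambda>r s. rowdiff s (f r)) ss0 (Inr ` E0) \<noteq> 0" .
      moreover have "perl (\<lambda>r s. rowdiff s (f r)) (ssA @ ssM) (Inl ` {..<length fl}) \<noteq> 0"
        using perlJ by (simp add: perl_reindex f_def)
      ultimately show ?thesis by simp
    qed
    finally show "perl (\<lambda>r s. rowdiff s (f r)) (ss0 @ ssA @ ssM) \<Phi> \<noteq> 0" .
  qed (use rest in auto)
  moreover have "(EJ \<union> E0) \<union> (E - (EJ \<union> E0)) = E" by (auto simp: EJ_def E0_def)
  ultimately show ?thesis by simp
qed

end


section \<open>Even and odd numbers of unpaired tokens\<close>

context core
begin

text \<open>The vertices at which local pairing leaves one token over; a join has to link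
  them.\<close>

definition S where "S = {v\<in>U. odd (card (Mv v))}"

lemma F0_sub: "F0 \<union> Ex \<subseteq> EJ \<union> E0" by (auto simp: F0_def Ex_def)

lemma free_antimono: "free D \<Longrightarrow> D' \<subseteq> D \<Longrightarrow> free D'"
  unfolding free_def by blast

text \<open>The token sets \<open>M\<close> may deviate from \<open>Mv\<close> by a dummy or a
  removed token, as the odd cases require. At boundary vertices outside \<open>J\<close> they must
  agree, since there \<open>Mv_two\<close> supplies the choice between labels.\<close>

lemma trails_exist:
  assumes D: "D \<subseteq> F0 \<union> Ex"
    and MJ: "\<And>v. v \<in> J \<Longrightarrow> M v \<subseteq> {v}"
    and MX: "\<And>v. v \<notin> J \<Longrightarrow> M v \<subseteq> Mv v"
    and bdD: "bd D = {v\<in>U. odd (card (M v))}"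
    and eq: "\<And>v. v \<in> bd D \<Longrightarrow> v \<notin> J \<Longrightarrow> M v = Mv v"
  shows "\<exists>TS. (\<forall>q\<in>set TS. realizes (EJ \<union> E0) q \<and> set (ends (fst q)) \<subseteq> J \<and> distinct (ends (fst q))) \<and>
    (\<forall>l. count (mset (labels TS)) l = card {v\<in>U. l \<in> M v}) \<and>
    (\<forall>e. usage TS e \<le> of_bool (own e) + of_bool (e \<in> D))"
proof -
  have finM: "finite (M v)" for v
    using MJ[of v] MX[of v] finite_Mv[of v] by (cases "v \<in> J") (auto intro: finite_subset)
  have ne: "M v \<noteq> {}" if "v \<in> bd D" for v using that bdD by auto
  have "\<exists>TS. (\<forall>q\<in>set TS. realizes (EJ \<union> E0) q \<and> set (ends (fst q)) \<subseteq> J \<and> distinct (ends (fst q))) \<and>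
    (\<forall>l. count (mset (labels TS)) l = card {v\<in>U. l \<in> M v}) \<and>
    (\<forall>e. usage TS e
       \<le> of_bool (\<exists>v\<in>U - J. \<exists>l\<in>M v. e = {l, v}) + of_bool (e \<in> D))"
  proof (rule trails_from_tokens)
    show "finite (EJ \<union> E0)" using finite_EJ by simp
    show "D \<subseteq> EJ \<union> E0" using D F0_sub by blast
    show "card e = 2" if "e \<in> D" for e
      using that D F0_sub card2 by (auto simp: EJ_def E0_def)
    show "l \<in> J \<and> {l, v} \<in> EJ \<union> E0" if "v \<notin> J" "l \<in> M v" for v l
      using that MX[of v] Mv_X[of v] arm_in_EJ[of l v] by (auto simp: in_N)
    show "\<exists>a\<in>M s. \<exists>b\<in>M s'. a \<noteq> b" if s: "s \<in> bd D" "s' \<in> bd D" "s \<noteq> s'" for s s'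
    proof -
      obtain a b where ab: "a \<in> M s" "b \<in> M s'" using ne s by blast
      consider "s \<notin> J" | "s' \<notin> J" | "s \<in> J" "s' \<in> J" by blast
      then show ?thesis
      proof cases
        case 1
        then show ?thesis using Mv_two[of s] eq[of s] s ab by (metis empty_iff)
      next
        case 2
        then show ?thesis using Mv_two[of s'] eq[of s'] s ab by (metis empty_iff)
      next
        case 3
        then show ?thesis using MJ[of s] MJ[of s'] ab s(3) by blast
      qed
    qed
  qed (use finite_U MJ finM bdD in auto)
  moreover have "of_bool (\<exists>v\<in>U - J. \<exists>l\<in>M v. e = {l, v}) \<le> (of_bool (own e) :: nat)" for e
    using MX by (auto simp: own_def of_bool_def)
  ultimately show ?thesis by (meson add_le_mono1 order_trans)
qed

lemma good_even:
  assumes "even (card S)" "good (E - (EJ \<union> E0))"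
  shows "good E"
proof -
  obtain D where D: "D \<subseteq> F0 \<union> Ex" "bd D = S" "free D"
    using free_join[of S] assms(1) by (auto simp: S_def)
  from trails_exist[OF D(1) Mv_J order_refl D(2)[unfolded S_def] refl]
  obtain TS where TS: "\<And>q. q \<in> set TS \<Longrightarrow> realizes (EJ \<union> E0) q \<and> set (ends (fst q)) \<subseteq> J \<and> distinct (ends (fst q))"
    "\<And>l. count (mset (labels TS)) l = card {v\<in>U. l \<in> Mv v}"
    "\<And>e. usage TS e \<le> of_bool (own e) + of_bool (e \<in> D)"
    by blast
  obtain arm where arm: "\<And>e. e \<in> E0 \<Longrightarrow> \<exists>x\<in>e. \<exists>c\<in>N x. arm e = {c, x} \<and> (own (arm e) \<and> arm e \<in> D \<longrightarrow> arm e \<in> TE)"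
    using choose_arms[OF D(3)] by blast
  show ?thesis
  proof (rule block_good[where TS = TS and sg = "[]" and arm = arm])
    show "realizes (EJ \<union> E0) q \<and> set (ends (fst q)) \<subseteq> J \<and> distinct (ends (fst q))" if "q \<in> set (TS @ [])" for q
      using TS(1)[of q] that by simp
    show "count (mset (labels TS @ map (\<lambda>q. fst (fst q)) [])) l = card {x\<in>X. l \<in> N x}"
      if "l \<in> J" for l using TS(2)[of l] token_count[OF that] by simp
    show "\<exists>x\<in>e. \<exists>c\<in>N x. arm e = {c, x}" if "e \<in> E0" for e using arm[OF that] by blast
    fix e
    have "2 * (of_bool (own e) + of_bool (e \<in> D)) + of_bool (e \<in> TE) + of_bool (e \<in> arm ` E0) \<le> (4 :: nat)"
    proof (rule load_bound[OF D(1) _ arm])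
      fix w p x assume t: "(w, p, x) \<in> T" "card (N x) = 2"
      then have "Mv x = N x" using T_facts(5)[OF t(1)] by (auto simp: Mv_def heavy_def)
      then show "{w, x} \<notin> D" using light_witness_arm[OF D(1) t] t(2) D(2) by (simp add: S_def)
    qed
    then show "2 * usage TS e + usage [] e
      + of_bool (e \<in> TE) + of_bool (e \<in> arm ` E0) \<le> (4 :: nat)"
      using TS(3)[of e] by simp
  qed (use assms in auto)
qed

text \<open>A dummy token at \<open>R\<close> restores parity. The form that consumes it is used
  once instead of twice and counted with its other label \<open>b\<close> only, so the dummy
  disappears from the label count.\<close>

lemma good_odd_dummy:
  assumes "odd (card S)" "R \<in> J" "Mv R = {}" "good (E - (EJ \<union> E0))"
  shows "good E"
proof -
  define M where "M = Mv(R := {R})"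
  have RS: "R \<notin> S" using assms by (simp add: S_def)
  have finS: "finite S" using finite_U by (simp add: S_def)
  have SM: "insert R S = {v\<in>U. odd (card (M v))}"
    using assms(2) by (auto simp: S_def M_def U_def)
  have "insert R S \<subseteq> U" "even (card (insert R S))"
    using assms(1,2) RS finS by (auto simp: S_def U_def)
  from free_join[OF this] obtain D where D: "D \<subseteq> F0 \<union> Ex" "bd D = insert R S" "free D" by blast
  have MJ: "M v \<subseteq> {v}" if "v \<in> J" for v using Mv_J[OF that] by (auto simp: M_def)
  have MX: "M v = Mv v" if "v \<notin> J" for v using that assms(2) by (auto simp: M_def)
  obtain TS where TS: "\<And>q. q \<in> set TS \<Longrightarrow> realizes (EJ \<union> E0) q \<and> set (ends (fst q)) \<subseteq> J \<and> distinct (ends (fst q))"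
    "\<And>l. count (mset (labels TS)) l = card {v\<in>U. l \<in> M v}"
    "\<And>e. usage TS e \<le> of_bool (own e) + of_bool (e \<in> D)"
    using trails_exist[of D M, OF D(1) MJ] MX D(2) SM by blast
  have cM: "card {v\<in>U. l \<in> M v} = card {v\<in>U. l \<in> Mv v} + of_bool (l = R)" for l
  proof (cases "l = R")
    case True
    have "{v\<in>U. l \<in> M v} = insert R {v\<in>U. l \<in> Mv v}" "R \<notin> {v\<in>U. l \<in> Mv v}"
      using assms(2,3) True by (auto simp: M_def U_def)
    then show ?thesis using True finite_U by simp
  next
    case False
    then have "{v\<in>U. l \<in> M v} = {v\<in>U. l \<in> Mv v}" using assms(3) by (auto simp: M_def)
    then show ?thesis using False by simp
  qed
  have "count (mset (labels TS)) R > 0" unfolding TS(2) cM by simp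
  then have "R \<in># mset (labels TS)" unfolding count_greater_zero_iff .
  then obtain q0 where q0: "q0 \<in> set TS" "R \<in> set (ends (fst q0))"
    unfolding set_mset_mset set_concat set_map by blast
  then obtain TS1 TS2 where TS12: "TS = TS1 @ q0 # TS2" by (meson split_list)
  \<comment> \<open>The form is turned round, if necessary, so that the counted label
    \<open>b\<close> comes first.\<close>
  obtain b \<sigma> c where b: "realizes (EJ \<union> E0) ((b, R, \<sigma>), c)" "\<And>e. c e \<noteq> 0 \<Longrightarrow> snd q0 e \<noteq> 0"
    "mset (ends (fst q0)) = {#b, R#}" "b \<in> J" "b \<noteq> R"
  proof -
    obtain a a' \<sigma> c where qq: "q0 = ((a, a', \<sigma>), c)" by (metis prod.collapse)
    have r: "realizes (EJ \<union> E0) ((a, a', \<sigma>), c)" "a \<in> J" "a' \<in> J" "a \<noteq> a'" using TS(1)[OF q0(1)] qq by auto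
    consider "a' = R" | "a = R" using q0(2) qq by auto
    then show thesis
    proof cases
      case 1
      show thesis by (rule that[of a \<sigma> c]) (use r qq 1 in auto)
    next
      case 2
      show thesis by (rule that[of a' \<sigma> "\<lambda>e. \<sigma> * c e"]) (use realizes_swap[OF r(1)] r qq 2 in auto)
    qed
  qed
  obtain arm where arm: "\<And>e. e \<in> E0 \<Longrightarrow> \<exists>x\<in>e. \<exists>c\<in>N x. arm e = {c, x} \<and> (own (arm e) \<and> arm e \<in> D \<longrightarrow> arm e \<in> TE)"
    using choose_arms[OF D(3)] by blast
  show ?thesis
  proof (rule block_good[where TS = "TS1 @ TS2" and sg = "[((b, R, \<sigma>), c)]" and arm = arm])
    show "realizes (EJ \<union> E0) q \<and> set (ends (fst q)) \<subseteq> J \<and> distinct (ends (fst q))"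
      if q: "q \<in> set ((TS1 @ TS2) @ [((b, R, \<sigma>), c)])" for q
    proof (cases "q = ((b, R, \<sigma>), c)")
      case True
      then show ?thesis using b assms(2) by simp
    next
      case False
      then have "q \<in> set TS" using q TS12 by auto
      then show ?thesis by (rule TS(1))
    qed
    show "count (mset (labels (TS1 @ TS2) @ map (\<lambda>q. fst (fst q)) [((b, R, \<sigma>), c)])) l = card {x\<in>X. l \<in> N x}"
      if "l \<in> J" for l
    proof -
      have "mset (labels TS) = mset (labels (TS1 @ TS2)) + {#b, R#}"
        unfolding TS12 b(3)[symmetric] by simp
      then have "count (mset (labels (TS1 @ TS2))) l + count {#b, R#} l = card {v\<in>U. l \<in> Mv v} + of_bool (l = R)"
        using TS(2)[of l] cM[of l] by (metis count_union)
      then show ?thesis unfolding token_count[OF that] by (auto split: if_splits)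
    qed
    show "\<exists>x\<in>e. \<exists>c\<in>N x. arm e = {c, x}" if "e \<in> E0" for e using arm[OF that] by blast
    fix e
    have 1: "2 * (of_bool (own e) + of_bool (e \<in> D)) + of_bool (e \<in> TE) + of_bool (e \<in> arm ` E0) \<le> (4 :: nat)"
    proof (rule load_bound[OF D(1) _ arm])
      fix w p x assume t: "(w, p, x) \<in> T" "card (N x) = 2"
      then have "Mv x = N x" "x \<noteq> R" using T_facts(5)[OF t(1)] assms(2) by (auto simp: Mv_def heavy_def)
      then show "{w, x} \<notin> D" using light_witness_arm[OF D(1) t] t(2) D(2) by (simp add: S_def)
    qed
    have 2: "usage TS e = usage (TS1 @ TS2) e + of_bool (snd q0 e \<noteq> 0)"
      unfolding TS12 by simp
    have 3: "usage [((b, R, \<sigma>), c)] e \<le> of_bool (snd q0 e \<noteq> 0)" using b(2)[of e] by auto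
    have "2 * m + s + t + r \<le> 4" if "2 * (p + d) + t + r \<le> 4" "n = m + k" "s \<le> k" "n \<le> p + d"
      for p d t r n m k s :: nat using that by simp
    from this[OF 1 2 3 TS(3)] show "2 * usage (TS1 @ TS2) e + usage [((b, R, \<sigma>), c)] e
      + of_bool (e \<in> TE) + of_bool (e \<in> arm ` E0) \<le> (4 :: nat)"
      .
  qed (use assms in auto)
qed

text \<open>Otherwise \<open>R\<close> has only private neighbours, hence by
  \<open>private_unique\<close> just one, and the edge to it would be cut off from the other labels,
  against \<open>connected\<close>.\<close>

lemma label_with_wide_neighbour:
  assumes T: "\<And>w p x. (w, p, x) \<notin> T" and R: "R \<in> J" "Mv R = {R}"
  shows "\<exists>x\<in>X. R \<in> N x \<and> 2 \<le> card (N x)"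
proof (rule ccontr)
  assume no: "\<not> ?thesis"
  have single: "N x = {R}" if "x \<in> X" "R \<in> N x" for x
  proof -
    have "card (N x) < 2" using no that by auto
    then have "card (N x) \<le> 1" by simp
    then show ?thesis using that(2) finite_N[of x] card_le_Suc0_iff_eq[OF finite_N[of x]] by auto
  qed
  obtain y where y: "y \<notin> J" "N y = {R}" using R T by (auto simp: Mv_def heavy_def split: if_splits)
  obtain R' where R': "R' \<in> J" "R' \<noteq> R" using two_labels by metis
  have "sym_diff {R} {R'} \<in> espan EJ"
    using connected R R' unfolding spans_pairs_def EJ_def by blast
  then obtain D where D: "finite D" "D \<subseteq> EJ" "bd D = sym_diff {R} {R'}" by (auto simp: espan_def)
  obtain e where e: "e \<in> D" "R \<in> e" using bd_in_edge[of R D] D(3) R' by auto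
  have "e \<in> EJ" using e D by auto
  then have eRy: "e = {R, y}"
  proof (cases rule: EJ_cases)
    case (arm l x)
    then have "l = R" using e R by (auto simp: X_def)
    then have "N x = {R}" using single arm by auto
    then have "x = y" using private_unique[of x y R] y arm by (auto simp: N_def X_def)
    then show ?thesis using arm \<open>l = R\<close> by simp
  next
    case mat
    then show ?thesis using T by simp
  qed
  have "{e\<in>D. y \<in> e} = {{R, y}}"
  proof (intro set_eqI iffI)
    fix f assume "f \<in> {e\<in>D. y \<in> e}"
    then show "f \<in> {{R, y}}" using EJ_edge_at[of f y] D y by auto
  qed (use e eRy in auto)
  then have "y \<in> bd D" by (simp add: bd_def)
  then show False using D(3) y R R' by auto
qed

text \<open>Choose \<open>t \<in> S\<close> and a free \<open>D\<close> with boundary \<open>S - {t}\<close> such that \<open>D\<close> is as small as possible; then \<open>D\<close>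
avoids \<open>t\<close>, for otherwise a trail in \<open>D\<close> starting at \<open>t\<close> could be removed.\<close>

lemma single_arm_pair:
  assumes T: "\<And>w p x. (w, p, x) \<notin> T" and tok: "\<And>R. R \<in> J \<Longrightarrow> Mv R = {R}" and odd: "odd (card S)"
  shows "\<exists>D l v x u. D \<subseteq> F0 \<union> Ex \<and> free D \<and> x \<in> X \<and> l \<in> N x \<and> v \<in> N x \<and> l \<noteq> v \<and>
    {l, x} \<notin> D \<and> {v, x} \<notin> D \<and> u \<in> S \<and> l \<in> Mv u \<and> bd D = S - {u}"
proof -
  have JS: "J \<subseteq> S" using tok by (auto simp: S_def U_def)
  have MvX: "Mv x = (if 2 \<le> card (N x) then N x else {})" if "x \<notin> J" for x
    using that T by (auto simp: Mv_def heavy_def)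
  have F0: "F0 = EJ" using T by (auto simp: F0_def)
  have finF: "finite (F0 \<union> Ex)" using finite_EJ by (auto simp: F0_def Ex_def)
  have SU: "S \<subseteq> U" "finite S" using finite_U by (auto simp: S_def)
  have ExE0: "e \<in> E0" if "e \<in> Ex" for e using that by (simp add: Ex_def)
  define P where "P = (\<lambda>(t, D). t \<in> S \<and> D \<subseteq> F0 \<union> Ex \<and> bd D = S - {t} \<and> free D)"
  have "\<exists>q. P q"
  proof -
    obtain t where t: "t \<in> S" using odd by fastforce
    have "even (card (S - {t}))" using t odd SU by simp
    then obtain D where "D \<subseteq> F0 \<union> Ex" "bd D = S - {t}" "free D" using free_join[of "S - {t}"] SU by blast
    then show ?thesis using t unfolding P_def by blast
  qed
  then obtain q where q: "P q" "\<And>q'. P q' \<Longrightarrow> card (snd q) \<le> card (snd q')"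
    using ex_has_least_nat[of P _ "\<lambda>q. card (snd q)"] by blast
  obtain t D where tD: "q = (t, D)" by (cases q)
  have t: "t \<in> S" "D \<subseteq> F0 \<union> Ex" "bd D = S - {t}" "free D" using q(1) by (auto simp: P_def tD)
  have minD: "card D \<le> card D'" if "t' \<in> S" "D' \<subseteq> F0 \<union> Ex" "bd D' = S - {t'}" "free D'" for t' D'
    using q(2)[of "(t', D')"] that by (simp add: P_def tD)
  have finD: "finite D" using t(2) finF finite_subset by blast
  have D2: "card e = 2" if "e \<in> D" for e
    using that t(2) F0_sub card2 by (auto simp: EJ_def E0_def)
  have isolated: "t \<notin> e" if e: "e \<in> D" for e
  proof
    assume "t \<in> e"
    then obtain u where u: "e = {t, u}" using D2[OF e] by (auto simp: card_2_iff)
    have "{t, u} \<in> D" using e u by simp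
    from closed_or_odd_end[OF finD D2 this]
    obtain D1 where D1: "D1 \<subseteq> D" "D1 \<noteq> {}" "bd D1 = {} \<or> (\<exists>s. s \<in> bd D \<and> s \<noteq> t \<and> bd D1 = {t, s})" by blast
    have "D - D1 \<subset> D" using D1 by blast
    then have less: "card (D - D1) < card D" using finD by (rule psubset_card_mono[rotated])
    have sub: "D - D1 \<subseteq> F0 \<union> Ex" "free (D - D1)" using t free_antimono[of D "D - D1"] by auto
    have bd: "v \<in> bd (D - D1) \<longleftrightarrow> (v \<in> bd D) \<noteq> (v \<in> bd D1)" for v using bd_Diff[OF finD D1(1)] .
    from D1(3) show False
    proof
      assume "bd D1 = {}"
      then have "bd (D - D1) = S - {t}" using bd t(3) by blast
      then show False using minD[OF t(1) sub(1) _ sub(2)] less by simp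
    next
      assume "\<exists>s. s \<in> bd D \<and> s \<noteq> t \<and> bd D1 = {t, s}"
      then obtain s where s: "s \<in> bd D" "s \<noteq> t" "bd D1 = {t, s}" by auto
      have "bd (D - D1) = S - {s}" using bd s t(1) unfolding t(3) s(3) by blast
      then show False using minD[OF _ sub(1) _ sub(2)] less s(1) t(3) by fastforce
    qed
  qed
  \<comment> \<open>At an odd vertex outside \<open>J\<close> whose arms all avoid
    \<open>D'\<close>, any two arms are spare and the removed token can be taken from the vertex
    itself.\<close>
  have at_X: ?thesis if x: "x \<in> S" "x \<notin> J" and D': "D' \<subseteq> F0 \<union> Ex" "bd D' = S - {x}" "free D'" "\<And>c. {c, x} \<notin> D'" for x D'
  proof -
    have "Mv x \<noteq> {}" using x by (auto simp: S_def)
    then have M: "Mv x = N x" "2 \<le> card (N x)" using MvX[OF x(2)] by (auto split: if_splits)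
    obtain l v where "l \<in> N x" "v \<in> N x" "l \<noteq> v" using M(2) card_le_Suc0_iff_eq[OF finite_N[of x]] by force
    moreover have "x \<in> X" using x SU by (auto simp: U_def)
    ultimately show ?thesis using M(1) D' x by blast
  qed
  show ?thesis
  proof (cases "t \<in> J")
    case False
    show ?thesis by (rule at_X[OF t(1) False t(2,3,4)]) (use isolated in blast)
  next
    case True
    obtain x where x: "x \<in> X" "t \<in> N x" "2 \<le> card (N x)"
      using label_with_wide_neighbour[OF T True tok[OF True]] by blast
    have xJ: "x \<notin> J" "x \<noteq> t" using x True by (auto simp: X_def)
    have tx: "{t, x} \<notin> D" using isolated by blast
    show ?thesis
    proof (cases "\<exists>v\<in>N x - {t}. {v, x} \<notin> D")
      case True
      then obtain v where "v \<in> N x" "v \<noteq> t" "{v, x} \<notin> D" by auto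
      moreover have "t \<in> Mv t" using tok \<open>t \<in> J\<close> by simp
      ultimately show ?thesis using t x tx by blast
    next
      case False
      \<comment> \<open>All other arms at \<open>x\<close> lie in \<open>D\<close> and
        \<open>{t, x}\<close> does not. The parity prescribed at \<open>x\<close> then requires one
        more kind of edge, which can only come from \<open>Ex\<close>.\<close>
      have "\<exists>f\<in>D \<inter> Ex. x \<in> f"
      proof (rule ccontr)
        assume no: "\<not> ?thesis"
        have "{e\<in>D. x \<in> e} = (\<lambda>v. {v, x}) ` (N x - {t})"
        proof (intro set_eqI iffI)
          fix e assume e: "e \<in> {e\<in>D. x \<in> e}"
          then have "e \<in> EJ" using no t(2) F0 by blast
          then obtain c where c: "c \<in> N x" "e = {c, x}" using EJ_edge_at e xJ by blast
          have "c \<noteq> t" using c e isolated by auto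
          then show "e \<in> (\<lambda>v. {v, x}) ` (N x - {t})" using c by blast
        qed (use False in auto)
        moreover have "inj_on (\<lambda>v. {v, x}) (N x - {t})"
          using xJ by (auto simp: inj_on_def doubleton_eq_iff in_N)
        ultimately have "card {e\<in>D. x \<in> e} = card (N x) - 1"
          using x(2) finite_N by (simp add: card_image)
        then have "x \<in> bd D \<longleftrightarrow> odd (card (N x) - 1)" by (simp add: bd_def)
        moreover have "x \<in> bd D \<longleftrightarrow> odd (card (N x))"
          using MvX[OF xJ(1)] x xJ t(3) by (auto simp: S_def U_def)
        ultimately show False using x(3) by auto
      qed
      then obtain f where f: "f \<in> D" "f \<in> Ex" "x \<in> f" by blast
      note f0 = ExE0[OF f(2)]
      obtain x' where x': "f = {x, x'}" "x' \<noteq> x" using D2[OF f(1)] f(3) by (auto simp: card_2_iff)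
      have x'X: "x' \<in> X" "x' \<notin> J" "2 \<le> card (N x')" using E0_facts(2,3)[OF f0] x' f(2) by (auto simp: Ex_def)
      \<comment> \<open>Trading \<open>f\<close> for \<open>{t, x}\<close> keeps the number of edges
        and the parity at \<open>x\<close>, makes \<open>t\<close> odd as it should be, and flips
        \<open>x'\<close>.\<close>
      define D2' where "D2' = insert {t, x} (D - {f})"
      have bd2: "v \<in> bd D2' \<longleftrightarrow> (v \<in> S) \<noteq> (v = x')" for v
        unfolding D2'_def using bd_insert[of "D - {f}" "{t, x}" v] bd_remove[OF finD f(1), of v] finD tx t(1,3) x' xJ
        by auto
      have D2'sub: "D2' \<subseteq> F0 \<union> Ex" using t(2) arm_in_EJ[OF x(2)] by (auto simp: D2'_def F0)
      have other: "\<exists>y\<in>h. \<exists>c\<in>N y. {c, y} \<notin> D2'" if h: "h \<in> Ex" "h \<noteq> f" for h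
      proof -
        obtain y c where y: "y \<in> h" "c \<in> N y" "{c, y} \<notin> D" using t(4) h unfolding free_def by blast
        have "y \<noteq> x" using E0_disjoint[OF ExE0[OF h(1)] f0, of x] y f(3) h(2) by auto
        moreover have "y \<noteq> t" using E0_facts(2)[OF ExE0[OF h(1)]] y(1) \<open>t \<in> J\<close> by auto
        ultimately show ?thesis using y by (auto simp: D2'_def doubleton_eq_iff)
      qed
      show ?thesis
      proof (cases "\<exists>g\<in>D - {f}. x' \<in> g")
        case True
        then obtain g where g: "g \<in> D" "g \<noteq> f" "x' \<in> g" by auto
        have "g \<notin> Ex" using E0_disjoint[OF ExE0 f0, of g x'] g x' by auto
        then have "g \<in> EJ" using g t(2) F0 by auto
        then obtain c where c: "c \<in> N x'" "g = {c, x'}" using EJ_edge_at g x'X by blast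
        have ct: "c \<noteq> t" using c g isolated by auto
        have cJ: "c \<in> J" using c by (simp add: in_N)
        have gt: "g \<noteq> {t, x}" using isolated[OF g(1)] by auto
        \<comment> \<open>Dropping \<open>g\<close> as well repairs \<open>x'\<close> and makes the
          label \<open>c\<close> the missing vertex, with fewer edges than the minimal
          \<open>D\<close>.\<close>
        define D3 where "D3 = D2' - {g}"
        have gD: "g \<in> D2'" using g by (simp add: D2'_def)
        have fin2: "finite D2'" using finD by (simp add: D2'_def)
        have "v \<in> bd D3 \<longleftrightarrow> v \<in> S - {c}" for v
          unfolding D3_def using bd_remove[OF fin2 gD, of v] bd2[of v] c(2) cJ JS x'X(2) by auto
        then have bd3: "bd D3 = S - {c}" by blast
        have "free D3"
          unfolding free_def
        proof
          fix h assume h: "h \<in> Ex"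
          show "\<exists>y\<in>h. \<exists>c\<in>N y. {c, y} \<notin> D3"
          proof (cases "h = f")
            case True
            then show ?thesis using c x' by (auto simp: D3_def)
          next
            case False
            then show ?thesis using other[OF h] by (auto simp: D3_def)
          qed
        qed
        moreover have "D3 \<subseteq> F0 \<union> Ex" using D2'sub by (auto simp: D3_def)
        moreover have "card D3 < card D"
        proof -
          have "card D2' = card D" using finD f(1) tx card_gt_0_iff[of D] by (auto simp: D2'_def)
          moreover have "card D3 = card D2' - 1" using gD by (simp add: D3_def)
          moreover have "card D > 0" using finD f(1) card_gt_0_iff by blast
          ultimately show ?thesis by simp
        qed
        ultimately show ?thesis using minD[of c D3] cJ JS bd3 by auto
      next
        case False
        \<comment> \<open>Without such a \<open>g\<close> only \<open>f\<close> touched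
          \<open>x'\<close>. So \<open>x'\<close> is the missing vertex of \<open>D2'\<close>, which
          has no arm at it, and \<open>at_X\<close> applies.\<close>
        then have "{e\<in>D. x' \<in> e} = {f}" using f x' by auto
        then have "x' \<in> bd D" by (simp add: bd_def)
        then have x'S: "x' \<in> S" using t(3) by simp
        then have "bd D2' = S - {x'}" using bd2 by blast
        moreover have none: "{c, x'} \<notin> D2'" for c using False x' x'X xJ \<open>t \<in> J\<close> by (auto simp: D2'_def doubleton_eq_iff)
        moreover have "free D2'"
          unfolding free_def
        proof
          fix h assume h: "h \<in> Ex"
          show "\<exists>y\<in>h. \<exists>c\<in>N y. {c, y} \<notin> D2'"
          proof (cases "h = f")
            case True
            then show ?thesis using none x' x'X by (auto simp: X_def)
          next
            case False
            then show ?thesis using other[OF h] by simp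
          qed
        qed
        ultimately show ?thesis using at_X[OF x'S x'X(2) D2'sub] by blast
      qed
    qed
  qed
qed

text \<open>If every label has a token of its own there are no triangles: the second label
  \<open>p\<close> of a matched pair has neither a private neighbour nor a heavy witness. A single
  form \<open>y_l - y_v\<close> through a vertex \<open>x\<close>, both of whose arms avoid
  \<open>D\<close>, then takes the place of one token \<open>l\<close>.\<close>

lemma good_odd_tokens:
  assumes "odd (card S)" "\<And>R. R \<in> J \<Longrightarrow> Mv R \<noteq> {}" "good (E - (EJ \<union> E0))"
  shows "good E"
proof -
  have tok: "Mv R = {R}" if "R \<in> J" for R using assms(2)[OF that] Mv_J[OF that] by auto
  have T: "(w, p, x) \<notin> T" for w p x
  proof
    assume t: "(w, p, x) \<in> T"
    note f = T_facts[OF t]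
    from tok[OF f(9)] f(9) have "(\<exists>y. y \<notin> J \<and> N y = {p}) \<or> (\<exists>x. heavy p x)"
      by (auto simp: Mv_def split: if_splits)
    then show False
    proof
      assume "\<exists>y. y \<notin> J \<and> N y = {p}"
      then show False using T_private[OF t] by (auto simp: N_def)
    next
      assume "\<exists>x. heavy p x"
      then obtain p' x' where "(p, p', x') \<in> T" by (auto simp: heavy_def)
      then show False using T_matching[OF t, of p p' x'] f(3) by auto
    qed
  qed
  obtain D l v x u where D: "D \<subseteq> F0 \<union> Ex" "free D" "x \<in> X" "l \<in> N x" "v \<in> N x" "l \<noteq> v"
    "{l, x} \<notin> D" "{v, x} \<notin> D" "u \<in> S" "l \<in> Mv u" "bd D = S - {u}"
    using single_arm_pair[OF T tok assms(1)] by blast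
  define M where "M = Mv(u := Mv u - {l})"
  have finM: "finite (Mv w)" for w by (rule finite_Mv)
  have uM: "even (card (M u))" using D(9,10) finM[of u] by (simp add: M_def S_def)
  have SM: "S - {u} = {v\<in>U. odd (card (M v))}" using uM by (auto simp: S_def M_def)
  have MJ: "M w \<subseteq> {w}" if "w \<in> J" for w using Mv_J[OF that] by (auto simp: M_def)
  have MX: "M w \<subseteq> Mv w" for w by (auto simp: M_def)
  have Meq: "M w = Mv w" if "w \<in> bd D" for w using that D(11) by (auto simp: M_def)
  from trails_exist[OF D(1) MJ MX trans[OF D(11) SM] Meq]
  obtain TS where TS: "\<And>q. q \<in> set TS \<Longrightarrow> realizes (EJ \<union> E0) q \<and> set (ends (fst q)) \<subseteq> J \<and> distinct (ends (fst q))"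
    "\<And>l. count (mset (labels TS)) l = card {v\<in>U. l \<in> M v}"
    "\<And>e. usage TS e \<le> of_bool (own e) + of_bool (e \<in> D)"
    by blast
  obtain arm where arm: "\<And>e. e \<in> E0 \<Longrightarrow> \<exists>x\<in>e. \<exists>c\<in>N x. arm e = {c, x} \<and> (own (arm e) \<and> arm e \<in> D \<longrightarrow> arm e \<in> TE)"
    using choose_arms[OF D(2)] by blast
  define c where "c e = (of_bool (e = {l, x}) - of_bool (e = {v, x}) :: real)" for e
  have fin: "finite (EJ \<union> E0)" using finite_EJ by simp
  have lv: "l \<in> J" "v \<in> J" "l \<noteq> x" "v \<noteq> x" using D(3-5) by (auto simp: in_N X_def)
  have real: "realizes (EJ \<union> E0) ((l, v, -1), c)"
  proof -
    have "(\<Sum>e\<in>EJ \<union> E0. c e * ind e y) = tform (l, v, -1) y" for y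
      unfolding c_def left_diff_distrib sum_subtractf
      using sum_arm[OF fin, of l x y] sum_arm[OF fin, of v x y] arm_in_EJ[OF D(4)] arm_in_EJ[OF D(5)] lv
      by (simp add: tform_def)
    then show ?thesis by (simp add: realizes_def)
  qed
  have cM: "card {w\<in>U. l' \<in> M w} + of_bool (l' = l) = card {w\<in>U. l' \<in> Mv w}" for l'
  proof (cases "l' = l")
    case True
    have "{w\<in>U. l' \<in> Mv w} = insert u {w\<in>U. l' \<in> M w}" "u \<notin> {w\<in>U. l' \<in> M w}"
      using True D(9,10) by (auto simp: M_def S_def)
    then show ?thesis using True finite_U by simp
  next
    case False
    then have "{w\<in>U. l' \<in> M w} = {w\<in>U. l' \<in> Mv w}" by (auto simp: M_def)
    then show ?thesis using False by simp
  qed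
  show ?thesis
  proof (rule block_good[where TS = TS and sg = "[((l, v, -1), c)]" and arm = arm])
    show "realizes (EJ \<union> E0) q \<and> set (ends (fst q)) \<subseteq> J \<and> distinct (ends (fst q))"
      if "q \<in> set (TS @ [((l, v, -1), c)])" for q
      using that TS(1)[of q] real lv D(6) by auto
    show "count (mset (labels TS @ map (\<lambda>q. fst (fst q)) [((l, v, -1), c)])) l' = card {x\<in>X. l' \<in> N x}"
      if "l' \<in> J" for l'
      using TS(2)[of l'] cM[of l'] token_count[OF that] by (cases "l = l'") simp_all
    show "\<exists>x\<in>e. \<exists>c\<in>N x. arm e = {c, x}" if "e \<in> E0" for e using arm[OF that] by blast
    fix e
    have TE: "e \<notin> TE" using T by (simp add: TE_def)
    have 1: "2 * (of_bool (own e) + of_bool (e \<in> D)) + of_bool (e \<in> TE) + of_bool (e \<in> arm ` E0) \<le> (4 :: nat)"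
      by (rule load_bound[OF D(1) _ arm]) (use T in auto)
    have 2: "usage [((l, v, -1), c)] e + of_bool (e \<in> D) \<le> 1"
      using D(7,8) by (auto simp: c_def)
    have 3: "of_bool (own e) \<le> (1::nat)" "of_bool (e \<in> arm ` E0) \<le> (1::nat)" "of_bool (e \<in> TE) = (0::nat)"
      using TE by simp_all
    \<comment> \<open>An edge of the single form is not in \<open>D\<close>: two uses for its token,
      one for the single form and one as an arm make at most four.\<close>
    have "2 * n + s + t + r \<le> 4" if "2 * (p + d) + t + r \<le> 4" "n \<le> p + d" "s + d \<le> 1" "p \<le> 1" "r \<le> 1" "t = 0"
      for p d t r n s :: nat using that by (cases d) auto
    from this[OF 1 TS(3) 2 3] show "2 * usage TS e + usage [((l, v, -1), c)] e
      + of_bool (e \<in> TE) + of_bool (e \<in> arm ` E0) \<le> (4 :: nat)"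
      .
  qed (use assms in auto)
qed

theorem core_good:
  assumes "good (E - (EJ \<union> E0))"
  shows "good E"
  using good_even good_odd_dummy good_odd_tokens assms by blast

end


section \<open>Choice of the labels\<close>

locale nice_graph =
  fixes E :: "'a set set"
  assumes finE: "finite E" and card2: "\<And>e. e \<in> E \<Longrightarrow> card e = 2"
    and nice: "\<And>e. e \<in> E \<Longrightarrow> \<exists>e'\<in>E. e' \<noteq> e \<and> e \<inter> e' \<noteq> {}"
    and ne: "E \<noteq> {}"
begin

definition adj where "adj u v \<longleftrightarrow> {u, v} \<in> E"
definition nbrs where "nbrs A v = {u\<in>A. adj u v}"
definition V where "V = \<Union>E"
definition deg where "deg v = card (nbrs V v)"

lemma adj_sym: "adj u v \<longleftrightarrow> adj v u" by (simp add: adj_def insert_commute)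
lemma adj_irrefl: "\<not> adj u u" using card2[of "{u, u}"] by (auto simp: adj_def)
lemma adj_V: "adj u v \<Longrightarrow> u \<in> V \<and> v \<in> V" by (auto simp: adj_def V_def)

lemma edge_cases:
  assumes "e \<in> E" "u \<in> e"
  obtains v where "e = {u, v}" "adj u v"
proof -
  obtain a b where ab: "e = {a, b}" using card2[OF assms(1)] by (auto simp: card_2_iff)
  consider "u = a" | "u = b" using assms(2) ab by blast
  then show thesis
  proof cases
    case 1
    show thesis by (rule that[of b]) (use 1 ab assms(1) in \<open>simp_all add: adj_def\<close>)
  next
    case 2
    show thesis by (rule that[of a]) (use 2 ab assms(1) in \<open>simp_all add: adj_def insert_commute\<close>)
  qed
qed

lemma finite_V: "finite V"
  unfolding V_def
proof (rule finite_Union[OF finE])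
  fix e assume "e \<in> E"
  then have "card e = 2" by (rule card2)
  then show "finite e" by (simp add: card_ge_0_finite)
qed

lemma V_adj: "v \<in> V \<Longrightarrow> \<exists>u. adj v u"
  unfolding V_def by (metis UnionE edge_cases)

definition indep where "indep I \<longleftrightarrow> I \<subseteq> V \<and> (\<forall>u\<in>I. \<forall>v\<in>I. \<not> adj u v)"
text \<open>Orders sets lexicographically by size and then by degree sum.\<close>

definition val where "val I = card I * Suc (\<Sum>v\<in>V. deg v) + (\<Sum>v\<in>I. deg v)"
definition best where "best I \<longleftrightarrow> indep I \<and> (\<forall>I'. indep I' \<longrightarrow> val I' \<le> val I)"

lemma best_exists: "\<exists>I. best I"
proof -
  have "finite {I. indep I}" by (rule finite_subset[of _ "Pow V"]) (use finite_V in \<open>auto simp: indep_def\<close>)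
  moreover have "{I. indep I} \<noteq> {}" by (auto simp: indep_def intro!: exI[of _ "{}"])
  ultimately obtain I where "I \<in> {I. indep I}" "\<forall>I'\<in>{I. indep I}. val I' \<le> val I"
    using Max_in[of "val ` {I. indep I}"] Max_ge[of "val ` {I. indep I}"] by fastforce
  then show ?thesis by (auto simp: best_def)
qed

lemma val_less:
  assumes "I \<subseteq> V" "I' \<subseteq> V" "card I < card I'"
  shows "val I < val I'"
proof -
  have "(\<Sum>v\<in>I. deg v) \<le> (\<Sum>v\<in>V. deg v)" using assms finite_V by (intro sum_mono2) auto
  then have "val I < Suc (card I) * Suc (\<Sum>v\<in>V. deg v)" by (simp add: val_def)
  also have "\<dots> \<le> card I' * Suc (\<Sum>v\<in>V. deg v)" using assms(3) by (intro mult_le_mono1) simp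
  also have "\<dots> \<le> val I'" by (simp add: val_def)
  finally show ?thesis .
qed

lemma best_dominates:
  assumes "best I" "x \<in> V" "x \<notin> I"
  shows "nbrs I x \<noteq> {}"
proof
  assume e: "nbrs I x = {}"
  have I: "indep I" "finite I" using assms finite_V finite_subset by (auto simp: best_def indep_def)
  have "indep (insert x I)"
    using I assms(2) e adj_irrefl adj_sym by (auto simp: indep_def nbrs_def)
  moreover have "val I < val (insert x I)"
    by (rule val_less) (use I assms in \<open>auto simp: indep_def\<close>)
  ultimately show False using assms(1) by (auto simp: best_def not_le[symmetric])
qed

text \<open>If they were not adjacent, both could replace \<open>w\<close> and give a larger
  independent set.\<close>

lemma best_privates_adjacent:
  assumes "best I" "y1 \<in> V" "y2 \<in> V" "y1 \<notin> I" "y2 \<notin> I" "y1 \<noteq> y2" "nbrs I y1 = {w}" "nbrs I y2 = {w}"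
  shows "adj y1 y2"
proof (rule ccontr)
  assume na: "\<not> adj y1 y2"
  have I: "indep I" "finite I" using assms finite_V finite_subset by (auto simp: best_def indep_def)
  have w: "w \<in> I" using assms(7) by (auto simp: nbrs_def)
  have n: "\<not> adj u y1" "\<not> adj u y2" "\<not> adj y1 u" "\<not> adj y2 u" if "u \<in> I - {w}" for u
    using assms(7,8) that adj_sym unfolding nbrs_def by blast+
  define I' where "I' = insert y1 (insert y2 (I - {w}))"
  have "indep I'"
    using I assms(2,3) n na adj_irrefl adj_sym[of y1 y2] unfolding indep_def I'_def by blast
  moreover have "card I' = Suc (card I)"
  proof -
    have "card I > 0" using w I by (auto simp: card_gt_0_iff)
    then show ?thesis unfolding I'_def using assms I w by simp
  qed
  then have "val I < val I'"
    by (intro val_less) (use I \<open>indep I'\<close> in \<open>auto simp: indep_def\<close>)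
  ultimately show False using assms(1) by (auto simp: best_def not_le[symmetric])
qed

text \<open>This is the purpose of the degree sum: exchanging the leaf \<open>w\<close> for
  \<open>x\<close> keeps the size, while \<open>nice\<close> gives \<open>x\<close> a second
  neighbour and thus a larger degree.\<close>

lemma best_leaf:
  assumes "best I" "w \<in> I" "nbrs V w = {x}"
  shows "nbrs I x \<noteq> {w}"
proof
  assume e: "nbrs I x = {w}"
  have I: "indep I" "finite I" using assms finite_V finite_subset by (auto simp: best_def indep_def)
  have xw: "adj x w" "x \<in> V" using assms(3) by (auto simp: nbrs_def)
  have xI: "x \<notin> I" using I(1) xw assms(2) by (auto simp: indep_def)
  have n: "\<not> adj u x" "\<not> adj x u" if "u \<in> I - {w}" for u
    using e that adj_sym unfolding nbrs_def by blast+
  define I' where "I' = insert x (I - {w})"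
  have "indep I'"
    using I xw n adj_irrefl unfolding indep_def I'_def by blast
  moreover have "val I < val I'"
  proof -
    have "card I > 0" using assms(2) I by (auto simp: card_gt_0_iff)
    then have c: "card I' = card I" unfolding I'_def using assms I xI by simp
    obtain e' where e': "e' \<in> E" "e' \<noteq> {x, w}" "{x, w} \<inter> e' \<noteq> {}" using nice[of "{x, w}"] xw by (auto simp: adj_def)
    have "x \<in> e'"
    proof (rule ccontr)
      assume "x \<notin> e'"
      then have "w \<in> e'" using e' by auto
      then obtain z where z: "e' = {w, z}" "adj w z" using e'(1) edge_cases by blast
      then have "z \<in> nbrs V w" using adj_V adj_sym by (auto simp: nbrs_def)
      then show False using assms(3) z \<open>x \<notin> e'\<close> by auto
    qed
    then obtain z where z: "e' = {x, z}" "adj x z" using e'(1) edge_cases by blast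
    have "{w, z} \<subseteq> nbrs V x" using z xw adj_V adj_sym by (auto simp: nbrs_def)
    moreover have "w \<noteq> z" using z e' by auto
    moreover have "finite (nbrs V x)" using finite_V by (simp add: nbrs_def)
    ultimately have "2 \<le> deg x" unfolding deg_def using card_mono[of "nbrs V x" "{w, z}"] by simp
    moreover have "deg w = 1" using assms(3) by (simp add: deg_def)
    moreover have "(\<Sum>v\<in>I. deg v) = deg w + (\<Sum>v\<in>I - {w}. deg v)" using I assms(2) by (simp add: sum.remove)
    moreover have "(\<Sum>v\<in>I'. deg v) = deg x + (\<Sum>v\<in>I - {w}. deg v)" unfolding I'_def using I xI by simp
    ultimately show ?thesis unfolding val_def c by simp
  qed
  ultimately show False using assms(1) by (auto simp: best_def not_le[symmetric])
qed

text \<open>\<open>P\<close> collects the second vertices of the future matched pairs; the common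
  neighbour \<open>x\<close> will be the witness.\<close>

definition valid where
  "valid I P \<longleftrightarrow> P \<subseteq> V - I \<and> (\<forall>p\<in>P. \<exists>w\<in>I. nbrs (I \<union> P) p = {w} \<and> (\<exists>x\<in>V - (I \<union> P). adj x p \<and> adj x w))"

lemma valid_max_exists: "\<exists>P. valid I P \<and> (\<forall>P'. valid I P' \<longrightarrow> card P' \<le> card P)"
proof -
  have "finite {P. valid I P}" by (rule finite_subset[of _ "Pow V"]) (use finite_V in \<open>auto simp: valid_def\<close>)
  moreover have "{P. valid I P} \<noteq> {}" by (auto simp: valid_def intro!: exI[of _ "{}"])
  ultimately obtain P where "P \<in> {P. valid I P}" "\<forall>P'\<in>{P. valid I P}. card P' \<le> card P"
    using Max_in[of "card ` {P. valid I P}"] Max_ge[of "card ` {P. valid I P}"] by fastforce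
  then show ?thesis by auto
qed

text \<open>The labels are a component of \<open>I \<union> P\<close>, where \<open>I\<close> is a best independent set and \<open>P\<close> a largest valid
set. If a label had two private neighbours, one of them could be added to \<open>P\<close> with the other as
its witness.\<close>

theorem core_exists: "\<exists>J T. core E J T \<and> {e\<in>E. e \<inter> J \<noteq> {}} \<noteq> {}"
proof -
  obtain I where best: "best I" using best_exists by blast
  then have indep: "I \<subseteq> V" "\<And>u v. u \<in> I \<Longrightarrow> v \<in> I \<Longrightarrow> \<not> adj u v" by (auto simp: best_def indep_def)
  obtain P where P: "valid I P" "\<And>P'. valid I P' \<Longrightarrow> card P' \<le> card P" using valid_max_exists by blast
  have PV: "P \<subseteq> V - I" using P(1) by (simp add: valid_def)
  define J' where "J' = I \<union> P"
  have J'V: "J' \<subseteq> V" using PV indep by (auto simp: J'_def)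
  have finP: "finite P" using PV finite_V finite_subset by blast
  have "\<forall>p\<in>P. \<exists>w x. w \<in> I \<and> nbrs J' p = {w} \<and> x \<in> V - J' \<and> adj x p \<and> adj x w"
    using P(1) unfolding valid_def J'_def by blast
  then obtain W wit where W: "\<And>p. p \<in> P \<Longrightarrow> W p \<in> I \<and> nbrs J' p = {W p} \<and> wit p \<in> V - J' \<and> adj (wit p) p \<and> adj (wit p) (W p)"
    by metis
  \<comment> \<open>Since \<open>I\<close> dominates, the only neighbour of \<open>y\<close> in
    \<open>J'\<close> lies in \<open>I\<close>, and extremality of \<open>I\<close> can be applied
    to it.\<close>
  have nbI: "nbrs I y = {u}" "u \<in> I" if y: "y \<in> V" "y \<notin> I" "nbrs J' y = {u}" for y u
  proof -
    have sub: "nbrs I y \<subseteq> nbrs J' y" by (auto simp: nbrs_def J'_def)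
    then show "nbrs I y = {u}" using best_dominates[OF best y(1,2)] y(3) by (metis subset_singletonD)
    then show "u \<in> I" by (auto simp: nbrs_def)
  qed
  have WI: "nbrs I p = {W p}" if "p \<in> P" for p
    using nbI(1)[of p "W p"] W[OF that] that PV by blast
  have PP: "\<not> adj p q" if "p \<in> P" "q \<in> P" for p q
  proof
    assume "adj p q"
    then have "p \<in> nbrs J' q" using that by (auto simp: nbrs_def J'_def)
    then have "p = W q" using W[OF that(2)] by auto
    then show False using W[OF that(2)] PV that by auto
  qed
  have JJ: "(v \<in> P \<and> u = W v) \<or> (u \<in> P \<and> v = W u)" if uv: "u \<in> J'" "v \<in> J'" "adj u v" for u v
  proof -
    have 1: "v = W u" if "u \<in> P" "v \<in> J'" "adj v u" for u v
      using W[OF that(1)] that by (auto simp: nbrs_def)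
    consider "u \<in> P" | "v \<in> P" | "u \<in> I" "v \<in> I" using uv by (auto simp: J'_def)
    then show ?thesis using 1[of u v] 1[of v u] uv adj_sym[of u v] indep(2)[of u v] by cases auto
  qed
  \<comment> \<open>Two vertices of \<open>P\<close> with the same partner would be private
    neighbours of it and hence adjacent, but \<open>P\<close> is independent.\<close>
  have Winj: "p = q" if "p \<in> P" "q \<in> P" "W p = W q" for p q
  proof (rule ccontr)
    assume "p \<noteq> q"
    then have "adj p q" using best_privates_adjacent[OF best, of p q "W p"] WI that PV by auto
    then show False using PP that by blast
  qed
  have private_unique: "y1 = y2"
    if y: "y1 \<in> V" "y2 \<in> V" "y1 \<notin> J'" "y2 \<notin> J'" "nbrs J' y1 = {u}" "nbrs J' y2 = {u}" for y1 y2 u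
  proof (rule ccontr)
    assume neq: "y1 \<noteq> y2"
    have yI: "y1 \<notin> I" "y2 \<notin> I" "y1 \<notin> P" "y2 \<notin> P" using y by (auto simp: J'_def)
    have u: "u \<in> I" "nbrs I y1 = {u}" "nbrs I y2 = {u}"
      using nbI(2)[OF y(1) yI(1) y(5)] nbI(1)[OF y(1) yI(1) y(5)] nbI(1)[OF y(2) yI(2) y(6)] by auto
    have a: "adj y1 y2" using best_privates_adjacent[OF best y(1,2) yI(1,2) neq u(2,3)] .
    have uy: "adj u y1" "adj u y2" using y(5,6) by (auto simp: nbrs_def)
    have y1P: "\<not> adj p y1" if "p \<in> P" for p
    proof
      assume "adj p y1"
      then have "p \<in> nbrs J' y1" using that by (auto simp: nbrs_def J'_def)
      then show False using y(5) u(1) that PV by auto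
    qed
    \<comment> \<open>\<open>y1\<close> enters with partner \<open>u\<close> and witness
      \<open>y2\<close>. The old witnesses survive because \<open>y1\<close> has no neighbour in
      \<open>P\<close>.\<close>
    have "valid I (insert y1 P)"
      unfolding valid_def
    proof (intro conjI ballI)
      show "insert y1 P \<subseteq> V - I" using y yI PV by auto
      fix p assume "p \<in> insert y1 P"
      then consider "p = y1" | "p \<in> P" by blast
      then show "\<exists>w\<in>I. nbrs (I \<union> insert y1 P) p = {w} \<and> (\<exists>x\<in>V - (I \<union> insert y1 P). adj x p \<and> adj x w)"
      proof cases
        case 1
        have "nbrs (I \<union> insert y1 P) y1 = nbrs J' y1" using adj_irrefl by (auto simp: nbrs_def J'_def)
        moreover have "y2 \<in> V - (I \<union> insert y1 P)" using y yI neq by auto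
        ultimately show ?thesis using 1 u(1) y(5) a uy adj_sym by blast
      next
        case 2
        have "\<not> adj y1 p" using y1P[OF 2] adj_sym by blast
        then have "nbrs (I \<union> insert y1 P) p = nbrs J' p" by (auto simp: nbrs_def J'_def)
        moreover have "wit p \<in> V - (I \<union> insert y1 P)" using W[OF 2] \<open>\<not> adj y1 p\<close> by (auto simp: J'_def)
        ultimately show ?thesis using W[OF 2] by blast
      qed
    qed
    then have "card (insert y1 P) \<le> card P" by (rule P(2))
    then show False using yI finP by simp
  qed
  have matched_private: "nbrs J' y \<noteq> {W p} \<and> nbrs J' y \<noteq> {p}" if p: "p \<in> P" and y: "y \<in> V" "y \<notin> J'" for p y
  proof (intro conjI notI)
    assume eq: "nbrs J' y = {W p}"
    have yI: "y \<notin> I" "y \<noteq> p" "p \<in> V" "p \<notin> I" using y p PV by (auto simp: J'_def)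
    have "adj p y"
      using best_privates_adjacent[OF best yI(3) y(1) yI(4,1) _ WI[OF p] nbI(1)[OF y(1) yI(1) eq]] yI(2) by auto
    then have "p \<in> nbrs J' y" using p by (auto simp: nbrs_def J'_def)
    then show False using eq W[OF p] yI by auto
  next
    assume eq: "nbrs J' y = {p}"
    have "y \<notin> I" using y by (auto simp: J'_def)
    then have "p \<in> I" using nbI(2)[OF y(1) _ eq] by blast
    then show False using p PV by auto
  qed
  have "I \<noteq> {}"
  proof
    assume "I = {}"
    obtain e where "e \<in> E" using ne by blast
    moreover then have "e \<noteq> {}" using card2[of e] by auto
    ultimately obtain v where "v \<in> V" by (auto simp: V_def)
    then show False using best_dominates[OF best, of v] \<open>I = {}\<close> by (auto simp: nbrs_def)
  qed
  then obtain v0 where v0: "v0 \<in> I" by blast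
  \<comment> \<open>Vertices are linked along edges that meet \<open>J'\<close>; restricting to one
    component of this relation provides \<open>connected\<close>.\<close>
  define R where "R = {(a, b). adj a b \<and> (a \<in> J' \<or> b \<in> J')}"
  define C where "C = {v. (v0, v) \<in> R\<^sup>*}"
  have C0: "v0 \<in> C" by (simp add: C_def)
  have Cstep: "b \<in> C" if "a \<in> C" "adj a b" "a \<in> J' \<or> b \<in> J'" for a b
    using that by (auto simp: C_def R_def intro: rtrancl_into_rtrancl)
  define J where "J = J' \<inter> C"
  have JJ': "J \<subseteq> J'" by (auto simp: J_def)
  have v0J: "v0 \<in> J" using v0 C0 by (simp add: J_def J'_def)
  have NJ: "nbrs J x = nbrs J' x" "x \<in> C" "x \<in> V" if x: "nbrs J x \<noteq> {}" for x
  proof -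
    obtain l where l: "l \<in> J" "adj l x" using x by (auto simp: nbrs_def)
    then show xC: "x \<in> C" using Cstep[of l x] by (auto simp: J_def)
    show "x \<in> V" using adj_V l by blast
    have "l' \<in> C" if "l' \<in> J'" "adj l' x" for l' using Cstep[OF xC, of l'] that adj_sym by blast
    then show "nbrs J x = nbrs J' x" by (auto simp: nbrs_def J_def)
  qed
  have NJx: "x \<notin> J'" if "nbrs J x \<noteq> {}" "x \<notin> J" for x using NJ(2)[OF that(1)] that(2) by (auto simp: J_def)
  define T where "T = {(W p, p, wit p) | p. p \<in> P \<inter> C}"
  have Tin: "w \<in> J \<and> p \<in> J \<and> x \<notin> J \<and> adj w p \<and> adj w x \<and> adj p x \<and> p \<in> P \<and> w = W p \<and> x = wit p" if "(w, p, x) \<in> T" for w p x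
  proof -
    have p: "p \<in> P" "p \<in> C" "w = W p" "x = wit p" using that by (auto simp: T_def)
    have pJ: "p \<in> J" using p by (auto simp: J_def J'_def)
    have "adj w p" using W[OF p(1)] p(3) by (auto simp: nbrs_def)
    moreover have "w \<in> J'" using W[OF p(1)] p(3) by (auto simp: J'_def)
    moreover have "w \<in> C" using Cstep[OF p(2), of w] \<open>adj w p\<close> \<open>w \<in> J'\<close> adj_sym by blast
    moreover have "x \<notin> J" using W[OF p(1)] p(4) by (auto simp: J_def)
    moreover have "adj w x" "adj p x" using W[OF p(1)] p adj_sym by auto
    ultimately show ?thesis using pJ p by (auto simp: J_def)
  qed
  have Nset: "{l\<in>J. {l, x} \<in> E} = nbrs J x" for x by (simp add: nbrs_def adj_def)
  have span0: "sym_diff {v0} {u} \<in> espan {e\<in>E. e \<inter> J \<noteq> {}}" if "u \<in> C" for u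
  proof -
    have "(v0, u) \<in> R\<^sup>*" using that by (simp add: C_def)
    then show ?thesis
    proof (induction)
      case base
      then show ?case by simp
    next
      case (step a b)
      have ab: "adj a b" "a \<in> J' \<or> b \<in> J'" using step(2) by (auto simp: R_def)
      have aC: "a \<in> C" using step(1) by (simp add: C_def)
      have "b \<in> C" using Cstep aC ab by blast
      then have "{a, b} \<in> {e\<in>E. e \<inter> J \<noteq> {}}" using ab aC by (auto simp: adj_def J_def)
      then have "sym_diff (sym_diff {v0} {a}) {a, b} \<in> espan {e\<in>E. e \<inter> J \<noteq> {}}"
        by (intro espan_sym_diff step.IH espan_edge)
      moreover have "a \<noteq> b" using ab adj_irrefl by auto
      then have "sym_diff (sym_diff {v0} {a}) {a, b} = sym_diff {v0} {b}" by auto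
      ultimately show ?case by simp
    qed
  qed
  have "core E J T"
  proof
    show "finite E" by (rule finE)
    show "card e = 2" if "e \<in> E" for e using card2[OF that] .
    show "J \<subseteq> \<Union>E" using JJ' J'V by (auto simp: V_def)
    show "\<exists>x. (u, v, x) \<in> T \<or> (v, u, x) \<in> T" if "{u, v} \<in> E" "u \<in> J" "v \<in> J" for u v
    proof -
      have "(v \<in> P \<and> u = W v) \<or> (u \<in> P \<and> v = W u)" using JJ[of u v] that JJ' by (auto simp: adj_def)
      then show ?thesis using that by (auto simp: T_def J_def)
    qed
    show "w \<in> J \<and> p \<in> J \<and> x \<notin> J \<and> {w, p} \<in> E \<and> {w, x} \<in> E \<and> {p, x} \<in> E" if "(w, p, x) \<in> T" for w p x
      using Tin[OF that] unfolding adj_def by blast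
    show "(w, p, x) = (w', p', x')" if t: "(w, p, x) \<in> T" "(w', p', x') \<in> T" "{w, p} \<inter> {w', p'} \<noteq> {}" for w p x w' p' x'
    proof -
      note a = Tin[OF t(1)] and b = Tin[OF t(2)]
      have "W p \<notin> P" "W p' \<notin> P" using W[of p] W[of p'] a b PV by auto
      consider "w = w'" | "w = p'" | "p = w'" | "p = p'" using t(3) by blast
      then have "p = p'"
        by cases (use a b \<open>W p \<notin> P\<close> \<open>W p' \<notin> P\<close> Winj[of p p'] in metis)+
      then show ?thesis using a b by metis
    qed
    show "x = y" if "x \<notin> J" "y \<notin> J" "{l\<in>J. {l, x} \<in> E} = {w}" "{l\<in>J. {l, y} \<in> E} = {w}" for w x y
    proof -
      have n: "nbrs J x = {w}" "nbrs J y = {w}" using that by (simp_all add: Nset)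
      then have ne: "nbrs J x \<noteq> {}" "nbrs J y \<noteq> {}" by simp_all
      show ?thesis
        using private_unique[OF NJ(3)[OF ne(1)] NJ(3)[OF ne(2)] NJx[OF ne(1) that(1)] NJx[OF ne(2) that(2)]]
          n NJ(1)[OF ne(1)] NJ(1)[OF ne(2)] by metis
    qed
    show "{l\<in>J. {l, y} \<in> E} \<noteq> {w} \<and> {l\<in>J. {l, y} \<in> E} \<noteq> {p}" if t: "(w, p, x) \<in> T" and y: "y \<notin> J" for w p x y
    proof (cases "nbrs J y = {}")
      case True
      then show ?thesis by (simp add: Nset)
    next
      case False
      have "p \<in> P" "w = W p" using Tin[OF t] by auto
      then show ?thesis unfolding Nset NJ(1)[OF False]
        using matched_private[of p y] NJ(3)[OF False] NJx[OF False y] by simp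
    qed
    show "spans_pairs {e\<in>E. e \<inter> J \<noteq> {}} (J \<union> {x. x \<notin> J \<and> {l\<in>J. {l, x} \<in> E} \<noteq> {}})"
      unfolding spans_pairs_def
    proof (intro ballI)
      fix u v assume "u \<in> J \<union> {x. x \<notin> J \<and> {l\<in>J. {l, x} \<in> E} \<noteq> {}}" "v \<in> J \<union> {x. x \<notin> J \<and> {l\<in>J. {l, x} \<in> E} \<noteq> {}}"
      then have "u \<in> C" "v \<in> C" unfolding Nset using NJ(2) by (auto simp: J_def)
      from espan_sym_diff[OF span0[OF this(1)] span0[OF this(2)]]
      have "sym_diff (sym_diff {v0} {u}) (sym_diff {v0} {v}) \<in> espan {e\<in>E. e \<inter> J \<noteq> {}}" .
      moreover have "sym_diff (sym_diff {v0} {u}) (sym_diff {v0} {v}) = sym_diff {u} {v}" by auto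
      ultimately show "sym_diff {u} {v} \<in> espan {e\<in>E. e \<inter> J \<noteq> {}}" by simp
    qed
    \<comment> \<open>A lone label would have only private neighbours, hence exactly one, and be a
      leaf excluded by \<open>best_leaf\<close>.\<close>
    show "\<exists>a\<in>J. \<exists>b\<in>J. a \<noteq> b"
    proof (rule ccontr)
      assume "\<not> ?thesis"
      then have only: "l = v0" if "l \<in> J" for l using that v0J by blast
      have pr: "x \<in> V" "x \<notin> J'" "nbrs J' x = {v0}" if x: "adj v0 x" for x
      proof -
        have nx: "v0 \<in> nbrs J x" using x v0J by (simp add: nbrs_def)
        then have ne: "nbrs J x \<noteq> {}" by blast
        have "x \<noteq> v0" using x adj_irrefl by auto
        then have "x \<notin> J" using only by blast
        then show "x \<in> V" "x \<notin> J'" using NJ[OF ne] NJx[OF ne] by auto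
        have "nbrs J x = {v0}" using nx only by (auto simp: nbrs_def)
        then show "nbrs J' x = {v0}" using NJ(1)[OF ne] by simp
      qed
      obtain x where x: "adj v0 x" using V_adj[of v0] v0 indep by blast
      have "y = x" if "adj v0 y" for y
        using private_unique[OF pr(1)[OF that] pr(1)[OF x] pr(2)[OF that] pr(2)[OF x] pr(3)[OF that] pr(3)[OF x]] .
      have "nbrs V v0 = {x}"
      proof (intro set_eqI iffI)
        fix y assume "y \<in> nbrs V v0"
        then have "adj v0 y" using adj_sym[of y v0] by (simp add: nbrs_def)
        then show "y \<in> {x}" using \<open>\<And>y. adj v0 y \<Longrightarrow> y = x\<close> by blast
      next
        fix y assume "y \<in> {x}"
        then show "y \<in> nbrs V v0" using x adj_sym[of v0 x] adj_V[OF x] by (simp add: nbrs_def)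
      qed
      moreover have "nbrs I x = {v0}" using nbI(1)[of x v0] pr[OF x] by (auto simp: J'_def)
      ultimately show False using best_leaf[OF best v0] by blast
    qed
    show "{l\<in>J. {l, x} \<in> E} \<noteq> {}"
      if e: "e \<in> E" "e \<inter> J = {}" and iso: "\<And>e'. e' \<in> E \<Longrightarrow> e' \<inter> J = {} \<Longrightarrow> e' \<inter> e \<noteq> {} \<Longrightarrow> e' = e" and x: "x \<in> e" for e x
      unfolding Nset
    proof
      assume nx: "nbrs J x = {}"
      obtain y where y: "e = {x, y}" "adj x y" using edge_cases[OF e(1) x] .
      obtain e' where e': "e' \<in> E" "e' \<noteq> e" "e \<inter> e' \<noteq> {}" using nice[OF e(1)] by blast
      then have "e' \<inter> J \<noteq> {}" using iso[of e'] by blast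
      then obtain l where l: "l \<in> e'" "l \<in> J" by blast
      then obtain z where z: "e' = {l, z}" "adj l z" using edge_cases[OF e'(1) l(1)] by blast
      have "l \<notin> e" using e(2) l by blast
      then have "z \<in> e" using e'(3) z by auto
      moreover have "z \<noteq> x" using nx z l by (auto simp: nbrs_def)
      ultimately have "z = y" using y by auto
      then have ny: "nbrs J y \<noteq> {}" using z l by (auto simp: nbrs_def)
      have yC: "y \<in> C" "y \<notin> J'" using NJ(2)[OF ny] NJx[OF ny] e(2) y by auto
      have "x \<notin> J'"
      proof
        assume "x \<in> J'"
        then have "x \<in> C" using Cstep[OF yC(1), of x] y adj_sym by blast
        then show False using \<open>x \<in> J'\<close> e(2) x by (auto simp: J_def)
      qed
      \<comment> \<open>A neighbour \<open>w\<close> of \<open>x\<close> in \<open>I\<close> is not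
        in \<open>J\<close>, so the edge \<open>{w, x}\<close> survives the deletion and isolation
        forces it to be \<open>e\<close>. Then \<open>w = y\<close>, although \<open>y\<close> is
        not in \<open>J'\<close>.\<close>
      then have "nbrs I x \<noteq> {}" using best_dominates[OF best, of x] adj_V[OF y(2)] by (auto simp: J'_def)
      then obtain w where w: "w \<in> I" "adj w x" by (auto simp: nbrs_def)
      have "w \<notin> J" using nx w by (auto simp: nbrs_def)
      then have "{w, x} \<inter> J = {}" using e(2) x by auto
      then have "{w, x} = e" using iso[of "{w, x}"] w x by (auto simp: adj_def)
      then have "w = y" using y adj_irrefl w by (auto simp: doubleton_eq_iff)
      then show False using w yC by (auto simp: J'_def)
    qed
  qed
  moreover have "{e\<in>E. e \<inter> J \<noteq> {}} \<noteq> {}"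
  proof -
    obtain x where "adj v0 x" using V_adj[of v0] v0 indep by blast
    then show ?thesis using v0J by (auto simp: adj_def)
  qed
  ultimately show ?thesis by blast
qed

end

text \<open>Removing \<open>E0\<close> along with the edges at \<open>J\<close> is what keeps the
  induction going: each remaining edge still meets another remaining edge.\<close>

theorem good_nice:
  assumes "finite E" "\<And>e. e \<in> E \<Longrightarrow> card e = 2"
    and "\<And>e. e \<in> E \<Longrightarrow> \<exists>e'\<in>E. e' \<noteq> e \<and> e \<inter> e' \<noteq> {}"
  shows "good E"
  using assms
proof (induction "card E" arbitrary: E rule: less_induct)
  case less
  show ?case
  proof (cases "E = {}")
    case True
    then show ?thesis by (simp add: good_empty)
  next
    case False
    interpret nice_graph E
      by unfold_locales (rule less.prems(1), erule less.prems(2), erule less.prems(3), rule False)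
    obtain J T where JT: "core E J T" "{e\<in>E. e \<inter> J \<noteq> {}} \<noteq> {}" using core_exists by blast
    interpret c: core E J T by (rule JT(1))
    have "good (E - (c.EJ \<union> c.E0))"
    proof (rule less.hyps)
      have "E - (c.EJ \<union> c.E0) \<subset> E" using JT(2) by (auto simp: c.EJ_def)
      then show "card (E - (c.EJ \<union> c.E0)) < card E" using less.prems(1) by (rule psubset_card_mono[rotated])
      show "finite (E - (c.EJ \<union> c.E0))" using less.prems by simp
      show "card e = 2" if "e \<in> E - (c.EJ \<union> c.E0)" for e using less.prems(2) that by simp
      show "\<exists>e'\<in>E - (c.EJ \<union> c.E0). e' \<noteq> e \<and> e \<inter> e' \<noteq> {}" if e: "e \<in> E - (c.EJ \<union> c.E0)" for e
      proof -
        have "e \<inter> J = {}" using e by (auto simp: c.EJ_def)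
        then obtain e' where e': "e' \<in> E" "e' \<inter> J = {}" "e' \<inter> e \<noteq> {}" "e' \<noteq> e" using e by (auto simp: c.E0_def)
        have "e' \<notin> c.E0"
        proof
          assume "e' \<in> c.E0"
          then have "e = e'" using e' e \<open>e \<inter> J = {}\<close> unfolding c.E0_def by blast
          then show False using e' by simp
        qed
        moreover have "e' \<notin> c.EJ" using e' by (simp add: c.EJ_def)
        ultimately show ?thesis using e' by blast
      qed
    qed
    then show ?thesis by (rule c.core_good)
  qed
qed


section \<open>Finite and infinite graphs\<close>

lemma finite_list_weights:
  fixes S :: "'a set \<Rightarrow> real set" and c :: "'a \<Rightarrow> real"
  assumes "finite E" "\<And>e. e \<in> E \<Longrightarrow> card e = 2"
    and "\<And>e. e \<in> E \<Longrightarrow> \<exists>e'\<in>E. e' \<noteq> e \<and> e \<inter> e' \<noteq> {}"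
    and "\<And>e. e \<in> E \<Longrightarrow> finite (S e) \<and> 5 \<le> card (S e)"
  shows "\<exists>x. (\<forall>e\<in>E. x e \<in> S e) \<and>
    (\<forall>u v. {u, v} \<in> E \<longrightarrow> (\<Sum>e\<in>{e\<in>E. u \<in> e}. x e) + c u \<noteq> (\<Sum>e\<in>{e\<in>E. v \<in> e}. x e) + c v)"
proof (rule good_proper_weights)
  show "good E" by (rule good_nice) (fact assms)+
qed (fact assms)+

section \<open>Finitely many constraints and compactness\<close>

text \<open>The edges at the finitely many constrained vertices form a finite graph, whose isolated
  edges are discarded. No edge at a constrained vertex is lost: it equals or meets a constrained
  edge, and that edge meets another one since the whole graph has no isolated edge. So weighted
  degrees there are computed within \<open>E\<close>.\<close>

lemma finite_constraints_satisfiable: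
  assumes G: "simple_graph V adj" "no_isolated_edge adj"
    and Le: "\<forall>e\<in>edges adj. is_list (Le e) \<and> card (Le e) \<ge> 5"
    and C: "finite C" "\<And>u v. (u, v) \<in> C \<Longrightarrow> adj u v \<and> finite (nbhd adj u) \<and> finite (nbhd adj v)"
  shows "\<exists>we. (\<forall>e\<in>edges adj. we e \<in> Le e) \<and> (\<forall>(u, v)\<in>C. wsum adj wv we u \<noteq> wsum adj wv we v)"
proof -
  have sym: "adj u v \<Longrightarrow> adj v u" and irr: "adj u v \<Longrightarrow> u \<noteq> v" for u v
    using G(1) unfolding simple_graph_def by blast+
  define W where "W = fst ` C \<union> snd ` C"
  have finW: "finite W" using C(1) by (simp add: W_def)
  have Wn: "finite (nbhd adj w)" if "w \<in> W" for w using that C(2) by (auto simp: W_def)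
  define EW where "EW = (\<Union>w\<in>W. (\<lambda>z. {w, z}) ` nbhd adj w)"
  have finEW: "finite EW" using finW Wn by (simp add: EW_def)
  have EWe: "EW \<subseteq> edges adj" by (auto simp: EW_def edges_def nbhd_def)
  have EW_mem: "{w, z} \<in> EW" if "w \<in> W" "adj w z" for w z using that by (auto simp: EW_def nbhd_def)
  define E where "E = {e\<in>EW. \<exists>e'\<in>EW. e' \<noteq> e \<and> e \<inter> e' \<noteq> {}}"
  have CE: "{u, v} \<in> E" "u \<in> W" "v \<in> W" if uv: "(u, v) \<in> C" for u v
  proof -
    show W: "u \<in> W" "v \<in> W" using uv by (force simp: W_def)+
    have a: "adj u v" "adj v u" using C(2)[OF uv] sym by auto
    have uvE: "{u, v} \<in> EW" using EW_mem W a by blast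
    have "nbhd adj u \<noteq> {v} \<or> nbhd adj v \<noteq> {u}" using G(2) a by (auto simp: no_isolated_edge_def)
    then have "(\<exists>z. adj u z \<and> z \<noteq> v) \<or> (\<exists>z. adj v z \<and> z \<noteq> u)" using a by (auto simp: nbhd_def)
    then have "\<exists>e'\<in>EW. e' \<noteq> {u, v} \<and> {u, v} \<inter> e' \<noteq> {}"
    proof
      assume "\<exists>z. adj u z \<and> z \<noteq> v"
      then obtain z where z: "adj u z" "z \<noteq> v" by blast
      then have "{u, z} \<noteq> {u, v}" by (auto simp: doubleton_eq_iff)
      moreover have "{u, v} \<inter> {u, z} \<noteq> {}" by simp
      ultimately show ?thesis using EW_mem[OF W(1) z(1)] by metis
    next
      assume "\<exists>z. adj v z \<and> z \<noteq> u"
      then obtain z where z: "adj v z" "z \<noteq> u" by blast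
      then have "{v, z} \<noteq> {u, v}" by (auto simp: doubleton_eq_iff)
      moreover have "{u, v} \<inter> {v, z} \<noteq> {}" by simp
      ultimately show ?thesis using EW_mem[OF W(2) z(1)] by metis
    qed
    then show "{u, v} \<in> E" using uvE by (simp add: E_def)
  qed
  have star: "{e\<in>E. w \<in> e} = (\<lambda>z. {w, z}) ` nbhd adj w" if uv: "(u, v) \<in> C" and w: "w = u \<or> w = v" for u v w
  proof (intro set_eqI iffI)
    fix e assume "e \<in> {e\<in>E. w \<in> e}"
    then have e: "e \<in> edges adj" "w \<in> e" using EWe by (auto simp: E_def)
    then obtain a b where ab: "e = {a, b}" "adj a b" by (auto simp: edges_def)
    consider "w = a" | "w = b" using e ab by auto
    then show "e \<in> (\<lambda>z. {w, z}) ` nbhd adj w"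
    proof cases
      case 1
      then show ?thesis using ab by (auto simp: nbhd_def)
    next
      case 2
      then have "e = {w, a}" "a \<in> nbhd adj w" using ab sym by (auto simp: nbhd_def)
      then show ?thesis by blast
    qed
  next
    fix e assume "e \<in> (\<lambda>z. {w, z}) ` nbhd adj w"
    then obtain z where z: "e = {w, z}" "adj w z" by (auto simp: nbhd_def)
    have uvE: "{u, v} \<in> E" "{u, v} \<in> EW" using CE(1)[OF uv] by (auto simp: E_def)
    have "e \<in> EW" using EW_mem[of w z] CE(2,3)[OF uv] w z by blast
    then have "e \<in> E"
    proof (cases "e = {u, v}")
      case True
      then show ?thesis using uvE by simp
    next
      case False
      have "e \<inter> {u, v} \<noteq> {}" using w z by auto
      then show ?thesis unfolding E_def
        using \<open>e \<in> EW\<close> uvE(2) False by (intro CollectI conjI bexI[of _ "{u, v}"]) auto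
    qed
    then show "e \<in> {e\<in>E. w \<in> e}" using z by simp
  qed
  have EE: "E \<subseteq> edges adj" using EWe by (auto simp: E_def)
  have "\<exists>x. (\<forall>e\<in>E. x e \<in> real ` Le e) \<and>
    (\<forall>u v. {u, v} \<in> E \<longrightarrow> (\<Sum>e\<in>{e\<in>E. u \<in> e}. x e) + real (wv u) \<noteq> (\<Sum>e\<in>{e\<in>E. v \<in> e}. x e) + real (wv v))"
  proof (rule finite_list_weights)
    show "finite E" using finEW by (simp add: E_def)
    show "card e = 2" if e: "e \<in> E" for e
    proof -
      have "e \<in> edges adj" using e EE by blast
      then obtain a b where "e = {a, b}" "adj a b" by (auto simp: edges_def)
      then show ?thesis using irr[of a b] by simp
    qed
    show "\<exists>e'\<in>E. e' \<noteq> e \<and> e \<inter> e' \<noteq> {}" if e: "e \<in> E" for e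
    proof -
      obtain e' where e': "e \<in> EW" "e' \<in> EW" "e' \<noteq> e" "e \<inter> e' \<noteq> {}" using e by (auto simp: E_def)
      then have "e' \<in> E" unfolding E_def by (intro CollectI conjI bexI[of _ e]) auto
      then show ?thesis using e' by blast
    qed
    show "finite (real ` Le e) \<and> 5 \<le> card (real ` Le e)" if "e \<in> E" for e
      using Le that EE by (auto simp: is_list_def card_image)
  qed
  then obtain x where x: "\<And>e. e \<in> E \<Longrightarrow> x e \<in> real ` Le e"
    "\<And>u v. {u, v} \<in> E \<Longrightarrow> (\<Sum>e\<in>{e\<in>E. u \<in> e}. x e) + real (wv u) \<noteq> (\<Sum>e\<in>{e\<in>E. v \<in> e}. x e) + real (wv v)"
    by blast
  have "\<forall>e\<in>edges adj. \<exists>n. n \<in> Le e \<and> (e \<in> E \<longrightarrow> real n = x e)"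
  proof
    fix e assume "e \<in> edges adj"
    then have "Le e \<noteq> {}" using Le by fastforce
    then show "\<exists>n. n \<in> Le e \<and> (e \<in> E \<longrightarrow> real n = x e)" using x(1)[of e] by (cases "e \<in> E") auto
  qed
  from bchoice[OF this] obtain we where we: "\<And>e. e \<in> edges adj \<Longrightarrow> we e \<in> Le e"
    "\<And>e. e \<in> E \<Longrightarrow> real (we e) = x e" using EE by blast
  have wsum: "real (wsum adj wv we w) = (\<Sum>e\<in>{e\<in>E. w \<in> e}. x e) + real (wv w)"
    if "(u, v) \<in> C" "w = u \<or> w = v" for u v w
  proof -
    have inj: "inj_on (\<lambda>z. {w, z}) (nbhd adj w)" by (auto simp: inj_on_def doubleton_eq_iff)
    have "(\<Sum>e\<in>{e\<in>E. w \<in> e}. x e) = (\<Sum>e\<in>{e\<in>E. w \<in> e}. real (we e))"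
      using we(2) by (intro sum.cong) auto
    also have "\<dots> = (\<Sum>z\<in>nbhd adj w. real (we {w, z}))"
      unfolding star[OF that] using inj by (simp add: sum.reindex)
    finally show ?thesis by (simp add: wsum_def)
  qed
  have "wsum adj wv we u \<noteq> wsum adj wv we v" if uv: "(u, v) \<in> C" for u v
    using x(2)[OF CE(1)[OF uv]] wsum[OF uv, of u] wsum[OF uv, of v] by auto
  then show ?thesis using we(1) by blast
qed

lemma compactness:
  assumes Le: "\<And>e. e \<in> A \<Longrightarrow> finite (Le e)"
    and K: "\<And>k. k \<in> F \<Longrightarrow> closedin (product_topology (\<lambda>e. discrete_topology (Le e)) A) (K k)"
    and fin: "\<And>C. finite C \<Longrightarrow> C \<subseteq> F \<Longrightarrow> \<exists>f\<in>PiE A Le. \<forall>k\<in>C. f \<in> K k"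
  shows "\<exists>f\<in>PiE A Le. \<forall>k\<in>F. f \<in> K k"
proof -
  define X where "X = product_topology (\<lambda>e. discrete_topology (Le e)) A"
  have top: "topspace X = PiE A Le" by (simp add: X_def)
  have cs: "compact_space X"
    unfolding X_def using Le by (simp add: compact_space_product_topology compact_space_discrete_topology)
  \<comment> \<open>Adding \<open>topspace X\<close> to the family keeps the common point in the
    product even if \<open>F\<close> is empty.\<close>
  have "\<Inter>(insert (topspace X) (K ` F)) \<noteq> {}"
  proof (rule cs[unfolded compact_space_fip, rule_format], intro conjI ballI allI impI)
    fix c assume "c \<in> insert (topspace X) (K ` F)"
    then show "closedin X c" using K by (auto simp: X_def[symmetric])
  next
    fix \<F> assume \<F>: "finite \<F> \<and> \<F> \<subseteq> insert (topspace X) (K ` F)"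
    then have "finite (\<F> - {topspace X})" "\<F> - {topspace X} \<subseteq> K ` F" by auto
    then obtain C where C: "C \<subseteq> F" "finite C" "\<F> - {topspace X} = K ` C"
      by (meson finite_subset_image)
    obtain f where f: "f \<in> PiE A Le" "\<forall>k\<in>C. f \<in> K k" using fin[OF C(2,1)] by blast
    have "f \<in> c" if "c \<in> \<F>" for c
    proof (cases "c = topspace X")
      case True
      then show ?thesis using f(1) top by simp
    next
      case False
      then have "c \<in> K ` C" using that C(3) by blast
      then show ?thesis using f(2) by blast
    qed
    then show "\<Inter>\<F> \<noteq> {}" by blast
  qed
  then show ?thesis using top by fastforce
qed

theorem theorem3:
  fixes V :: "'a set" and adj :: "'a \<Rightarrow> 'a \<Rightarrow> bool"
    and Lv :: "'a \<Rightarrow> nat set" and Le :: "'a set \<Rightarrow> nat set"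
  assumes "simple_graph V adj"
    and "no_isolated_edge adj"
    and "\<forall>v\<in>V. is_list (Lv v) \<and> card (Lv v) = 1"
    and "\<forall>e\<in>edges adj. is_list (Le e) \<and> card (Le e) \<ge> 5"
  shows "\<exists>wv we. L_weighting V adj Lv Le wv we"
proof -
  \<comment> \<open>The vertex lists are singletons, so the vertex weights are fixed in
    advance.\<close>
  define wv where "wv v = (SOME n. n \<in> Lv v)" for v
  have wv: "wv v \<in> Lv v" if "v \<in> V" for v
  proof -
    have "Lv v \<noteq> {}" using assms(3) that by fastforce
    then show ?thesis unfolding wv_def by (simp add: some_in_eq)
  qed
  define F where "F = {(u, v). adj u v \<and> finite (nbhd adj u) \<and> finite (nbhd adj v)}"
  define X where "X = product_topology (\<lambda>e. discrete_topology (Le e)) (edges adj)"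
  have top: "topspace X = PiE (edges adj) Le" by (simp add: X_def)
  \<comment> \<open>At a vertex of finite degree only finitely many coordinates enter.\<close>
  have cont: "continuous_map X euclideanreal (\<lambda>f. real (wsum adj wv f v))" if "finite (nbhd adj v)" for v
  proof -
    have "continuous_map X euclideanreal (\<lambda>f. real (f {v, w}))" if w: "w \<in> nbhd adj v" for w
    proof -
      have e: "{v, w} \<in> edges adj" using w by (auto simp: edges_def nbhd_def)
      have "continuous_map X (discrete_topology (Le {v, w})) (\<lambda>f. f {v, w})"
        unfolding X_def using e by (rule continuous_map_product_projection)
      moreover have "continuous_map (discrete_topology (Le {v, w})) euclideanreal real" by simp
      ultimately have "continuous_map X euclideanreal (real \<circ> (\<lambda>f. f {v, w}))"
        by (rule continuous_map_compose)
      then show ?thesis by (simp add: comp_def)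
    qed
    then have "continuous_map X euclideanreal (\<lambda>f. (\<Sum>w\<in>nbhd adj v. real (f {v, w})) + real (wv v))"
      using that by (intro continuous_map_add continuous_map_sum) auto
    then show ?thesis by (simp add: wsum_def)
  qed
  define K where "K k = {f\<in>topspace X. wsum adj wv f (fst k) \<noteq> wsum adj wv f (snd k)}" for k
  have "\<exists>f\<in>PiE (edges adj) Le. \<forall>k\<in>F. f \<in> K k"
  proof (rule compactness)
    show "finite (Le e)" if "e \<in> edges adj" for e using assms(4) that by (simp add: is_list_def)
  next
    fix k assume "k \<in> F"
    then have fin: "finite (nbhd adj (fst k))" "finite (nbhd adj (snd k))" by (auto simp: F_def)
    have "continuous_map X euclideanreal (\<lambda>f. real (wsum adj wv f (fst k)) - real (wsum adj wv f (snd k)))"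
      by (intro continuous_map_diff cont fin)
    \<comment> \<open>Weighted degrees are integers, so being different means differing by at least
      1, a closed condition.\<close>
    then have "closedin X {f\<in>topspace X. real (wsum adj wv f (fst k)) - real (wsum adj wv f (snd k)) \<in> {..-1} \<union> {1..}}"
      by (rule closedin_continuous_map_preimage) auto
    moreover have "{f\<in>topspace X. real (wsum adj wv f (fst k)) - real (wsum adj wv f (snd k)) \<in> {..-1} \<union> {1..}} = K k"
      unfolding K_def by (rule Collect_cong) auto
    ultimately show "closedin (product_topology (\<lambda>e. discrete_topology (Le e)) (edges adj)) (K k)"
      by (simp add: X_def)
  next
    fix C assume C: "finite C" "C \<subseteq> F"
    have "\<exists>we. (\<forall>e\<in>edges adj. we e \<in> Le e) \<and> (\<forall>(u, v)\<in>C. wsum adj wv we u \<noteq> wsum adj wv we v)"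
      by (rule finite_constraints_satisfiable[OF assms(1,2,4) C(1)]) (use C(2) in \<open>auto simp: F_def\<close>)
    then obtain we where we: "\<And>e. e \<in> edges adj \<Longrightarrow> we e \<in> Le e"
      "\<And>u v. (u, v) \<in> C \<Longrightarrow> wsum adj wv we u \<noteq> wsum adj wv we v" by blast
    define f where "f = restrict we (edges adj)"
    have wsum: "wsum adj wv f v = wsum adj wv we v" for v
    proof -
      have "{v, w} \<in> edges adj" if "w \<in> nbhd adj v" for w using that by (auto simp: edges_def nbhd_def)
      then show ?thesis by (simp add: wsum_def f_def)
    qed
    have fP: "f \<in> PiE (edges adj) Le" using we(1) by (auto simp: f_def)
    have "f \<in> K k" if "k \<in> C" for k
      using that fP we(2)[of "fst k" "snd k"] by (simp add: K_def top wsum)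
    then show "\<exists>f\<in>PiE (edges adj) Le. \<forall>k\<in>C. f \<in> K k" using fP by blast
  qed
  then obtain we where we: "we \<in> PiE (edges adj) Le" "\<And>k. k \<in> F \<Longrightarrow> we \<in> K k" by blast
  have "L_weighting V adj Lv Le wv we"
    unfolding L_weighting_def weighting_from_def
  proof (intro conjI ballI allI impI)
    show "wv v \<in> Lv v" if "v \<in> V" for v using wv[OF that] .
    show "we e \<in> Le e" if "e \<in> edges adj" for e using we(1) that by auto
    fix u v assume uv: "adj u v"
    show "\<not> wdeg_eq adj wv we u v \<or> same_infinite_degree adj u v"
    proof (cases "finite (nbhd adj u) \<and> finite (nbhd adj v)")
      case True
      then have "(u, v) \<in> F" using uv by (simp add: F_def)
      then have "wsum adj wv we u \<noteq> wsum adj wv we v" using we(2)[of "(u, v)"] by (simp add: K_def)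
      then show ?thesis using True by (simp add: wdeg_eq_def)
    next
      \<comment> \<open>If just one degree is infinite, the weighted degrees differ; if both are,
        their equality is equality of the infinite degrees.\<close>
      case False
      then show ?thesis by (auto simp: wdeg_eq_def same_infinite_degree_def)
    qed
  qed
  then show ?thesis by blast
qed


end
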